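(* Let $1<p<\infty$ and let $(c,d)$ be the subordinated pair for a matching pair $(a,b)\in L^\infty\times L^\infty$. If the operator $T(c):H^p\to H^p$ is right-invertible, then $$\ker(T(a)+H(b))=\varphi_+(\operatorname{im}\mathbf{P}_d^+)\dotplus \operatorname{im}\mathbf{P}_c^-,\qquad \ker(T(a)-H(b))=\varphi_-(\operatorname{im}\mathbf{P}_d^-)\dotplus \operatorname{im}\mathbf{P}_c^+,$$ where $T(a)\pm H(b)$ act on $H^p$ and $\dotplus$ denotes direct sum.
   Context: $\mathbb{T}$ is the unit circle, $L^p=L^p(\mathbb{T})$, and $H^p=\{f\in L^p:\widehat f_n=0 \text{ for } n<0\}$. $P$ is the Riesz projection of $L^p$ onto $H^p$ ($\sum_{n\in\mathbb Z}\widehat f_nt^n\mapsto\sum_{n\ge0}\widehat f_nt^n$), $Q=I-P$, and $(Jf)(t)=\overline{t}f(\overline{t})$. For $a\in L^\infty$: $\widetilde a(t)=a(1/t)$, and on $H^p$, $T(a)f=P(af)$ (Toeplitz operator), $H(a)f=PaQJf$ (Hankel operator). $GL^\infty$ is the group of invertible elements of $L^\infty$. A matching pair $(a,b)$ consists of $a\in GL^\infty$, $b\in L^\infty$ with $a\widetilde a=b\widetilde b$ (then $b\in GL^\infty$). Its subordinated pair is $(c,d)$ with $c=ab^{-1}=\widetilde b\,\widetilde a^{-1}$, $d=b\widetilde a^{-1}=a\widetilde b^{-1}$; then $c\widetilde c=d\widetilde d=1$. For $g\in L^\infty$ with $g\widetilde g=1$, $\mathbf{P}_g:=JQgP|_{\ker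 T(g)}$ maps $\ker T(g)$ into itself and $\mathbf{P}_g^2=I$; $\mathbf{P}_g^{\pm}:=\frac12(I\pm\mathbf{P}_g)$ are complementary projections on $\ker T(g)$. $T_r^{-1}(c)$ is a right inverse of $T(c)$: if $T(c)$ is Fredholm and right-invertible with index $\kappa\ge0$, then $T_r^{-1}(c):=T^{-1}(ct^{\kappa})T(t^{\kappa})$; if $\dim\ker T(c)=\infty$, it is any fixed right inverse. For $s\in\ker T(d)$, $$\varphi_\pm(s):=T_r^{-1}(c)T(\widetilde a^{-1})s\mp JQcP\,T_r^{-1}(c)T(\widetilde a^{-1})s\pm JQ\widetilde a^{-1}s.$$ *)

theory Defs
  imports "HOL-Analysis.Analysis"
begin

text \<open>Normalised arc length on the unit circle, as a measure on the complex plane.\<close>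

definition circ :: "complex measure" where
  "circ = distr (uniform_measure lborel {-pi..pi}) borel cis"

lemma sets_circ [simp, measurable_cong]: "sets circ = sets borel"
  by (simp add: circ_def)

lemma space_circ [simp]: "space circ = UNIV"
  by (simp add: circ_def)

lemma cis_measurable [measurable]: "cis \<in> borel_measurable borel"
  by (intro borel_measurable_continuous_onI continuous_intros)

lemma cnj_measurable [measurable]: "cnj \<in> borel_measurable borel"
  by (intro borel_measurable_continuous_onI continuous_intros)

lemma AE_circ_iff:
  assumes [measurable]: "Measurable.pred borel P"
  shows "(AE x in circ. P x) \<longleftrightarrow> (AE t in lborel. t \<in> {-pi..pi} \<longrightarrow> P (cis t))"
proof -
  have "(AE x in circ. P x) \<longleftrightarrow> (AE t in uniform_measure lborel {-pi..pi}. P (cis t))"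
    unfolding circ_def by (rule AE_distr_iff) measurable
  also have "\<dots> \<longleftrightarrow> (AE t in lborel. t \<in> {-pi..pi} \<longrightarrow> P (cis t))"
    by (rule AE_uniform_measure) auto
  finally show ?thesis .
qed

lemma AE_circ_cnj:
  assumes [measurable]: "Measurable.pred borel P" and "AE x in circ. P x"
  shows "AE x in circ. P (cnj x)"
proof -
  have "AE t in distr lborel borel uminus. t \<in> {-pi..pi} \<longrightarrow> P (cis t)"
    using assms(2) unfolding AE_circ_iff[OF assms(1)] lborel_distr_uminus .
  hence "AE t in lborel. - t \<in> {-pi..pi} \<longrightarrow> P (cis (- t))"
    by (subst (asm) AE_distr_iff) auto
  hence "AE t in lborel. t \<in> {-pi..pi} \<longrightarrow> P (cnj (cis t))"
    by (rule AE_mp) (auto simp: cis_cnj)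
  thus ?thesis by (subst AE_circ_iff) auto
qed

lemma AE_circ_norm: "AE x in circ. norm x = 1"
  by (subst AE_circ_iff) auto

lemma AE_circ_not_False: "\<not> (AE x in circ. False)"
proof
  assume "AE x in circ. False"
  hence "AE t in lborel. t \<notin> {-pi..pi::real}"
    by (simp add: AE_circ_iff)
  hence "emeasure lborel {-pi..pi::real} = 0"
    by (subst (asm) AE_iff_measurable[where N = "{-pi..pi}"]) auto
  thus False by (simp add: emeasure_lborel_Icc_eq)
qed

definition eq_ae :: "(complex \<Rightarrow> complex) \<Rightarrow> (complex \<Rightarrow> complex) \<Rightarrow> bool" where
  "eq_ae f g \<longleftrightarrow> f \<in> borel_measurable borel \<and> g \<in> borel_measurable borel \<and> (AE x in circ. f x = g x)"

text \<open>
  Elements of \<open>circ_fun\<close> are the measurable functions on the circle modulo almost everywhere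
  equality; values of representatives off the circle are irrelevant because the measure lives on
  the circle. The Lebesgue and Hardy spaces are subsets of this type, and an operator on a Hardy
  space is a function on this type of which only the restriction to that subset matters.
\<close>

quotient_type circ_fun = "complex \<Rightarrow> complex" / partial: eq_ae
proof (rule part_equivpI)
  show "\<exists>f. eq_ae f f"
    by (rule exI[of _ "\<lambda>_. 0"]) (auto simp: eq_ae_def)
  show "symp eq_ae"
    by (auto simp: symp_def eq_ae_def)
  show "transp eq_ae"
  proof (rule transpI)
    fix f g h
    assume fg: "eq_ae f g" and gh: "eq_ae g h"
    have "AE x in circ. f x = g x" "AE x in circ. g x = h x"
      using fg gh by (auto simp: eq_ae_def)
    hence "AE x in circ. f x = h x" by eventually_elim simp
    with fg gh show "eq_ae f h" by (simp add: eq_ae_def)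
  qed
qed

instantiation circ_fun :: "{comm_ring_1, inverse}"
begin

lift_definition zero_circ_fun :: circ_fun is "\<lambda>_. 0" by (simp add: eq_ae_def)
lift_definition one_circ_fun :: circ_fun is "\<lambda>_. 1" by (simp add: eq_ae_def)
lift_definition plus_circ_fun :: "circ_fun \<Rightarrow> circ_fun \<Rightarrow> circ_fun" is "\<lambda>f g x. f x + g x"
  by (auto simp: eq_ae_def)
lift_definition minus_circ_fun :: "circ_fun \<Rightarrow> circ_fun \<Rightarrow> circ_fun" is "\<lambda>f g x. f x - g x"
  by (auto simp: eq_ae_def)
lift_definition times_circ_fun :: "circ_fun \<Rightarrow> circ_fun \<Rightarrow> circ_fun" is "\<lambda>f g x. f x * g x"
  by (auto simp: eq_ae_def)
lift_definition uminus_circ_fun :: "circ_fun \<Rightarrow> circ_fun" is "\<lambda>f x. - f x"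
  by (auto simp: eq_ae_def)
lift_definition inverse_circ_fun :: "circ_fun \<Rightarrow> circ_fun" is "\<lambda>f x. inverse (f x)"
  by (auto simp: eq_ae_def)

definition divide_circ_fun :: "circ_fun \<Rightarrow> circ_fun \<Rightarrow> circ_fun" where
  "divide_circ_fun f g = f * inverse g"

instance
proof
  show "(0::circ_fun) \<noteq> 1"
    by transfer (simp add: eq_ae_def AE_circ_not_False)
qed (transfer; auto simp: eq_ae_def algebra_simps)+

end

lift_definition cscale :: "complex \<Rightarrow> circ_fun \<Rightarrow> circ_fun" is "\<lambda>z f x. z * f x"
  by (auto simp: eq_ae_def)

interpretation circ_fun: vector_space cscale
  by unfold_locales (transfer; simp add: eq_ae_def algebra_simps)+

lift_definition tilde :: "circ_fun \<Rightarrow> circ_fun" is "\<lambda>f t. f (1 / t)"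
proof -
  fix f g assume "eq_ae f g"
  hence [measurable]: "f \<in> borel_measurable borel" "g \<in> borel_measurable borel"
    and ae: "AE x in circ. f x = g x" by (auto simp: eq_ae_def)
  have "AE x in circ. f (cnj x) = g (cnj x)"
    by (rule AE_circ_cnj[OF _ ae]) measurable
  hence "AE x in circ. f (1 / x) = g (1 / x)"
    using AE_circ_norm
  proof eventually_elim
    case (elim x)
    hence "1 / x = cnj x"
      using complex_div_cnj[of 1 x] by simp
    thus ?case using elim by simp
  qed
  thus "eq_ae (\<lambda>t. f (1 / t)) (\<lambda>t. g (1 / t))" by (simp add: eq_ae_def)
qed

lift_definition flipJ :: "circ_fun \<Rightarrow> circ_fun" is "\<lambda>f t. cnj t * f (cnj t)"
proof -
  fix f g assume "eq_ae f g"
  hence [measurable]: "f \<in> borel_measurable borel" "g \<in> borel_measurable borel"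
    and ae: "AE x in circ. f x = g x" by (auto simp: eq_ae_def)
  have "AE x in circ. f (cnj x) = g (cnj x)"
    by (rule AE_circ_cnj[OF _ ae]) measurable
  thus "eq_ae (\<lambda>t. cnj t * f (cnj t)) (\<lambda>t. cnj t * g (cnj t))"
    by (auto simp: eq_ae_def)
qed

lemma powi_measurable [measurable]: "(\<lambda>t::complex. t powi n) \<in> borel_measurable borel"
  unfolding power_int_def by (cases "n \<ge> 0") simp_all

lift_definition tpow :: "int \<Rightarrow> circ_fun" is "\<lambda>n t. t powi n"
  by (auto simp: eq_ae_def)


lift_definition fourier :: "circ_fun \<Rightarrow> int \<Rightarrow> complex" is
  "\<lambda>f n. \<integral>t. f t * t powi (- n) \<partial>circ"
proof -
  fix f g assume "eq_ae f g"
  hence [measurable]: "f \<in> borel_measurable borel" "g \<in> borel_measurable borel"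
    and ae: "AE x in circ. f x = g x" by (auto simp: eq_ae_def)
  have "(\<integral>t. f t * t powi (- n) \<partial>circ) = (\<integral>t. g t * t powi (- n) \<partial>circ)" for n
    by (rule integral_cong_AE) (use ae in auto)
  thus "(\<lambda>n. \<integral>t. f t * t powi (- n) \<partial>circ) = (\<lambda>n. \<integral>t. g t * t powi (- n) \<partial>circ)"
    by simp
qed

lift_definition p_integrable :: "real \<Rightarrow> circ_fun \<Rightarrow> bool" is
  "\<lambda>p f. integrable circ (\<lambda>t. norm (f t) powr p)"
proof -
  fix p f g assume "eq_ae f g"
  hence [measurable]: "f \<in> borel_measurable borel" "g \<in> borel_measurable borel"
    and ae: "AE x in circ. f x = g x" by (auto simp: eq_ae_def)
  show "integrable circ (\<lambda>t. norm (f t) powr p) = integrable circ (\<lambda>t. norm (g t) powr p)"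
    by (rule integrable_cong_AE) (use ae in auto)
qed

lift_definition ess_bounded :: "circ_fun \<Rightarrow> bool" is
  "\<lambda>f. \<exists>K. AE t in circ. norm (f t) \<le> K"
proof -
  fix f g assume "eq_ae f g"
  hence ae: "AE x in circ. f x = g x" by (auto simp: eq_ae_def)
  have "(AE t in circ. norm (f t) \<le> K) \<longleftrightarrow> (AE t in circ. norm (g t) \<le> K)" for K
    using ae by (intro eventually_subst) (auto elim: eventually_mono)
  thus "(\<exists>K. AE t in circ. norm (f t) \<le> K) = (\<exists>K. AE t in circ. norm (g t) \<le> K)"
    by simp
qed

lift_definition norm_Lp :: "real \<Rightarrow> circ_fun \<Rightarrow> real" is
  "\<lambda>p f. (\<integral>t. norm (f t) powr p \<partial>circ) powr (1 / p)"
proof -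
  fix p f g assume "eq_ae f g"
  hence [measurable]: "f \<in> borel_measurable borel" "g \<in> borel_measurable borel"
    and ae: "AE x in circ. f x = g x" by (auto simp: eq_ae_def)
  have "(\<integral>t. norm (f t) powr p \<partial>circ) = (\<integral>t. norm (g t) powr p \<partial>circ)"
    by (rule integral_cong_AE) (use ae in auto)
  thus "(\<integral>t. norm (f t) powr p \<partial>circ) powr (1 / p) = (\<integral>t. norm (g t) powr p \<partial>circ) powr (1 / p)"
    by simp
qed

definition Lp :: "real \<Rightarrow> circ_fun set" where
  "Lp p = {f. p_integrable p f}"

definition Linf :: "circ_fun set" where
  "Linf = {a. ess_bounded a}"

definition GLinf :: "circ_fun set" where
  "GLinf = {a \<in> Linf. \<exists>b\<in>Linf. a * b = 1}"

definition Hp :: "real \<Rightarrow> circ_fun set" where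
  "Hp p = {f \<in> Lp p. \<forall>n<0. fourier f n = 0}"

text \<open>
  The Riesz projection maps \<open>f\<close> to the element of \<open>Lp p\<close> whose Fourier series is the analytic part
  of that of \<open>f\<close>. It is unique by uniqueness of Fourier coefficients, and for \<open>1 < p < \<infinity>\<close> it exists
  by the theorem of M. Riesz.
\<close>

definition rieszP :: "real \<Rightarrow> circ_fun \<Rightarrow> circ_fun" where
  "rieszP p f = (THE g. g \<in> Lp p \<and> (\<forall>n. fourier g n = (if 0 \<le> n then fourier f n else 0)))"

definition rieszQ :: "real \<Rightarrow> circ_fun \<Rightarrow> circ_fun" where
  "rieszQ p f = f - rieszP p f"

definition toeplitz :: "real \<Rightarrow> circ_fun \<Rightarrow> circ_fun \<Rightarrow> circ_fun" where
  "toeplitz p a f = rieszP p (a * f)"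

definition hankel :: "real \<Rightarrow> circ_fun \<Rightarrow> circ_fun \<Rightarrow> circ_fun" where
  "hankel p a f = rieszP p (a * rieszQ p (flipJ f))"

definition op_kernel :: "real \<Rightarrow> (circ_fun \<Rightarrow> circ_fun) \<Rightarrow> circ_fun set" where
  "op_kernel p A = {f \<in> Hp p. A f = 0}"

definition bounded_operator :: "real \<Rightarrow> (circ_fun \<Rightarrow> circ_fun) \<Rightarrow> bool" where
  "bounded_operator p A \<longleftrightarrow>
     (\<forall>f\<in>Hp p. A f \<in> Hp p) \<and>
     (\<forall>f\<in>Hp p. \<forall>g\<in>Hp p. A (f + g) = A f + A g) \<and>
     (\<forall>z. \<forall>f\<in>Hp p. A (cscale z f) = cscale z (A f)) \<and>
     (\<exists>K. \<forall>f\<in>Hp p. norm_Lp p (A f) \<le> K * norm_Lp p f)"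

definition right_inverse :: "real \<Rightarrow> (circ_fun \<Rightarrow> circ_fun) \<Rightarrow> (circ_fun \<Rightarrow> circ_fun) \<Rightarrow> bool" where
  "right_inverse p A R \<longleftrightarrow> bounded_operator p R \<and> (\<forall>f\<in>Hp p. A (R f) = f)"

definition right_invertible :: "real \<Rightarrow> (circ_fun \<Rightarrow> circ_fun) \<Rightarrow> bool" where
  "right_invertible p A \<longleftrightarrow> (\<exists>R. right_inverse p A R)"

definition finite_dim :: "circ_fun set \<Rightarrow> bool" where
  "finite_dim V \<longleftrightarrow> (\<exists>B. finite B \<and> V \<subseteq> circ_fun.span B)"

definition spans_coker :: "real \<Rightarrow> (circ_fun \<Rightarrow> circ_fun) \<Rightarrow> circ_fun set \<Rightarrow> bool" where
  "spans_coker p A B \<longleftrightarrow> B \<subseteq> Hp p \<and> Hp p \<subseteq> circ_fun.span (A ` Hp p \<union> B)"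

definition coker_dim :: "real \<Rightarrow> (circ_fun \<Rightarrow> circ_fun) \<Rightarrow> nat" where
  "coker_dim p A = (LEAST n. \<exists>B. finite B \<and> card B = n \<and> spans_coker p A B)"

definition closed_range :: "real \<Rightarrow> (circ_fun \<Rightarrow> circ_fun) \<Rightarrow> bool" where
  "closed_range p A \<longleftrightarrow>
     (\<forall>u. \<forall>g\<in>Hp p. (\<forall>n::nat. u n \<in> A ` Hp p) \<and> (\<lambda>n. norm_Lp p (u n - g)) \<longlonglongrightarrow> 0
        \<longrightarrow> g \<in> A ` Hp p)"

text \<open>
  This is the Fredholm property for bounded linear operators \<open>A\<close> on \<open>Hp p\<close>. The cokernel dimension
  is measured as the least number of vectors spanning \<open>Hp p\<close> modulo the range.
\<close>

definition fredholm :: "real \<Rightarrow> (circ_fun \<Rightarrow> circ_fun) \<Rightarrow> bool" where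
  "fredholm p A \<longleftrightarrow>
     finite_dim (op_kernel p A) \<and> closed_range p A \<and> (\<exists>B. finite B \<and> spans_coker p A B)"

definition fredholm_index :: "real \<Rightarrow> (circ_fun \<Rightarrow> circ_fun) \<Rightarrow> int" where
  "fredholm_index p A = int (circ_fun.dim (op_kernel p A)) - int (coker_dim p A)"

text \<open>
  \<open>toeplitz_right_inverse p c R\<close> says that \<open>R\<close> is an admissible choice of the right inverse
  \<open>T\<^sub>r\<^sup>-\<^sup>1(c)\<close> of \<open>T(c)\<close>: it is prescribed on \<open>Hp p\<close> in the Fredholm case, and is an arbitrary right
  inverse if the kernel of \<open>T(c)\<close> is infinite-dimensional. For right-invertible \<open>T(c)\<close> exactly one
  of the two cases occurs, since a right-invertible operator is onto.
\<close>

definition toeplitz_right_inverse :: "real \<Rightarrow> circ_fun \<Rightarrow> (circ_fun \<Rightarrow> circ_fun) \<Rightarrow> bool" where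
  "toeplitz_right_inverse p c R \<longleftrightarrow>
     (fredholm p (toeplitz p c) \<and> right_invertible p (toeplitz p c) \<longrightarrow>
        (let \<kappa> = fredholm_index p (toeplitz p c) in
         \<forall>f\<in>Hp p. R f =
           inv_into (Hp p) (toeplitz p (c * tpow \<kappa>)) (toeplitz p (tpow \<kappa>) f))) \<and>
     (\<not> finite_dim (op_kernel p (toeplitz p c)) \<longrightarrow> right_inverse p (toeplitz p c) R)"

definition matching_pair :: "circ_fun \<Rightarrow> circ_fun \<Rightarrow> bool" where
  "matching_pair a b \<longleftrightarrow> a \<in> GLinf \<and> b \<in> Linf \<and> a * tilde a = b * tilde b"

definition subordinated_pair :: "circ_fun \<Rightarrow> circ_fun \<Rightarrow> circ_fun \<Rightarrow> circ_fun \<Rightarrow> bool" where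
  "subordinated_pair a b c d \<longleftrightarrow> c = a * inverse b \<and> d = b * inverse (tilde a)"

definition PP :: "real \<Rightarrow> circ_fun \<Rightarrow> circ_fun \<Rightarrow> circ_fun" where
  "PP p g f = flipJ (rieszQ p (g * rieszP p f))"

definition PP_plus :: "real \<Rightarrow> circ_fun \<Rightarrow> circ_fun \<Rightarrow> circ_fun" where
  "PP_plus p g f = cscale (1 / 2) (f + PP p g f)"

definition PP_minus :: "real \<Rightarrow> circ_fun \<Rightarrow> circ_fun \<Rightarrow> circ_fun" where
  "PP_minus p g f = cscale (1 / 2) (f - PP p g f)"

definition im_PP_plus :: "real \<Rightarrow> circ_fun \<Rightarrow> circ_fun set" where
  "im_PP_plus p g = PP_plus p g ` op_kernel p (toeplitz p g)"

definition im_PP_minus :: "real \<Rightarrow> circ_fun \<Rightarrow> circ_fun set" where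
  "im_PP_minus p g = PP_minus p g ` op_kernel p (toeplitz p g)"

definition phi_plus ::
  "real \<Rightarrow> circ_fun \<Rightarrow> circ_fun \<Rightarrow> (circ_fun \<Rightarrow> circ_fun) \<Rightarrow> circ_fun \<Rightarrow> circ_fun" where
  "phi_plus p a c R s =
     R (toeplitz p (inverse (tilde a)) s)
     - flipJ (rieszQ p (c * rieszP p (R (toeplitz p (inverse (tilde a)) s))))
     + flipJ (rieszQ p (inverse (tilde a) * s))"

definition phi_minus ::
  "real \<Rightarrow> circ_fun \<Rightarrow> circ_fun \<Rightarrow> (circ_fun \<Rightarrow> circ_fun) \<Rightarrow> circ_fun \<Rightarrow> circ_fun" where
  "phi_minus p a c R s =
     R (toeplitz p (inverse (tilde a)) s)
     + flipJ (rieszQ p (c * rieszP p (R (toeplitz p (inverse (tilde a)) s))))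
     - flipJ (rieszQ p (inverse (tilde a) * s))"

definition is_direct_sum :: "circ_fun set \<Rightarrow> circ_fun set \<Rightarrow> circ_fun set \<Rightarrow> bool" where
  "is_direct_sum W U V \<longleftrightarrow>
     circ_fun.subspace U \<and> circ_fun.subspace V \<and> U \<inter> V = {0} \<and> W = {u + v | u v. u \<in> U \<and> v \<in> V}"

end

(*
  Put J f(t) = t^{-1} f(1/t), which interchanges H^p and its complement QL^p, and let e = +1 or -1.
  For f in H^p one has T(a)f + eH(b)f = P(af + ebJf), so f lies in the kernel iff
  psi(f) := J(af + ebJf) lies in H^p. The matching condition turns this into
  d psi(f) = e J psi(f), which says that psi(f) lies in the image of P_d^{+-} (sign e), while
  psi(f) = 0 says that cf = -eJf, i.e. that f lies in the image of P_c^{-+} (sign -e). Since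
  psi(phi(s)) = 2es, the map phi splits psi, which gives the direct sum.

  Two analytic facts are needed. The Riesz projection has to exist on L^p: for 1 < p <= 2 the
  estimate |z|^p <= A (Re z)^p - B Re(z^p) on the right half plane and the mean value property
  bound an analytic polynomial by its real part, Cotlar's identity doubles p, and density of the
  trigonometric polynomials does the rest. In the Fredholm case T(ct^kappa) has to be
  invertible: as T(c) is onto, this follows from H^p = ker T(c) + t^kappa H^p.
*)
theory Submission
  imports Defs "HOL-Complex_Analysis.Complex_Analysis"
begin

text \<open>Where \<phi> comes from: look for f = w - e J x with w in H^p and x in QL^p. If c w - x
  = s / tilde a, then multiplying by b gives a w - b x = d s, while applying J and multiplying by a
  gives b J w - a J x = J s. Added with the sign e, these make a f + e b J f = d s + e J s = 2 e J
  s. The equation for w and x is a Riemann-Hilbert problem whose analytic part is T(c) w = T(1 /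
  tilde a) s; the right inverse of T(c) solves it.

  A bound by the real part leads to the Riesz projection because, up to its mean, a trigonometric
  polynomial has real and imaginary parts that are real parts of analytic polynomials.

  In the Fredholm case the right inverse is given only through \<open>inv_into\<close>, so even its
  linearity has to come from the bijectivity of T(c t^kappa). The decomposition behind that rests on
  orders of vanishing at the origin: division by a power of t maps QL^p into itself, so it does not
  lead out of ker T(c) as long as the quotient stays analytic.\<close>

section \<open>Integration on the circle\<close>

lemma measure_circ_UNIV [simp]: "measure circ UNIV = 1"
  by (simp add: circ_def measure_distr emeasure_lborel_Icc_eq)

interpretation circ: finite_measure circ
  by standard (simp add: circ_def emeasure_distr emeasure_lborel_Icc_eq)

lemma inverse_eq_cnj: "norm (t::complex) = 1 \<Longrightarrow> inverse t = cnj t"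
  using complex_div_cnj[of 1 t] by (simp add: divide_inverse)

lemma borel_measurable_poly [measurable]: "(\<lambda>t::complex. poly F t) \<in> borel_measurable borel"
  by (intro borel_measurable_continuous_onI continuous_intros)

lemma integral_circ:
  fixes f :: "complex \<Rightarrow> 'b::{banach, second_countable_topology}"
  assumes [measurable]: "f \<in> borel_measurable borel"
  shows "(\<integral>t. f t \<partial>circ) = (\<integral>x. (indicator {-pi..pi} x / (2 * pi)) *\<^sub>R f (cis x) \<partial>lborel)"
proof -
  have *: "uniform_measure lborel {-pi..pi} = density lborel (\<lambda>x. ennreal (indicator {-pi..pi} x / (2 * pi)))"
    unfolding uniform_measure_def
  proof (rule density_cong)
    show "AE x in lborel. indicator {-pi..pi} x / emeasure lborel {-pi..pi} =
            ennreal (indicator {-pi..pi} x / (2 * pi))"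
      by (auto simp: emeasure_lborel_Icc_eq indicator_def divide_ennreal ennreal_1[symmetric]
          simp del: ennreal_1)
  qed auto
  have "(\<integral>t. f t \<partial>circ) = (\<integral>x. f (cis x) \<partial>uniform_measure lborel {-pi..pi})"
    unfolding circ_def by (rule integral_distr) auto
  also have "\<dots> = (\<integral>x. (indicator {-pi..pi} x / (2 * pi)) *\<^sub>R f (cis x) \<partial>lborel)"
    unfolding * by (rule integral_density) (auto simp: indicator_def)
  finally show ?thesis .
qed

lemma circ_mean_value:
  assumes [measurable]: "F \<in> borel_measurable borel"
    and cont: "continuous_on (cball 0 1) F" and hol: "F holomorphic_on ball 0 1"
  shows "(\<integral>t. F t \<partial>circ) = F 0"
proof -
  \<comment> \<open>\<open>circlepath\<close> runs over the angles [0, 2 pi], whereas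
    \<open>circ\<close> uses [-pi, pi]. The half turn from z to -z reconciles them: after the shift
    by pi, \<open>G (cis (x + pi))\<close> is again \<open>F (cis x)\<close>.\<close>
  define G where "G = (\<lambda>z. F (-z))"
  have "((\<lambda>u. G u / (u - 0)) has_contour_integral (2 * of_real pi * \<i> * G 0)) (circlepath 0 1)"
  proof (rule Cauchy_integral_circlepath)
    show "continuous_on (cball 0 1) G" unfolding G_def
      by (rule continuous_on_compose2[OF cont]) (auto intro: continuous_on_minus continuous_on_id)
    have "(F \<circ> uminus) holomorphic_on ball 0 1"
      by (rule holomorphic_on_compose_gen[OF _ hol]) (auto intro: holomorphic_on_minus holomorphic_on_ident)
    then show "G holomorphic_on ball 0 1" by (simp add: G_def comp_def)
  qed auto
  then have "((\<lambda>t. G (cis t) / cis t * \<i> * cis t) has_integral (2 * of_real pi * \<i> * G 0)) {0..2*pi}"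
    unfolding circlepath_def by (subst (asm) has_contour_integral_part_circlepath_iff) (auto simp: mult.assoc)
  then have "((\<lambda>t. \<i> * G (cis t)) has_integral (\<i> * (2 * of_real pi * G 0))) {0..2*pi}"
    by (simp add: mult_ac)
  from has_integral_mult_right[OF this, of "-\<i>"]
  have "((\<lambda>t. G (cis t)) has_integral (2 * of_real pi * G 0)) {0..2*pi}"
    by (simp add: mult.assoc[symmetric])
  from has_integral_affinity[OF this[folded cbox_interval], of 1 pi]
  have "((\<lambda>x. G (cis (x + pi))) has_integral (2 * of_real pi * G 0)) {-pi..pi}"
    by (simp add: cbox_interval algebra_simps)
  moreover have "G (cis (x + pi)) = F (cis x)" for x
    by (simp add: G_def cis_mult[symmetric])
  ultimately have H: "((\<lambda>x. F (cis x)) has_integral (2 * of_real pi * F 0)) {-pi..pi}"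
    by (simp add: G_def)
  have "continuous_on {-pi..pi} (\<lambda>x. F (cis x))"
    by (rule continuous_on_compose2[OF cont]) (auto intro!: continuous_intros)
  then have "set_integrable lborel {-pi..pi} (\<lambda>x. F (cis x))"
    using borel_integrable_atLeastAtMost'[of "-pi" pi "\<lambda>x. F (cis x)"] by simp
  from set_borel_integral_eq_integral(2)[OF this] H
  have "(LINT x:{-pi..pi}|lborel. F (cis x)) = 2 * of_real pi * F 0"
    by (simp add: integral_unique)
  then have "(\<integral>x. (1 / (2 * pi)) *\<^sub>R (indicator {-pi..pi} x *\<^sub>R F (cis x)) \<partial>lborel) = F 0"
    by (simp add: set_lebesgue_integral_def scaleR_conv_of_real)
  moreover have "(1 / (2 * pi)) *\<^sub>R (indicator {-pi..pi} x *\<^sub>R F (cis x)) =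
      (indicator {-pi..pi} x / (2 * pi)) *\<^sub>R F (cis x)" for x
    by simp
  ultimately show ?thesis
    by (simp add: integral_circ)
qed

lemma integrable_circ_bounded:
  fixes f :: "complex \<Rightarrow> 'b::{banach, second_countable_topology}"
  assumes "f \<in> borel_measurable borel" and "\<And>t. norm t = 1 \<Longrightarrow> norm (f t) \<le> K"
  shows "integrable circ f"
proof (rule circ.integrable_const_bound)
  show "AE t in circ. norm (f t) \<le> K"
    using AE_circ_norm by eventually_elim (use assms(2) in auto)
  show "f \<in> borel_measurable circ"
    using assms(1) by simp
qed

lemma integrable_circ_continuous:
  fixes f :: "complex \<Rightarrow> 'b::{banach, second_countable_topology}"
  assumes "f \<in> borel_measurable borel" and "continuous_on (sphere 0 1) f"
  shows "integrable circ f"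
proof -
  have "bounded (f ` sphere 0 1)"
    by (intro compact_imp_bounded compact_continuous_image assms compact_sphere)
  then obtain K where "\<And>t. t \<in> sphere 0 1 \<Longrightarrow> norm (f t) \<le> K"
    unfolding bounded_iff by blast
  then show ?thesis
    by (intro integrable_circ_bounded[OF assms(1), of K]) auto
qed

lemma integral_circ_mono:
  fixes f g :: "complex \<Rightarrow> real"
  assumes "integrable circ f" "integrable circ g" and "\<And>t. norm t = 1 \<Longrightarrow> f t \<le> g t"
  shows "(\<integral>t. f t \<partial>circ) \<le> (\<integral>t. g t \<partial>circ)"
  by (rule integral_mono_AE[OF assms(1,2)])
     (use AE_circ_norm in eventually_elim, use assms(3) in auto)

lemma integrable_circ_mono:
  fixes f :: "complex \<Rightarrow> 'b::{banach, second_countable_topology}" and g :: "complex \<Rightarrow> real"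
  assumes "integrable circ g" "f \<in> borel_measurable borel" "\<And>t. norm t = 1 \<Longrightarrow> norm (f t) \<le> g t"
  shows "integrable circ f"
proof (rule Bochner_Integration.integrable_bound[OF assms(1)])
  show "AE t in circ. norm (f t) \<le> norm (g t)"
    using AE_circ_norm by eventually_elim (use assms(3) in force)
qed (use assms(2) in simp)

section \<open>Inequalities for p-th powers\<close>

text \<open>A crude form of Minkowski's inequality: a sum is at most twice its larger term. Later
  estimates compare integrals of p-th powers and pay the factor \<open>2 powr p\<close> for each
  splitting.\<close>

lemma powr_add_le:
  fixes x y p :: real
  assumes "0 \<le> x" "0 \<le> y" "0 \<le> p"
  shows "(x + y) powr p \<le> 2 powr p * (x powr p + y powr p)"
proof -
  have "(x + y) powr p \<le> (2 * max x y) powr p"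
    using assms by (intro powr_mono2) auto
  also have "\<dots> = 2 powr p * max x y powr p"
    using assms by (simp add: powr_mult)
  also have "max x y powr p \<le> x powr p + y powr p"
    by (auto simp: max_def)
  finally show ?thesis by simp
qed

lemma norm_add_powr_le:
  fixes x y :: "'a::real_normed_vector"
  assumes "0 \<le> p"
  shows "norm (x + y) powr p \<le> 2 powr p * (norm x powr p + norm y powr p)"
proof -
  have "norm (x + y) powr p \<le> (norm x + norm y) powr p"
    using assms by (intro powr_mono2 norm_triangle_ineq) auto
  also have "\<dots> \<le> 2 powr p * (norm x powr p + norm y powr p)"
    using assms by (intro powr_add_le) auto
  finally show ?thesis .
qed

lemma norm_diff_powr_le:
  fixes x y :: "'a::real_normed_vector"
  assumes "0 \<le> p"
  shows "norm (x - y) powr p \<le> 2 powr p * (norm x powr p + norm y powr p)"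
  using norm_add_powr_le[OF assms, of x "-y"] by simp

text \<open>For x > \<delta>, write x = x powr (1 - p) * x powr p and estimate the decreasing first
  factor at \<delta>. Leaving \<delta> free allows its best value to be chosen after integration,
  which compares the L^1 norm with the L^p norm.\<close>

lemma le_powr_scaled:
  fixes x \<delta> p :: real
  assumes "0 \<le> x" "0 < \<delta>" "1 < p"
  shows "x \<le> \<delta> + \<delta> powr (1 - p) * x powr p"
proof (cases "x \<le> \<delta>")
  case True
  then show ?thesis by (simp add: add_increasing2)
next
  case False
  then have "\<delta> powr (p - 1) \<le> x powr (p - 1)"
    using assms by (intro powr_mono2) auto
  moreover have "\<delta> powr (1 - p) = inverse (\<delta> powr (p - 1))"
    by (metis minus_diff_eq powr_minus)
  moreover have "0 < \<delta> powr (p - 1)"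
    using assms by simp
  ultimately have "\<delta> powr (p - 1) * inverse (\<delta> powr (p - 1)) \<le> x powr (p - 1) * \<delta> powr (1 - p)"
    by (intro mult_mono) auto
  then have "1 \<le> \<delta> powr (1 - p) * x powr (p - 1)"
    using assms by (simp add: mult.commute)
  then have "x * 1 \<le> x * (\<delta> powr (1 - p) * x powr (p - 1))"
    using assms by (intro mult_left_mono) auto
  also have "\<dots> = \<delta> powr (1 - p) * x powr p"
    using assms False by (simp add: powr_diff)
  finally show ?thesis using assms by simp
qed

section \<open>Analytic polynomials and their real parts\<close>

text \<open>For \<open>p \<le> 2\<close> the harmonic function \<open>- Re (z powr p)\<close> is positive near the boundary
  of the right half-plane, which compensates for the vanishing of \<open>Re z\<close> there.\<close>

lemma norm_powr_le_Re_powr: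
  assumes "1 < p" "p \<le> 2"
  obtains A B :: real where "0 \<le> A" "0 \<le> B"
    "\<And>z. 0 < Re z \<Longrightarrow> norm z powr p \<le> A * Re z powr p - B * Re (z powr of_real p)"
proof -
  \<comment> \<open>The midpoint of pi / (2 p) and pi / 2. Being below pi / 2, it keeps the cosine
    away from 0 in the sector; being above pi / (2 p), it makes cos (p \<theta>) negative
    outside.\<close>
  define \<theta>\<^sub>0 where "\<theta>\<^sub>0 = (pi / (2 * p) + pi / 2) / 2"
  define m where "m = - cos (p * \<theta>\<^sub>0)"
  define k where "k = cos \<theta>\<^sub>0 powr p"
  have p: "0 < p" using assms by simp
  have "pi / (2 * p) < pi / 2" using assms by (simp add: field_simps)
  then have \<theta>: "0 < \<theta>\<^sub>0" "\<theta>\<^sub>0 < pi / 2" using p unfolding \<theta>\<^sub>0_def by (auto intro: add_pos_pos)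
  define w where "w = p * pi"
  have p\<theta>: "p * \<theta>\<^sub>0 = (pi + w) / 4"
    using p by (simp add: \<theta>\<^sub>0_def w_def field_simps)
  have "pi < w" "w \<le> 2 * pi" using assms by (auto simp: w_def)
  then have p\<theta>2: "pi / 2 < p * \<theta>\<^sub>0" "p * \<theta>\<^sub>0 < pi" by (auto simp: p\<theta>)
  have m: "0 < m"
    using cos_monotone_0_pi[of "pi/2" "p * \<theta>\<^sub>0"] p\<theta>2 by (simp add: m_def)
  have k: "0 < k" using \<theta> cos_gt_zero[of \<theta>\<^sub>0] by (simp add: k_def)
  \<comment> \<open>Outside the sector the B-term alone yields the required 1, since there -cos (p
    \<theta>) is at least m. Inside it the A-term is at least 1 + 1 / m, and its excess 1 / m
    absorbs a possibly positive cos (p \<theta>) / m.\<close>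
  have key: "norm z powr p \<le> (1 + 1 / m) / k * Re z powr p - 1 / m * Re (z powr of_real p)"
    if z: "0 < Re z" for z
  proof -
    define \<theta> where "\<theta> = Arg z"
    have nz: "z \<noteq> 0" using z by auto
    have a: "\<bar>\<theta>\<bar> < pi / 2" using z Arg_Re_pos[of z] by (simp add: \<theta>_def)
    have Re: "Re z = norm z * cos \<theta>"
      using nz by (simp add: \<theta>_def cos_Arg)
    have cosp: "0 < cos \<theta>" using a by (intro cos_gt_zero_pi) auto
    have RP: "Re (z powr of_real p) = norm z powr p * cos (p * \<theta>)"
      using nz by (simp add: powr_def Re_exp Arg_eq_Im_Ln \<theta>_def)
    have ReP: "Re z powr p = norm z powr p * cos \<theta> powr p"
      using cosp by (simp add: Re powr_mult)
    have "1 \<le> (1 + 1 / m) / k * cos \<theta> powr p - 1 / m * cos (p * \<theta>)"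
    proof (cases "\<bar>\<theta>\<bar> \<le> \<theta>\<^sub>0")
      case True
      have "cos \<theta>\<^sub>0 \<le> cos \<bar>\<theta>\<bar>"
        using True \<theta> by (intro cos_monotone_0_pi_le) auto
      then have "k \<le> cos \<theta> powr p"
        unfolding k_def using \<theta> p cos_gt_zero[of \<theta>\<^sub>0] by (intro powr_mono2) auto
      then have "(1 + 1 / m) * 1 \<le> (1 + 1 / m) * (cos \<theta> powr p / k)"
        using k m by (intro mult_left_mono) (auto simp: field_simps)
      moreover have "1 / m * cos (p * \<theta>) \<le> 1 / m * 1"
        using m by (intro mult_left_mono) auto
      ultimately show ?thesis by simp
    next
      case False
      \<comment> \<open>Here p \<le> 2 enters: the angle p |\<theta>| does not exceed pi, up to
        which the cosine decreases.\<close>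
      have "p * \<bar>\<theta>\<bar> \<le> 2 * (pi / 2)"
        using assms a by (intro mult_mono) auto
      moreover have "p * \<theta>\<^sub>0 \<le> p * \<bar>\<theta>\<bar>"
        using False p by (intro mult_left_mono) auto
      ultimately have "cos (p * \<bar>\<theta>\<bar>) \<le> cos (p * \<theta>\<^sub>0)"
        using p \<theta> by (intro cos_monotone_0_pi_le) auto
      moreover have "cos (p * \<bar>\<theta>\<bar>) = cos (p * \<theta>)"
        by (simp add: abs_if)
      ultimately have "m \<le> - cos (p * \<theta>)"
        by (simp add: m_def)
      from divide_right_mono[OF this, of m] have "1 \<le> - (1 / m * cos (p * \<theta>))"
        using m by simp
      moreover have "0 \<le> (1 + 1 / m) / k * cos \<theta> powr p" using m k by simp
      ultimately show ?thesis by linarith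
    qed
    then have "norm z powr p * 1 \<le> norm z powr p * ((1 + 1 / m) / k * cos \<theta> powr p - 1 / m * cos (p * \<theta>))"
      by (intro mult_left_mono) auto
    then show ?thesis by (simp add: RP ReP algebra_simps)
  qed
  show thesis
    by (rule that[OF _ _ key]) (use m k in auto)
qed

lemma complex_powr_measurable [measurable]: "(\<lambda>z::complex. z powr w) \<in> borel_measurable borel"
  unfolding powr_def by measurable

lemma continuous_on_norm_poly_powr:
  "0 < p \<Longrightarrow> continuous_on S (\<lambda>t::complex. norm (poly F t) powr p)"
  by (intro continuous_on_powr' continuous_intros) auto

lemma integral_poly_powr_half_plane:
  fixes F :: "complex poly" and p A B e :: real
  assumes "1 < p" "0 \<le> B"
    and AB: "\<And>z. 0 < Re z \<Longrightarrow> norm z powr p \<le> A * Re z powr p - B * Re (z powr of_real p)"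
    and "0 < e" and e: "\<And>t. norm t = 1 \<Longrightarrow> e \<le> Re (poly F t)"
    and Im: "Im (poly F 0) = 0"
  shows "(\<integral>t. norm (poly F t) powr p \<partial>circ) \<le> A * (\<integral>t. Re (poly F t) powr p \<partial>circ)"
proof -
  have pos: "0 < Re (poly F z)" if "norm z \<le> 1" for z
  proof -
    have "Re (- poly F z) \<le> - e"
    proof (rule maximum_real_frontier[where S = "cball 0 1" and f = "\<lambda>z. - poly F z"])
      show "(\<lambda>z. - poly F z) holomorphic_on interior (cball 0 1)"
        by (intro holomorphic_intros)
      show "continuous_on (closure (cball 0 1)) (\<lambda>z. - poly F z)"
        by (intro continuous_intros)
    qed (use that e in auto)
    then show ?thesis using \<open>0 < e\<close> by simp
  qed
  define H where "H z = poly F z powr of_real p" for z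
  have contH: "continuous_on (cball 0 1) H"
    unfolding H_def
  proof (intro continuous_on_powr_complex continuous_on_poly continuous_on_id continuous_on_const subsetI)
    fix z :: complex assume "z \<in> cball 0 1"
    then have "0 < Re (poly F z)" by (intro pos) auto
    then show "z \<in> {z. 0 \<le> Re (poly F z) \<or> Im (poly F z) \<noteq> 0}" by simp
  qed (use \<open>1 < p\<close> in simp)
  have [measurable]: "H \<in> borel_measurable borel"
    unfolding H_def by measurable
  have "(\<integral>t. H t \<partial>circ) = H 0"
  proof (rule circ_mean_value[OF _ contH])
    show "H holomorphic_on ball 0 1"
      unfolding H_def
    proof (intro holomorphic_intros)
      fix z :: complex assume "z \<in> ball 0 1"
      then have "0 < Re (poly F z)" by (intro pos) auto
      then show "poly F z \<notin> \<real>\<^sub>\<le>\<^sub>0" by (auto simp: complex_nonpos_Reals_iff)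
    qed
  qed simp
  moreover have intH: "integrable circ H"
    by (rule integrable_circ_continuous) (auto intro: continuous_on_subset[OF contH])
  ultimately have ReH: "(\<integral>t. Re (H t) \<partial>circ) = Re (H 0)"
    by simp
  have "poly F 0 = of_real (Re (poly F 0))"
    using Im by (simp add: complex_eq_iff)
  then have "H 0 = of_real (Re (poly F 0) powr p)"
    unfolding H_def using pos[of 0] by (metis less_imp_le norm_zero powr_of_real zero_le_one)
  then have H0: "0 \<le> Re (H 0)"
    by simp
  have int1: "integrable circ (\<lambda>t. norm (poly F t) powr p)"
    using \<open>1 < p\<close> by (intro integrable_circ_continuous continuous_on_norm_poly_powr) auto
  have int2: "integrable circ (\<lambda>t. Re (poly F t) powr p)"
    using \<open>1 < p\<close> pos
    by (intro integrable_circ_continuous continuous_on_powr' continuous_intros)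
       (auto simp: less_imp_le dual_order.strict_iff_order)
  have "(\<integral>t. norm (poly F t) powr p \<partial>circ) \<le> (\<integral>t. A * Re (poly F t) powr p - B * Re (H t) \<partial>circ)"
    using int1 int2 intH AB[OF pos, folded H_def] by (intro integral_circ_mono) auto
  also have "\<dots> = A * (\<integral>t. Re (poly F t) powr p \<partial>circ) - B * Re (H 0)"
    using int2 intH ReH by simp
  finally show ?thesis using H0 \<open>0 \<le> B\<close> by (smt (verit) mult_nonneg_nonneg)
qed

section \<open>Real parts of polynomials and uniform approximation on the circle\<close>

text \<open>This serves products of real parts: 2 Re z Re w = Re (z w) + Re (z cnj w), where only
  the second term is not yet the real part of a polynomial. Since t cnj t = 1 on the circle, one
  coefficient can be peeled off both factors at once.\<close>

lemma Re_poly_mult_cnj_poly_on_circle: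
  "\<exists>K. \<forall>t. norm t = 1 \<longrightarrow> Re (poly F t * cnj (poly G t)) = Re (poly K t)"
proof (induction F arbitrary: G)
  case 0
  show ?case by (intro exI[of _ 0]) simp
next
  case (pCons a F)
  show ?case
  proof (cases G)
    case (pCons b G')
    from pCons.IH[of G'] obtain K where
      K: "\<And>t. norm t = 1 \<Longrightarrow> Re (poly F t * cnj (poly G' t)) = Re (poly K t)" by blast
    show ?thesis
    proof (intro exI[of _ "smult (cnj a) G + pCons 0 (smult (cnj b) F) + K"] allI impI)
      fix t :: complex assume t: "norm t = 1"
      have tt: "t * cnj t = 1" using t by (simp add: complex_norm_square[symmetric])
      have "poly (pCons a F) t * cnj (poly G t) =
          a * cnj (poly G t) + t * cnj b * poly F t + (t * cnj t) * (poly F t * cnj (poly G' t))"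
        by (simp add: pCons algebra_simps)
      also have "Re \<dots> = Re (a * cnj (poly G t)) + Re (t * cnj b * poly F t) + Re (poly K t)"
        using K[OF t] by (simp add: tt)
      also have "Re (a * cnj (poly G t)) = Re (cnj a * poly G t)"
        by simp
      finally show "Re (poly (pCons a F) t * cnj (poly G t)) =
          Re (poly (smult (cnj a) G + pCons 0 (smult (cnj b) F) + K) t)"
        by (simp add: algebra_simps)
    qed
  qed
qed

lemma real_polynomial_function_on_circle:
  assumes "real_polynomial_function (h :: complex \<Rightarrow> real)"
  shows "\<exists>F. \<forall>t. norm t = 1 \<longrightarrow> h t = Re (poly F t)"
  using assms
proof induction
  case (linear h)
  interpret bounded_linear h by fact
  have "h t = Re (poly [:0, h 1 - \<i> * h \<i>:] t)" for t
  proof -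
    have "t = Re t *\<^sub>R 1 + Im t *\<^sub>R \<i>" by (simp add: complex_eq_iff)
    then have "h t = Re t * h 1 + Im t * h \<i>" by (metis add scaleR real_scaleR_def)
    then show ?thesis by simp
  qed
  then show ?case by blast
next
  case (const c)
  show ?case by (intro exI[of _ "[:of_real c:]"]) simp
next
  case (add f g)
  then obtain F G where "\<forall>t. norm t = 1 \<longrightarrow> f t = Re (poly F t)" "\<forall>t. norm t = 1 \<longrightarrow> g t = Re (poly G t)"
    by blast
  then show ?case by (intro exI[of _ "F + G"]) simp
next
  case (mult f g)
  then obtain F G where FG: "\<forall>t. norm t = 1 \<longrightarrow> f t = Re (poly F t)" "\<forall>t. norm t = 1 \<longrightarrow> g t = Re (poly G t)"
    by blast
  obtain K where K: "\<And>t. norm t = 1 \<Longrightarrow> Re (poly F t * cnj (poly G t)) = Re (poly K t)"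
    using Re_poly_mult_cnj_poly_on_circle by blast
  have "f t * g t = Re (poly (smult (1 / 2) (F * G + K)) t)" if "norm t = 1" for t
    using FG K[OF that] that by (simp add: field_simps)
  then show ?case by blast
qed

lemma continuous_on_circle_approx:
  fixes f :: "complex \<Rightarrow> real"
  assumes "continuous_on (sphere 0 1) f" "0 < e"
  obtains F where "\<And>t. norm t = 1 \<Longrightarrow> \<bar>f t - Re (poly F t)\<bar> < e"
proof -
  obtain g where g: "real_polynomial_function g" "\<And>t. t \<in> sphere 0 1 \<Longrightarrow> \<bar>f t - g t\<bar> < e"
    using Stone_Weierstrass_real_polynomial_function[OF compact_sphere assms] by blast
  obtain F where F: "\<forall>t. norm t = 1 \<longrightarrow> g t = Re (poly F t)"
    using real_polynomial_function_on_circle[OF g(1)] by blast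
  show thesis
    by (rule that[of F]) (use g(2) F in force)
qed

lemma integrable_poly_powr:
  "0 < p \<Longrightarrow> integrable circ (\<lambda>t. norm (poly F t) powr p)"
  by (intro integrable_circ_continuous continuous_on_norm_poly_powr) auto

lemma integrable_Re_poly_powr:
  assumes "0 < p" shows "integrable circ (\<lambda>t. \<bar>Re (poly F t)\<bar> powr p)"
  using assms by (intro integrable_circ_continuous continuous_on_powr' continuous_intros) auto

text \<open>The half-plane estimate needs a positive real part, so Re F is split into its positive
  and negative parts. Neither need be the real part of a polynomial; the positive one is therefore
  approximated uniformly and lifted slightly, and the error tends to 0 with e.\<close>

lemma integral_poly_powr_le_Re_small:
  assumes "1 < p" "p \<le> 2"
  obtains C where "0 \<le> C" "\<And>F. poly F 0 = 0 \<Longrightarrow>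
    (\<integral>t. norm (poly F t) powr p \<partial>circ) \<le> C * (\<integral>t. \<bar>Re (poly F t)\<bar> powr p \<partial>circ)"
proof -
  obtain A B where AB: "0 \<le> A" "0 \<le> B"
    "\<And>z. 0 < Re z \<Longrightarrow> norm z powr p \<le> A * Re z powr p - B * Re (z powr of_real p)"
    using norm_powr_le_Re_powr[OF assms] by blast
  \<comment> \<open>The outer 2^p splits F = F1 - F2, the 2 counts the two pieces, A is the
    half-plane constant, and the inner 2^p separates |Re F| from the error 3 e.\<close>
  define C where "C = 2 powr p * (2 * A * 2 powr p)"
  have main: "(\<integral>t. norm (poly F t) powr p \<partial>circ) \<le> C * (\<integral>t. \<bar>Re (poly F t)\<bar> powr p \<partial>circ)"
    if F0: "poly F 0 = 0" for F
  proof (rule field_le_epsilon)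
    fix \<delta> :: real assume "0 < \<delta>"
    have "0 \<le> C" using AB by (simp add: C_def)
    define e where "e = (\<delta> / (C + 1)) powr (1 / p) / 3"
    have "0 < e" using \<open>0 < \<delta>\<close> \<open>0 \<le> C\<close> by (simp add: e_def)
    have "C * (3 * e) powr p = C * (\<delta> / (C + 1))"
      using \<open>0 < \<delta>\<close> \<open>0 \<le> C\<close> assms by (simp add: e_def powr_powr)
    also have "\<dots> \<le> \<delta>"
      using \<open>0 < \<delta>\<close> \<open>0 \<le> C\<close> by (simp add: field_simps)
    finally have e\<delta>: "C * (3 * e) powr p \<le> \<delta>" .
    have "continuous_on (sphere 0 1) (\<lambda>t. max 0 (Re (poly F t)))"
      by (intro continuous_intros)
    then obtain G where G: "\<And>t. norm t = 1 \<Longrightarrow> \<bar>max 0 (Re (poly F t)) - Re (poly G t)\<bar> < e"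
      using \<open>0 < e\<close> continuous_on_circle_approx by blast
    \<comment> \<open>Re G is within e of max 0 (Re F), so adding 2 e places it between e and |Re F|
      + 3 e; the imaginary constant makes F1(0) real. F2 inherits all this because max 0 u - u = max
      0 (-u) and F(0) = 0.\<close>
    define F1 where "F1 = G + [:of_real (2 * e) - \<i> * Im (poly G 0):]"
    define F2 where "F2 = F1 - F"
    let ?I = "\<lambda>F. \<integral>t. norm (poly F t) powr p \<partial>circ"
    let ?J = "\<integral>t. \<bar>Re (poly F t)\<bar> powr p \<partial>circ"
    have bound: "?I H \<le> A * 2 powr p * (?J + (3 * e) powr p)"
      if H: "Im (poly H 0) = 0" "\<And>t. norm t = 1 \<Longrightarrow> e \<le> Re (poly H t)"
        "\<And>t. norm t = 1 \<Longrightarrow> Re (poly H t) \<le> \<bar>Re (poly F t)\<bar> + 3 * e" for H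
    proof -
      have "?I H \<le> A * (\<integral>t. Re (poly H t) powr p \<partial>circ)"
        using assms AB H \<open>0 < e\<close> by (intro integral_poly_powr_half_plane[where B = B and e = e]) auto
      also have "(\<integral>t. Re (poly H t) powr p \<partial>circ) \<le> (\<integral>t. 2 powr p * (\<bar>Re (poly F t)\<bar> powr p + (3 * e) powr p) \<partial>circ)"
      proof (rule integral_circ_mono)
        show "integrable circ (\<lambda>t. Re (poly H t) powr p)"
        proof (rule integrable_circ_mono[OF integrable_Re_poly_powr[of p H]])
          fix t :: complex assume "norm t = 1"
          with H(2)[of t] \<open>0 < e\<close> show "norm (Re (poly H t) powr p) \<le> \<bar>Re (poly H t)\<bar> powr p" by simp
        qed (use assms in auto)
        show "integrable circ (\<lambda>t. 2 powr p * (\<bar>Re (poly F t)\<bar> powr p + (3 * e) powr p))"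
          using integrable_Re_poly_powr[of p F] assms by simp
        fix t :: complex assume t: "norm t = 1"
        have "Re (poly H t) powr p \<le> (\<bar>Re (poly F t)\<bar> + 3 * e) powr p"
          using H(2,3)[OF t] \<open>0 < e\<close> assms by (intro powr_mono2) auto
        also have "\<dots> \<le> 2 powr p * (\<bar>Re (poly F t)\<bar> powr p + (3 * e) powr p)"
          using \<open>0 < e\<close> assms by (intro powr_add_le) auto
        finally show "Re (poly H t) powr p \<le> 2 powr p * (\<bar>Re (poly F t)\<bar> powr p + (3 * e) powr p)" .
      qed
      also have "\<dots> = 2 powr p * (?J + (3 * e) powr p)"
        using integrable_Re_poly_powr[of p F] assms by simp
      finally show ?thesis
        using AB by (simp add: mult_left_mono mult.assoc)
    qed
    have 1: "?I F1 \<le> A * 2 powr p * (?J + (3 * e) powr p)"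
      by (rule bound) (use G in \<open>force simp: F1_def max_def split: if_splits\<close>)+
    have 2: "?I F2 \<le> A * 2 powr p * (?J + (3 * e) powr p)"
      by (rule bound) (use G F0 in \<open>force simp: F1_def F2_def max_def split: if_splits\<close>)+
    have "?I F \<le> (\<integral>t. 2 powr p * (norm (poly F1 t) powr p + norm (poly F2 t) powr p) \<partial>circ)"
    proof (rule integral_circ_mono)
      fix t :: complex
      have "poly F t = poly F1 t - poly F2 t" by (simp add: F2_def)
      then show "norm (poly F t) powr p \<le> 2 powr p * (norm (poly F1 t) powr p + norm (poly F2 t) powr p)"
        using assms by (metis norm_diff_powr_le less_eq_real_def less_trans zero_less_one)
    qed (use assms in \<open>auto intro!: integrable_poly_powr\<close>)
    also have "\<dots> = 2 powr p * (?I F1 + ?I F2)"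
      using assms by (simp add: integrable_poly_powr)
    also have "\<dots> \<le> 2 powr p * (2 * (A * 2 powr p * (?J + (3 * e) powr p)))"
      using 1 2 by (intro mult_left_mono) auto
    also have "\<dots> = C * ?J + C * (3 * e) powr p"
      by (simp add: C_def algebra_simps)
    finally show "?I F \<le> C * ?J + \<delta>" using e\<delta> by linarith
  qed
  show thesis
    by (rule that[OF _ main]) (use AB in \<open>simp add: C_def\<close>)
qed

text \<open>Cotlar's trick: the real part of \<open>- \<i> F\<^sup>2\<close> is \<open>2 Re F Im F\<close>, so the estimate for \<open>p\<close>
  implies the one for \<open>2 p\<close>.\<close>

lemma integral_poly_powr_le_Re_double:
  assumes "1 < q" "0 \<le> C"
    and C: "\<And>F. poly F 0 = 0 \<Longrightarrow>
      (\<integral>t. norm (poly F t) powr q \<partial>circ) \<le> C * (\<integral>t. \<bar>Re (poly F t)\<bar> powr q \<partial>circ)"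
    and F0: "poly F 0 = 0"
  defines "K \<equiv> 2 * (C * 2 powr q) + 1"
  shows "(\<integral>t. norm (poly F t) powr (2 * q) \<partial>circ)
    \<le> 2 * (C * 2 powr q) * K * (\<integral>t. \<bar>Re (poly F t)\<bar> powr (2 * q) \<partial>circ)"
proof -
  define G where "G = smult (-\<i>) (F * F)"
  let ?X = "\<integral>t. norm (poly F t) powr (2 * q) \<partial>circ"
  let ?U = "\<integral>t. \<bar>Re (poly F t)\<bar> powr (2 * q) \<partial>circ"
  have K: "0 < K" using \<open>0 \<le> C\<close> by (simp add: K_def add_nonneg_pos)
  have intU: "integrable circ (\<lambda>t. \<bar>Re (poly F t)\<bar> powr (2 * q))"
    and intX: "integrable circ (\<lambda>t. norm (poly F t) powr (2 * q))"
    using \<open>1 < q\<close> by (auto intro!: integrable_Re_poly_powr integrable_poly_powr)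
  have "norm (poly G t) powr q = norm (poly F t) powr (2 * q)" for t
    by (simp add: G_def norm_mult powr_mult powr_add[symmetric])
  then have "?X = (\<integral>t. norm (poly G t) powr q \<partial>circ)" by simp
  also have "\<dots> \<le> C * (\<integral>t. \<bar>Re (poly G t)\<bar> powr q \<partial>circ)"
    by (rule C) (simp add: G_def F0)
  also have "(\<integral>t. \<bar>Re (poly G t)\<bar> powr q \<partial>circ) \<le>
      (\<integral>t. 2 powr q * (K * \<bar>Re (poly F t)\<bar> powr (2 * q) + norm (poly F t) powr (2 * q) / K) \<partial>circ)"
  proof (rule integral_circ_mono)
    fix t
    define x y where "x = \<bar>Re (poly F t)\<bar> powr q" and "y = norm (poly F t) powr q"
    have "\<bar>Re (poly G t)\<bar> = 2 * (\<bar>Re (poly F t)\<bar> * \<bar>Im (poly F t)\<bar>)"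
      by (simp add: G_def abs_mult)
    also have "\<dots> \<le> 2 * (\<bar>Re (poly F t)\<bar> * norm (poly F t))"
      by (intro mult_left_mono) (auto intro: abs_Im_le_cmod)
    finally have "\<bar>Re (poly G t)\<bar> powr q \<le> (2 * (\<bar>Re (poly F t)\<bar> * norm (poly F t))) powr q"
      using assms by (intro powr_mono2) auto
    also have "\<dots> = 2 powr q * (x * y)"
      by (simp add: powr_mult x_def y_def)
    \<comment> \<open>The weight K is put on the factor with Re F, so that the full norm comes back
      only with the factor 1 / K.\<close>
    also have "x * y \<le> K * x\<^sup>2 + y\<^sup>2 / K"
    proof -
      have "0 \<le> (K * x - y)\<^sup>2 + K * x * y"
        using K by (auto simp: x_def y_def)
      then have "K * (x * y) \<le> K * (K * x\<^sup>2 + y\<^sup>2 / K)"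
        using K by (simp add: power2_eq_square algebra_simps)
      then show ?thesis using K by (simp add: mult_le_cancel_left)
    qed
    also have "x\<^sup>2 = \<bar>Re (poly F t)\<bar> powr (2 * q)"
      by (simp add: x_def power2_eq_square powr_add[symmetric])
    also have "y\<^sup>2 = norm (poly F t) powr (2 * q)"
      by (simp add: y_def power2_eq_square powr_add[symmetric])
    finally show "\<bar>Re (poly G t)\<bar> powr q \<le>
        2 powr q * (K * \<bar>Re (poly F t)\<bar> powr (2 * q) + norm (poly F t) powr (2 * q) / K)"
      by simp
  qed (use intU intX \<open>1 < q\<close> in \<open>auto intro!: integrable_Re_poly_powr\<close>)
  also have "\<dots> = 2 powr q * (K * ?U + ?X / K)"
    using intU intX by simp
  finally have "?X \<le> C * (2 powr q * (K * ?U + ?X / K))"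
    using \<open>0 \<le> C\<close> by (simp add: mult_left_mono)
  then have X: "?X \<le> C * 2 powr q * K * ?U + (C * 2 powr q / K) * ?X"
    by (simp add: algebra_simps)
  \<comment> \<open>The value of K is made for this: the term with \<open>?X\<close> on the right
    gets a factor of at most 1 / 2 and is absorbed into the left-hand side.\<close>
  have "C * 2 powr q / K \<le> 1 / 2"
    using K by (simp add: K_def field_simps)
  then have "(C * 2 powr q / K) * ?X \<le> 1 / 2 * ?X"
    by (intro mult_right_mono) auto
  with X have "?X \<le> C * 2 powr q * K * ?U + 1 / 2 * ?X"
    by linarith
  then show ?thesis by (simp add: mult.assoc)
qed

text \<open>Induction on n reaches all exponents in (1, 2^n]: if p > 2, then p / 2 still exceeds 1
  and lies in the previous range, so the doubling step applies.\<close>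

lemma integral_poly_powr_le_Re:
  assumes "1 < p"
  shows "\<exists>C\<ge>0. \<forall>F. poly F 0 = 0 \<longrightarrow>
    (\<integral>t. norm (poly F t) powr p \<partial>circ) \<le> C * (\<integral>t. \<bar>Re (poly F t)\<bar> powr p \<partial>circ)"
proof -
  have "\<exists>C\<ge>0. \<forall>F. poly F 0 = 0 \<longrightarrow>
      (\<integral>t. norm (poly F t) powr p \<partial>circ) \<le> C * (\<integral>t. \<bar>Re (poly F t)\<bar> powr p \<partial>circ)"
    if "1 < p" "p \<le> 2 ^ n" for n and p :: real
    using that
  proof (induction n arbitrary: p)
    case 0
    then show ?case by simp
  next
    case (Suc n)
    show ?case
    proof (cases "p \<le> 2")
      case True
      with Suc.prems show ?thesis by (metis integral_poly_powr_le_Re_small)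
    next
      case False
      define q where "q = p / 2"
      have q: "1 < q" "q \<le> 2 ^ n" "p = 2 * q"
        using False Suc.prems by (auto simp: q_def)
      obtain C where C: "0 \<le> C" "\<And>F. poly F 0 = 0 \<Longrightarrow>
          (\<integral>t. norm (poly F t) powr q \<partial>circ) \<le> C * (\<integral>t. \<bar>Re (poly F t)\<bar> powr q \<partial>circ)"
        using Suc.IH[OF q(1,2)] by blast
      show ?thesis
        unfolding q(3)
        by (intro exI[of _ "2 * (C * 2 powr q) * (2 * (C * 2 powr q) + 1)"] conjI allI impI
            integral_poly_powr_le_Re_double[OF q(1) C]) (use C in auto)
    qed
  qed
  moreover obtain n :: nat where "p < 2 ^ n"
    using real_arch_pow[of 2 p] by auto
  ultimately show ?thesis using assms less_imp_le by blast
qed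

section \<open>The analytic part of a trigonometric polynomial\<close>

lemma powr_integrable_imp_integrable:
  fixes f :: "complex \<Rightarrow> complex"
  assumes "1 < p" and [measurable]: "f \<in> borel_measurable borel"
    and I: "integrable circ (\<lambda>t. norm (f t) powr p)"
  shows "integrable circ f"
proof (rule integrable_circ_mono)
  show "integrable circ (\<lambda>t. 1 + norm (f t) powr p)"
    using I by simp
  show "norm (f t) \<le> 1 + norm (f t) powr p" for t
    using le_powr_scaled[of "norm (f t)" 1 p] \<open>1 < p\<close> by simp
qed simp

lemma integral_norm_le:
  fixes f :: "complex \<Rightarrow> complex"
  assumes "1 < p" and [measurable]: "f \<in> borel_measurable borel"
    and I: "integrable circ (\<lambda>t. norm (f t) powr p)"
  shows "(\<integral>t. norm (f t) \<partial>circ) \<le> 2 * (\<integral>t. norm (f t) powr p \<partial>circ) powr (1 / p)"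
proof -
  let ?N = "\<integral>t. norm (f t) powr p \<partial>circ"
  have le: "(\<integral>t. norm (f t) \<partial>circ) \<le> \<delta> + \<delta> powr (1 - p) * ?N" if "0 < \<delta>" for \<delta>
  proof -
    have "(\<integral>t. norm (f t) \<partial>circ) \<le> (\<integral>t. \<delta> + \<delta> powr (1 - p) * norm (f t) powr p \<partial>circ)"
      using powr_integrable_imp_integrable[OF assms] I that \<open>1 < p\<close>
      by (intro integral_circ_mono le_powr_scaled) auto
    also have "\<dots> = \<delta> + \<delta> powr (1 - p) * ?N"
      using I by simp
    finally show ?thesis .
  qed
  have "0 \<le> ?N" by simp
  show ?thesis
  proof (cases "?N = 0")
    case True
    have "(\<integral>t. norm (f t) \<partial>circ) \<le> 0"
    proof (rule field_le_epsilon)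
      fix \<delta> :: real assume "0 < \<delta>"
      from le[OF this] show "(\<integral>t. norm (f t) \<partial>circ) \<le> 0 + \<delta>"
        unfolding True by simp
    qed
    then show ?thesis using True by simp
  next
    case False
    then have N: "0 < ?N" using \<open>0 \<le> ?N\<close> by linarith
    \<comment> \<open>With this choice both terms of \<open>le\<close> equal
      \<open>?N powr (1 / p)\<close>, hence the factor 2.\<close>
    let ?\<delta> = "?N powr (1 / p)"
    have "?\<delta> powr (1 - p) * ?N = ?N powr ((1 / p) * (1 - p) + 1)"
      using N \<open>1 < p\<close> by (simp add: powr_powr powr_add)
    also have "(1 / p) * (1 - p) + 1 = 1 / p"
      using \<open>1 < p\<close> by (simp add: field_simps)
    finally show ?thesis using le[of ?\<delta>] N by simp
  qed
qed

lemma norm_integral_powr_le: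
  fixes f :: "complex \<Rightarrow> complex"
  assumes "1 < p" and "f \<in> borel_measurable borel"
    and I: "integrable circ (\<lambda>t. norm (f t) powr p)"
  shows "norm (\<integral>t. f t \<partial>circ) powr p \<le> 2 powr p * (\<integral>t. norm (f t) powr p \<partial>circ)"
proof -
  let ?N = "\<integral>t. norm (f t) powr p \<partial>circ"
  have "norm (\<integral>t. f t \<partial>circ) \<le> (\<integral>t. norm (f t) \<partial>circ)" by simp
  also have "\<dots> \<le> 2 * ?N powr (1 / p)" by (rule integral_norm_le[OF assms])
  finally have "norm (\<integral>t. f t \<partial>circ) powr p \<le> (2 * ?N powr (1 / p)) powr p"
    using \<open>1 < p\<close> by (intro powr_mono2) auto
  also have "\<dots> = 2 powr p * ?N"
    using \<open>1 < p\<close> by (simp add: powr_mult powr_powr)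
  finally show ?thesis .
qed

lemma integral_poly: "(\<integral>t. poly F t \<partial>circ) = poly F 0"
  by (rule circ_mean_value) (auto intro!: continuous_intros holomorphic_intros)

lemma integrable_poly: "integrable circ (poly F :: complex \<Rightarrow> complex)"
  by (intro integrable_circ_continuous continuous_intros) simp

lemma integrable_trig_poly_powr:
  assumes "0 < p"
  shows "integrable circ (\<lambda>t. norm (poly F t + cnj (poly G t)) powr p)"
  using assms by (intro integrable_circ_continuous continuous_on_powr' continuous_intros) auto

text \<open>Let c be the mean of q = F + cnj G and F0 = F - c. Then Re (q - c) is the real part of
  F0 + G, and Im (q - c) is the real part of -i (F0 - G). Both polynomials vanish at 0, so q
  controls them, and together they recover 2 F0.\<close>

lemma integral_poly_powr_le_trig_poly:
  assumes "1 < p"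
  obtains C where "0 \<le> C" "\<And>F G. poly G 0 = 0 \<Longrightarrow>
    (\<integral>t. norm (poly F t) powr p \<partial>circ) \<le> C * (\<integral>t. norm (poly F t + cnj (poly G t)) powr p \<partial>circ)"
proof -
  obtain C0 where C0: "0 \<le> C0" "\<And>F. poly F 0 = 0 \<Longrightarrow>
      (\<integral>t. norm (poly F t) powr p \<partial>circ) \<le> C0 * (\<integral>t. \<bar>Re (poly F t)\<bar> powr p \<partial>circ)"
    using integral_poly_powr_le_Re[OF assms] by blast
  define T where "T = (2::real) powr p"
  \<comment> \<open>T * ?I bounds the mean, T * (1 + T) * ?I bounds q - c, and C0 carries that bound
    over to \<open>H1\<close> and \<open>H2\<close>. The next T combines these two into
    \<open>F0\<close>, and the outermost one adds the mean back.\<close>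
  define C where "C = T * (T * (2 * (C0 * (T * (1 + T)))) + T)"
  have p: "0 < p" "0 \<le> p" using assms by auto
  have T: "0 \<le> T" by (simp add: T_def)
  have "(\<integral>t. norm (poly F t) powr p \<partial>circ) \<le> C * (\<integral>t. norm (poly F t + cnj (poly G t)) powr p \<partial>circ)"
    if G: "poly G 0 = 0" for F G
  proof -
    define c where "c = poly F 0"
    define F0 where "F0 = F - [:c:]"
    let ?q = "\<lambda>t. poly F t + cnj (poly G t)"
    let ?I = "\<integral>t. norm (?q t) powr p \<partial>circ"
    let ?N = "\<lambda>F. \<integral>t. norm (poly F t) powr p \<partial>circ"
    have Iq: "integrable circ (\<lambda>t. norm (?q t) powr p)"
      by (rule integrable_trig_poly_powr[OF p(1)])
    have "(\<integral>t. ?q t \<partial>circ) = c"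
      by (simp add: c_def integral_poly integrable_poly G)
    with norm_integral_powr_le[OF assms _ Iq] have c: "norm c powr p \<le> T * ?I"
      by (simp add: T_def)
    have Iqc: "integrable circ (\<lambda>t. norm (?q t - c) powr p)"
      using integrable_trig_poly_powr[OF p(1), of F0 G] by (simp add: F0_def algebra_simps)
    have "(\<integral>t. norm (?q t - c) powr p \<partial>circ) \<le> (\<integral>t. T * (norm (?q t) powr p + norm c powr p) \<partial>circ)"
      unfolding T_def using Iq Iqc p by (intro integral_circ_mono norm_diff_powr_le) auto
    also have "\<dots> = T * (?I + norm c powr p)"
      using Iq by simp
    also have "\<dots> \<le> T * (?I + T * ?I)"
      using c T by (intro mult_left_mono) auto
    finally have qc: "(\<integral>t. norm (?q t - c) powr p \<partial>circ) \<le> T * (1 + T) * ?I"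
      by (simp add: algebra_simps)
    have bound: "?N H \<le> C0 * (T * (1 + T) * ?I)"
      if "poly H 0 = 0" "\<And>t. \<bar>Re (poly H t)\<bar> \<le> norm (?q t - c)" for H
    proof -
      have "?N H \<le> C0 * (\<integral>t. \<bar>Re (poly H t)\<bar> powr p \<partial>circ)"
        by (rule C0) fact
      also have "\<dots> \<le> C0 * (\<integral>t. norm (?q t - c) powr p \<partial>circ)"
        using that p C0(1) Iqc integrable_Re_poly_powr[OF p(1), of H]
        by (intro mult_left_mono integral_circ_mono powr_mono2) auto
      also have "\<dots> \<le> C0 * (T * (1 + T) * ?I)"
        using qc C0(1) by (intro mult_left_mono) auto
      finally show ?thesis .
    qed
    define H1 H2 where "H1 = F0 + G" and "H2 = smult (-\<i>) (F0 - G)"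
    have H1: "?N H1 \<le> C0 * (T * (1 + T) * ?I)"
    proof (rule bound)
      show "poly H1 0 = 0" by (simp add: H1_def F0_def c_def G)
      show "\<bar>Re (poly H1 t)\<bar> \<le> norm (?q t - c)" for t
        using abs_Re_le_cmod[of "?q t - c"] by (simp add: H1_def F0_def algebra_simps)
    qed
    have H2: "?N H2 \<le> C0 * (T * (1 + T) * ?I)"
    proof (rule bound)
      show "poly H2 0 = 0" by (simp add: H2_def F0_def c_def G)
      show "\<bar>Re (poly H2 t)\<bar> \<le> norm (?q t - c)" for t
        using abs_Im_le_cmod[of "?q t - c"] by (simp add: H2_def F0_def algebra_simps)
    qed
    have "?N F0 \<le> (\<integral>t. T * (norm (poly H1 t) powr p + norm (poly H2 t) powr p) \<partial>circ)"
    proof (intro integral_circ_mono)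
      fix t
      have "2 * poly F0 t = poly H1 t + \<i> * poly H2 t"
        by (simp add: H1_def H2_def algebra_simps)
      then have "2 * norm (poly F0 t) = norm (poly H1 t + \<i> * poly H2 t)"
        by (metis norm_mult norm_numeral)
      then have "norm (poly F0 t) \<le> norm (poly H1 t + \<i> * poly H2 t)"
        using norm_ge_zero[of "poly F0 t"] by linarith
      then have "norm (poly F0 t) powr p \<le> norm (poly H1 t + \<i> * poly H2 t) powr p"
        using p by (intro powr_mono2) auto
      also have "\<dots> \<le> T * (norm (poly H1 t) powr p + norm (\<i> * poly H2 t) powr p)"
        unfolding T_def by (intro norm_add_powr_le p)
      finally show "norm (poly F0 t) powr p \<le> T * (norm (poly H1 t) powr p + norm (poly H2 t) powr p)"
        by (simp add: norm_mult)
    qed (use p in \<open>auto intro!: integrable_poly_powr\<close>)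
    also have "\<dots> = T * (?N H1 + ?N H2)"
      using p by (simp add: integrable_poly_powr)
    also have "\<dots> \<le> T * (2 * (C0 * (T * (1 + T) * ?I)))"
      using H1 H2 T by (intro mult_left_mono) auto
    finally have F0: "?N F0 \<le> T * (2 * (C0 * (T * (1 + T) * ?I)))" .
    have "?N F \<le> (\<integral>t. T * (norm (poly F0 t) powr p + norm c powr p) \<partial>circ)"
    proof (intro integral_circ_mono)
      fix t
      have "norm (poly F t) powr p = norm (poly F0 t + c) powr p"
        by (simp add: F0_def)
      also have "\<dots> \<le> T * (norm (poly F0 t) powr p + norm c powr p)"
        unfolding T_def by (intro norm_add_powr_le p)
      finally show "norm (poly F t) powr p \<le> T * (norm (poly F0 t) powr p + norm c powr p)" .
    qed (use p in \<open>auto intro!: integrable_poly_powr\<close>)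
    also have "\<dots> = T * (?N F0 + norm c powr p)"
      using p by (simp add: integrable_poly_powr)
    also have "\<dots> \<le> T * (T * (2 * (C0 * (T * (1 + T) * ?I))) + T * ?I)"
      using F0 c T by (intro mult_left_mono add_mono) auto
    also have "\<dots> = C * ?I"
      by (simp add: C_def algebra_simps)
    finally show ?thesis .
  qed
  moreover have "0 \<le> C" using C0(1) T by (simp add: C_def)
  ultimately show thesis using that by blast
qed

section \<open>Density of the trigonometric polynomials\<close>

text \<open>The condition \<open>poly G 0 = 0\<close> assigns the constant term to F, so that F is
  the whole analytic part of the approximant.\<close>

definition trig_approx :: "real \<Rightarrow> (complex \<Rightarrow> complex) \<Rightarrow> bool" where
  "trig_approx p f \<longleftrightarrow> f \<in> borel_measurable borel \<and> integrable circ (\<lambda>t. norm (f t) powr p) \<and>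
    (\<forall>e>0. \<exists>F G. poly G 0 = 0 \<and>
      (\<integral>t. norm (f t - (poly F t + cnj (poly G t))) powr p \<partial>circ) < e)"

lemma integrable_add_powr:
  fixes f g :: "complex \<Rightarrow> complex"
  assumes [measurable]: "f \<in> borel_measurable borel" "g \<in> borel_measurable borel"
    and "integrable circ (\<lambda>t. norm (f t) powr p)" "integrable circ (\<lambda>t. norm (g t) powr p)" "0 \<le> p"
  shows "integrable circ (\<lambda>t. norm (f t + g t) powr p)"
proof (rule integrable_circ_mono)
  show "integrable circ (\<lambda>t. 2 powr p * (norm (f t) powr p + norm (g t) powr p))"
    using assms by simp
  show "norm (norm (f t + g t) powr p) \<le> 2 powr p * (norm (f t) powr p + norm (g t) powr p)" for t
    using norm_add_powr_le[OF \<open>0 \<le> p\<close>, of "f t" "g t"] by simp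
qed simp

lemma integrable_scale_powr:
  fixes f :: "complex \<Rightarrow> complex"
  assumes "integrable circ (\<lambda>t. norm (f t) powr p)"
  shows "integrable circ (\<lambda>t. norm (z * f t) powr p)"
  using assms by (simp add: norm_mult powr_mult)

lemma integrable_diff_powr:
  fixes f g :: "complex \<Rightarrow> complex"
  assumes "f \<in> borel_measurable borel" "g \<in> borel_measurable borel"
    and "integrable circ (\<lambda>t. norm (f t) powr p)" "integrable circ (\<lambda>t. norm (g t) powr p)" "0 \<le> p"
  shows "integrable circ (\<lambda>t. norm (f t - g t) powr p)"
  using integrable_add_powr[of f "\<lambda>t. - g t" p] assms by simp

lemma integral_add_powr_le:
  fixes f g :: "complex \<Rightarrow> complex"
  assumes "f \<in> borel_measurable borel" "g \<in> borel_measurable borel"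
    and I: "integrable circ (\<lambda>t. norm (f t) powr p)" "integrable circ (\<lambda>t. norm (g t) powr p)" "0 \<le> p"
  shows "(\<integral>t. norm (f t + g t) powr p \<partial>circ)
    \<le> 2 powr p * ((\<integral>t. norm (f t) powr p \<partial>circ) + (\<integral>t. norm (g t) powr p \<partial>circ))"
proof -
  have "(\<integral>t. norm (f t + g t) powr p \<partial>circ) \<le> (\<integral>t. 2 powr p * (norm (f t) powr p + norm (g t) powr p) \<partial>circ)"
    using I integrable_add_powr[OF assms] by (intro integral_circ_mono norm_add_powr_le) auto
  then show ?thesis using I by simp
qed

lemma trig_approx_close:
  assumes "0 \<le> p" and [measurable]: "f \<in> borel_measurable borel"
    and I: "integrable circ (\<lambda>t. norm (f t) powr p)"
    and approx: "\<And>e. 0 < e \<Longrightarrow> \<exists>g. trig_approx p g \<and> (\<integral>t. norm (f t - g t) powr p \<partial>circ) < e"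
  shows "trig_approx p f"
  unfolding trig_approx_def
proof (intro conjI allI impI)
  fix e :: real assume "0 < e"
  define \<delta> where "\<delta> = e / (2 powr p * 2)"
  have "0 < \<delta>" using \<open>0 < e\<close> by (simp add: \<delta>_def)
  then obtain g where g: "trig_approx p g" "(\<integral>t. norm (f t - g t) powr p \<partial>circ) < \<delta>"
    using approx by blast
  then obtain F G where FG: "poly G 0 = 0"
      "(\<integral>t. norm (g t - (poly F t + cnj (poly G t))) powr p \<partial>circ) < \<delta>"
    using \<open>0 < \<delta>\<close> unfolding trig_approx_def by blast
  have gm: "g \<in> borel_measurable borel" "integrable circ (\<lambda>t. norm (g t) powr p)"
    using g by (auto simp: trig_approx_def)
  have Iq: "integrable circ (\<lambda>t. norm (poly F t + cnj (poly G t)) powr p)"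
  proof (cases "p = 0")
    \<comment> \<open>For p = 0 the integrand takes only the values 0 and 1; it is bounded but may
      be discontinuous at zeros.\<close>
    case True
    then show ?thesis
      by (intro integrable_circ_bounded[where K = 1]) auto
  next
    case False
    then show ?thesis using \<open>0 \<le> p\<close> by (intro integrable_trig_poly_powr) auto
  qed
  have "(\<integral>t. norm (f t - (poly F t + cnj (poly G t))) powr p \<partial>circ) =
      (\<integral>t. norm ((f t - g t) + (g t - (poly F t + cnj (poly G t)))) powr p \<partial>circ)"
    by (simp only: add_diff_eq diff_add_cancel)
  also have "\<dots> \<le> 2 powr p * ((\<integral>t. norm (f t - g t) powr p \<partial>circ) +
      (\<integral>t. norm (g t - (poly F t + cnj (poly G t))) powr p \<partial>circ))"
    using gm I Iq assms by (intro integral_add_powr_le integrable_diff_powr) auto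
  also have "\<dots> < 2 powr p * (\<delta> + \<delta>)"
    using g FG by (intro mult_strict_left_mono add_strict_mono) auto
  also have "\<dots> = e" by (simp add: \<delta>_def)
  finally show "\<exists>F G. poly G 0 = 0 \<and> (\<integral>t. norm (f t - (poly F t + cnj (poly G t))) powr p \<partial>circ) < e"
    using FG(1) by blast
qed (use assms in auto)

lemma trig_approx_lim:
  assumes p: "0 < p" and f: "\<And>n. trig_approx p (f n)" and g: "integrable circ g"
    and bound: "\<And>n t. norm (f n t - h t) powr p \<le> g t"
    and lim: "\<And>t. (\<lambda>n. f n t) \<longlonglongrightarrow> h t"
  shows "trig_approx p h"
proof -
  have [measurable]: "f n \<in> borel_measurable borel" for n
    using f[of n] by (simp add: trig_approx_def)
  have fI: "integrable circ (\<lambda>t. norm (f n t) powr p)" for n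
    using f[of n] by (simp add: trig_approx_def)
  have h: "h \<in> borel_measurable borel"
    by (rule borel_measurable_LIMSEQ_metric[OF _ lim]) simp
  note [measurable] = h
  \<comment> \<open>The dominating function controls only differences, so h is reached as (h - f 0)
    + f 0.\<close>
  have "integrable circ (\<lambda>t. norm (h t - f 0 t) powr p)"
    by (rule integrable_circ_mono[OF g]) (use bound[of 0] in \<open>auto simp: norm_minus_commute\<close>)
  from integrable_add_powr[OF _ _ this fI[of 0]] p
  have hI: "integrable circ (\<lambda>t. norm (h t) powr p)" by simp
  have "(\<lambda>n. \<integral>t. norm (h t - f n t) powr p \<partial>circ) \<longlonglongrightarrow> (\<integral>t. 0 \<partial>circ)"
  proof (rule integral_dominated_convergence[OF _ _ g])
    have "(\<lambda>n. norm (h t - f n t) powr p) \<longlonglongrightarrow> norm (h t - h t) powr p" for t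
      using p by (intro tendsto_intros lim tendsto_powr') auto
    then show "AE t in circ. (\<lambda>n. norm (h t - f n t) powr p) \<longlonglongrightarrow> 0"
      using p by simp
  qed (use bound in \<open>auto simp: norm_minus_commute\<close>)
  then have L: "(\<lambda>n. \<integral>t. norm (h t - f n t) powr p \<partial>circ) \<longlonglongrightarrow> 0" by simp
  show ?thesis
  proof (rule trig_approx_close[OF _ h hI])
    fix e :: real assume "0 < e"
    then have "\<forall>\<^sub>F n in sequentially. (\<integral>t. norm (h t - f n t) powr p \<partial>circ) < e"
      using L by (simp add: order_tendsto_iff)
    then show "\<exists>g. trig_approx p g \<and> (\<integral>t. norm (h t - g t) powr p \<partial>circ) < e"
      using f by (auto simp: eventually_sequentially)
  qed (use p in simp)
qed

section \<open>Indicator functions: from open sets to Borel sets\<close>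

lemma open_indicator_limit:
  fixes U :: "complex set"
  assumes "open U"
  obtains \<phi> :: "nat \<Rightarrow> complex \<Rightarrow> real"
  where "\<And>n. continuous_on UNIV (\<phi> n)" "\<And>n t. 0 \<le> \<phi> n t" "\<And>n t. \<phi> n t \<le> 1"
    "\<And>t. (\<lambda>n. \<phi> n t) \<longlonglongrightarrow> indicator U t"
proof (cases "U = UNIV")
  \<comment> \<open>\<open>infdist\<close> to the empty set is 0, so the distance formula used below
    would give 0 here instead of 1.\<close>
  case True
  show thesis
    by (rule that[of "\<lambda>_ _. 1"]) (auto simp: True)
next
  case False
  define \<phi> where "\<phi> n t = min 1 (real n * infdist t (- U))" for n t
  show thesis
  proof (rule that[of \<phi>])
    show "continuous_on UNIV (\<phi> n)" for n
      unfolding \<phi>_def by (intro continuous_intros)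
    show "(\<lambda>n. \<phi> n t) \<longlonglongrightarrow> indicator U t" for t
    proof (cases "t \<in> U")
      case True
      then have "0 < infdist t (- U)"
        using False \<open>open U\<close> in_closed_iff_infdist_zero[of "- U" t] infdist_nonneg[of t "- U"]
        by (auto simp: less_le)
      then have "filterlim (\<lambda>n. real n * infdist t (- U)) at_top sequentially"
        by (intro filterlim_at_top_mult_tendsto_pos[OF tendsto_const] filterlim_real_sequentially)
      then have "\<forall>\<^sub>F n in sequentially. 1 \<le> real n * infdist t (- U)"
        by (simp add: filterlim_at_top)
      then have "\<forall>\<^sub>F n in sequentially. \<phi> n t = 1"
        by eventually_elim (simp add: \<phi>_def)
      then show ?thesis using True by (simp add: tendsto_eventually)
    next
      case False
      then show ?thesis by (simp add: \<phi>_def)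
    qed
  qed (auto simp: \<phi>_def infdist_nonneg)
qed

text \<open>Dynkin's pi-lambda theorem for the generator of open sets, which is stable under
  intersection; this is why only disjoint unions have to be treated.\<close>

lemma borel_set_induct [consumes 1, case_names open_set compl disjoint_union]:
  assumes "B \<in> sets (borel :: complex measure)"
    and op: "\<And>U. open U \<Longrightarrow> P U"
    and compl: "\<And>A. A \<in> sets borel \<Longrightarrow> P A \<Longrightarrow> P (- A)"
    and union: "\<And>A :: nat \<Rightarrow> complex set. disjoint_family A \<Longrightarrow> (\<And>i. A i \<in> sets borel) \<Longrightarrow>
      (\<And>i. P (A i)) \<Longrightarrow> P (\<Union>i. A i)"
  shows "P B"
proof -
  have sets: "sets (borel :: complex measure) = sigma_sets UNIV {S. open S}"
    by (simp add: borel_def)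
  have "Int_stable {S :: complex set. open S}"
    by (auto simp: Int_stable_def)
  then show ?thesis
  proof (rule sigma_sets_induct_disjoint[of _ UNIV B P])
    show "B \<in> sigma_sets UNIV {S. open S}" using assms(1) sets by simp
    show "P (UNIV - A)" if "A \<in> sigma_sets UNIV {S. open S}" "P A" for A
      using compl[of A] that sets by (simp add: Compl_eq_Diff_UNIV)
    show "P (\<Union>i. A i)" if "disjoint_family A" "range A \<subseteq> sigma_sets UNIV {S. open S}" "\<And>i. P (A i)"
      for A :: "nat \<Rightarrow> complex set"
      using that sets by (intro union) auto
  qed (use op in auto)
qed

section \<open>Uniqueness of Fourier coefficients\<close>

text \<open>Orthogonality to f spreads from the powers of t to polynomials and their conjugates, to
  real parts, by uniform approximation to continuous functions, by dominated convergence to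
  indicators of open sets, and from there to all Borel sets. The sets on which Re f, -Re f, Im f or
  -Im f is positive then have to be null.\<close>

lemma integral_fourier_zero_imp_AE_zero:
  fixes f :: "complex \<Rightarrow> complex"
  assumes [measurable]: "f \<in> borel_measurable borel" and f: "integrable circ f"
    and zero: "\<And>n. (\<integral>t. f t * t powi n \<partial>circ) = 0"
  shows "AE t in circ. f t = 0"
proof -
  have int_mult: "integrable circ (\<lambda>t. f t * g t)" 
    if [measurable]: "g \<in> borel_measurable borel" and "\<And>t. norm t = 1 \<Longrightarrow> norm (g t) \<le> K" for g K
  proof (rule integrable_circ_mono)
    show "integrable circ (\<lambda>t. norm (f t) * K)" using f by simp
    show "norm (f t * g t) \<le> norm (f t) * K" if "norm t = 1" for t
      using \<open>\<And>t. norm t = 1 \<Longrightarrow> norm (g t) \<le> K\<close>[OF that] by (simp add: norm_mult mult_left_mono)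
  qed simp
  have int_pow: "integrable circ (\<lambda>t. f t * t powi n)" for n
    by (rule int_mult[where K = 1]) (auto simp: norm_power_int)
  have poly: "(\<integral>t. f t * poly F t \<partial>circ) = 0" for F
  proof -
    have "(\<integral>t. f t * poly F t \<partial>circ) = (\<integral>t. (\<Sum>i\<le>degree F. coeff F i * (f t * t powi int i)) \<partial>circ)"
      by (simp add: poly_altdef sum_distrib_left mult_ac)
    also have "\<dots> = (\<Sum>i\<le>degree F. coeff F i * (\<integral>t. f t * t powi int i \<partial>circ))"
      by (subst Bochner_Integration.integral_sum)
         (intro Bochner_Integration.integrable_mult_right int_pow, simp only: integral_mult_right_zero)
    finally show ?thesis by (simp only: zero) simp
  qed
  have cnj_poly: "(\<integral>t. f t * cnj (poly F t) \<partial>circ) = 0" for F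
  proof -
    have "(\<integral>t. f t * cnj (poly F t) \<partial>circ) =
        (\<integral>t. (\<Sum>i\<le>degree F. cnj (coeff F i) * (f t * t powi (- int i))) \<partial>circ)"
    proof (rule integral_cong_AE)
      show "AE t in circ. f t * cnj (poly F t) =
          (\<Sum>i\<le>degree F. cnj (coeff F i) * (f t * t powi (- int i)))"
        using AE_circ_norm
      proof eventually_elim
        case (elim t)
        note cnj = inverse_eq_cnj[OF elim, symmetric]
        have "cnj (t ^ i) = t powi (- int i)" for i
          by (simp add: cnj power_int_minus power_inverse)
        then show ?case by (simp add: poly_altdef sum_distrib_left mult_ac)
      qed
    qed auto
    also have "\<dots> = (\<Sum>i\<le>degree F. cnj (coeff F i) * (\<integral>t. f t * t powi (- int i) \<partial>circ))"
      by (subst Bochner_Integration.integral_sum)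
         (intro Bochner_Integration.integrable_mult_right int_pow, simp only: integral_mult_right_zero)
    finally show ?thesis by (simp only: zero) simp
  qed
  have bounded_poly: "\<exists>K. \<forall>t. norm t = 1 \<longrightarrow> norm (poly F t) \<le> K" for F :: "complex poly"
  proof -
    have "bounded (poly F ` sphere 0 1)"
      by (intro compact_imp_bounded compact_continuous_image continuous_intros compact_sphere)
    then show ?thesis unfolding bounded_iff by fastforce
  qed
  have Re_poly: "(\<integral>t. f t * of_real (Re (poly F t)) \<partial>circ) = 0" for F
  proof -
    obtain K where K: "\<And>t. norm t = 1 \<Longrightarrow> norm (poly F t) \<le> K" using bounded_poly by blast
    have "(\<integral>t. f t * of_real (Re (poly F t)) \<partial>circ) =
        (\<integral>t. (f t * poly F t + f t * cnj (poly F t)) / 2 \<partial>circ)"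
      by (intro Bochner_Integration.integral_cong refl)
         (simp add: complex_add_cnj distrib_left[symmetric])
    also have "\<dots> = ((\<integral>t. f t * poly F t \<partial>circ) + (\<integral>t. f t * cnj (poly F t) \<partial>circ)) / 2"
      using int_mult[of "poly F" K] int_mult[of "\<lambda>t. cnj (poly F t)" K] K by simp
    finally show ?thesis by (simp add: poly cnj_poly)
  qed
  have cont: "(\<integral>t. f t * of_real (\<phi> t) \<partial>circ) = 0"
    if \<phi>: "continuous_on UNIV \<phi>" for \<phi> :: "complex \<Rightarrow> real"
  proof -
    have [measurable]: "\<phi> \<in> borel_measurable borel"
      by (rule borel_measurable_continuous_onI[OF \<phi>])
    have "norm (\<integral>t. f t * of_real (\<phi> t) \<partial>circ) \<le> 0 + \<delta>" if "0 < \<delta>" for \<delta>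
    proof -
      define N where "N = (\<integral>t. norm (f t) \<partial>circ)"
      have "0 \<le> N" by (simp add: N_def)
      define e where "e = \<delta> / (N + 1)"
      have "0 < e" using \<open>0 < \<delta>\<close> \<open>0 \<le> N\<close> by (simp add: e_def)
      obtain F where F: "\<And>t. norm t = 1 \<Longrightarrow> \<bar>\<phi> t - Re (poly F t)\<bar> < e"
        using continuous_on_circle_approx[OF continuous_on_subset[OF \<phi> subset_UNIV] \<open>0 < e\<close>] by blast
      obtain K where K: "\<And>t. norm t = 1 \<Longrightarrow> norm (poly F t) \<le> K" using bounded_poly by blast
      have K': "\<bar>Re (poly F t)\<bar> \<le> K" if "norm t = 1" for t
        using K[OF that] abs_Re_le_cmod order_trans by blast
      have I1: "integrable circ (\<lambda>t. f t * of_real (Re (poly F t)))"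
        by (rule int_mult[of _ K]) (use K' in auto)
      have I2: "integrable circ (\<lambda>t. f t * of_real (\<phi> t - Re (poly F t)))"
        by (rule int_mult[of _ e]) (use F in \<open>auto intro: less_imp_le simp del: of_real_diff\<close>)
      have "(\<integral>t. f t * of_real (\<phi> t) \<partial>circ) =
          (\<integral>t. f t * of_real (\<phi> t - Re (poly F t)) + f t * of_real (Re (poly F t)) \<partial>circ)"
        by (simp add: algebra_simps)
      also have "\<dots> = (\<integral>t. f t * of_real (\<phi> t - Re (poly F t)) \<partial>circ)"
        using I1 I2 by (simp only: Bochner_Integration.integral_add Re_poly add_0_right)
      also have "norm \<dots> \<le> (\<integral>t. norm (f t * of_real (\<phi> t - Re (poly F t))) \<partial>circ)"
        by (rule integral_norm_bound)
      also have "\<dots> \<le> (\<integral>t. norm (f t) * e \<partial>circ)"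
      proof (rule integral_circ_mono)
        show "norm (f t * of_real (\<phi> t - Re (poly F t))) \<le> norm (f t) * e" if "norm t = 1" for t
          using F[OF that] unfolding norm_mult norm_of_real by (intro mult_left_mono) auto
      qed (use I2 f in auto)
      also have "\<dots> = N * e" by (simp add: N_def)
      also have "\<dots> \<le> \<delta>" using \<open>0 < \<delta>\<close> \<open>0 \<le> N\<close> by (simp add: e_def field_simps)
      finally show ?thesis by simp
    qed
    then have "norm (\<integral>t. f t * of_real (\<phi> t) \<partial>circ) \<le> 0" by (rule field_le_epsilon)
    then show ?thesis by simp
  qed
  have ind: "(\<integral>t. f t * of_real (indicator B t) \<partial>circ) = 0" if "B \<in> sets borel" for B
    using that
  proof (induction rule: borel_set_induct)
    case (open_set U)
    obtain \<phi> :: "nat \<Rightarrow> complex \<Rightarrow> real"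
      where \<phi>: "\<And>n. continuous_on UNIV (\<phi> n)" "\<And>n t. 0 \<le> \<phi> n t" "\<And>n t. \<phi> n t \<le> 1"
      "\<And>t. (\<lambda>n. \<phi> n t) \<longlonglongrightarrow> indicator U t"
      by (rule open_indicator_limit[OF open_set]) blast
    have [measurable]: "\<phi> n \<in> borel_measurable borel" for n
      by (rule borel_measurable_continuous_onI[OF \<phi>(1)])
    have [measurable]: "U \<in> sets borel" using open_set by simp
    have "(\<lambda>n. \<integral>t. f t * of_real (\<phi> n t) \<partial>circ) \<longlonglongrightarrow> (\<integral>t. f t * of_real (indicator U t) \<partial>circ)"
    proof (rule integral_dominated_convergence[where w = "\<lambda>t. norm (f t)"])
      show "AE t in circ. (\<lambda>n. f t * of_real (\<phi> n t)) \<longlonglongrightarrow> f t * of_real (indicator U t)"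
        by (intro AE_I2 tendsto_intros \<phi>(4))
      show "AE t in circ. norm (f t * of_real (\<phi> n t)) \<le> norm (f t)" for n
        using \<phi>(2,3) by (intro AE_I2) (simp add: norm_mult mult_left_le)
    qed (use f in auto)
    then show ?case using cont[OF \<phi>(1)] by (simp add: LIMSEQ_const_iff)
  next
    case (compl A)
    have I: "integrable circ (\<lambda>t. f t * of_real (indicator A t))"
      using compl(1) by (intro int_mult[of _ 1]) (auto simp: indicator_def)
    \<comment> \<open>The constant 1 appears as \<open>t powi 0\<close>, so that \<open>zero\<close>
      with exponent 0 gives its integral against f.\<close>
    have "(\<integral>t. f t * of_real (indicator (- A) t) \<partial>circ) =
        (\<integral>t. f t * t powi 0 - f t * of_real (indicator A t) \<partial>circ)"
      by (intro Bochner_Integration.integral_cong) (auto simp: indicator_def)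
    also have "\<dots> = 0"
      using I int_pow[of 0] zero[of 0] compl(2) by simp
    finally show ?case .
  next
    case (disjoint_union A)
    note [measurable] = disjoint_union(2)
    have fin: "(\<integral>t. f t * of_real (indicator (\<Union>i<n. A i) t) \<partial>circ) = 0" for n
    proof (induction n)
      case (Suc n)
      have "A n \<inter> (\<Union>i<n. A i) = {}"
        using disjoint_family_onD[OF disjoint_union(1), of n] by force
      then have "(\<integral>t. f t * of_real (indicator (\<Union>i<Suc n. A i) t) \<partial>circ) =
          (\<integral>t. f t * of_real (indicator (A n) t) + f t * of_real (indicator (\<Union>i<n. A i) t) \<partial>circ)"
        by (intro Bochner_Integration.integral_cong refl)
           (auto simp: lessThan_Suc indicator_def disjoint_iff)
      also have "\<dots> = (\<integral>t. f t * of_real (indicator (A n) t) \<partial>circ) +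
          (\<integral>t. f t * of_real (indicator (\<Union>i<n. A i) t) \<partial>circ)"
        by (intro Bochner_Integration.integral_add int_mult[of _ 1]) (auto simp: indicator_def)
      finally show ?case using Suc disjoint_union(3) by simp
    qed simp
    have "(\<lambda>n. \<integral>t. f t * of_real (indicator (\<Union>i<n. A i) t) \<partial>circ) \<longlonglongrightarrow>
        (\<integral>t. f t * of_real (indicator (\<Union>i. A i) t) \<partial>circ)"
    proof (rule integral_dominated_convergence[where w = "\<lambda>t. norm (f t)"])
      show "AE t in circ. (\<lambda>n. f t * of_real (indicator (\<Union>i<n. A i) t)) \<longlonglongrightarrow>
          f t * of_real (indicator (\<Union>i. A i) t)"
        by (intro AE_I2 tendsto_intros LIMSEQ_indicator_UN)
      show "AE t in circ. norm (f t * of_real (indicator (\<Union>i<n. A i) t)) \<le> norm (f t)" for n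
        by (intro AE_I2) (simp add: norm_mult mult_left_le)
    qed (use f in auto)
    then show ?case by (simp only: fin LIMSEQ_const_iff)
  qed
  have real_zero: "AE t in circ. h t \<le> 0"
    if h: "integrable circ h" and [measurable]: "h \<in> borel_measurable borel"
      and hz: "\<And>B. B \<in> sets borel \<Longrightarrow> (\<integral>t. h t * indicator B t \<partial>circ) = 0" for h :: "complex \<Rightarrow> real"
  proof -
    have "(\<integral>t. h t * indicator {t. 0 < h t} t \<partial>circ) = 0"
      by (rule hz) measurable
    moreover have "integrable circ (\<lambda>t. h t * indicator {t. 0 < h t} t)"
      by (rule integrable_circ_mono[of "\<lambda>t. norm (h t)"]) (use h in \<open>auto simp: indicator_def\<close>)
    ultimately have "AE t in circ. h t * indicator {t. 0 < h t} t = 0"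
      by (subst (asm) integral_nonneg_eq_0_iff_AE) (auto simp: indicator_def)
    then show ?thesis by eventually_elim (auto simp: indicator_def split: if_splits)
  qed
  have int_ind: "integrable circ (\<lambda>t. f t * of_real (indicator B t))" if "B \<in> sets borel" for B
    using that by (intro int_mult[of _ 1]) (auto simp: indicator_def)
  have Re0: "(\<integral>t. Re (f t) * indicator B t \<partial>circ) = 0" if "B \<in> sets borel" for B
    using integral_Re[OF int_ind[OF that]] ind[OF that] by simp
  have Im0: "(\<integral>t. Im (f t) * indicator B t \<partial>circ) = 0" if "B \<in> sets borel" for B
    using integral_Im[OF int_ind[OF that]] ind[OF that] by simp
  have "AE t in circ. Re (f t) \<le> 0" "AE t in circ. - Re (f t) \<le> 0"
    by (intro real_zero; use f Re0 in simp)+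
  moreover have "AE t in circ. Im (f t) \<le> 0" "AE t in circ. - Im (f t) \<le> 0"
    by (intro real_zero; use f Im0 in simp)+
  ultimately show ?thesis
    by eventually_elim (simp add: complex_eq_iff)
qed

section \<open>Approximation of arbitrary L^p functions\<close>

lemma trig_approx_imp:
  assumes "trig_approx p f"
  shows "f \<in> borel_measurable borel" "integrable circ (\<lambda>t. norm (f t) powr p)"
    "\<And>e. 0 < e \<Longrightarrow> \<exists>F G. poly G 0 = 0 \<and>
      (\<integral>t. norm (f t - (poly F t + cnj (poly G t))) powr p \<partial>circ) < e"
  using assms by (auto simp: trig_approx_def)

lemma trig_approx_add:
  assumes p: "0 < p" and f: "trig_approx p f" and g: "trig_approx p g"
  shows "trig_approx p (\<lambda>t. f t + g t)"
  unfolding trig_approx_def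
proof (intro conjI allI impI)
  note fm = trig_approx_imp[OF f] and gm = trig_approx_imp[OF g]
  show "(\<lambda>t. f t + g t) \<in> borel_measurable borel" using fm gm by simp
  show "integrable circ (\<lambda>t. norm (f t + g t) powr p)"
    using fm gm p by (intro integrable_add_powr) auto
  fix e :: real assume "0 < e"
  define \<delta> where "\<delta> = e / (2 powr p * 2)"
  have "0 < \<delta>" using \<open>0 < e\<close> by (simp add: \<delta>_def)
  obtain F G where F: "poly G 0 = 0" "(\<integral>t. norm (f t - (poly F t + cnj (poly G t))) powr p \<partial>circ) < \<delta>"
    using fm(3)[OF \<open>0 < \<delta>\<close>] by blast
  obtain F' G' where F': "poly G' 0 = 0" "(\<integral>t. norm (g t - (poly F' t + cnj (poly G' t))) powr p \<partial>circ) < \<delta>"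
    using gm(3)[OF \<open>0 < \<delta>\<close>] by blast
  have "f t + g t - (poly (F + F') t + cnj (poly (G + G') t)) =
      (f t - (poly F t + cnj (poly G t))) + (g t - (poly F' t + cnj (poly G' t)))" for t
    by simp
  then have "(\<integral>t. norm (f t + g t - (poly (F + F') t + cnj (poly (G + G') t))) powr p \<partial>circ) =
      (\<integral>t. norm ((f t - (poly F t + cnj (poly G t))) + (g t - (poly F' t + cnj (poly G' t)))) powr p \<partial>circ)"
    by presburger
  also have "\<dots> \<le> 2 powr p * ((\<integral>t. norm (f t - (poly F t + cnj (poly G t))) powr p \<partial>circ) +
      (\<integral>t. norm (g t - (poly F' t + cnj (poly G' t))) powr p \<partial>circ))"
    using fm(1,2) gm(1,2) p
    by (intro integral_add_powr_le integrable_diff_powr integrable_trig_poly_powr) auto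
  also have "\<dots> < 2 powr p * (\<delta> + \<delta>)"
    using F F' by (intro mult_strict_left_mono add_strict_mono) auto
  also have "\<dots> = e" by (simp add: \<delta>_def)
  finally show "\<exists>F G. poly G 0 = 0 \<and> (\<integral>t. norm (f t + g t - (poly F t + cnj (poly G t))) powr p \<partial>circ) < e"
    using F(1) F'(1) by (intro exI[of _ "F + F'"] exI[of _ "G + G'"]) simp
qed

lemma trig_approx_scale:
  assumes p: "0 < p" and f: "trig_approx p f"
  shows "trig_approx p (\<lambda>t. z * f t)"
  unfolding trig_approx_def
proof (intro conjI allI impI)
  note fm = trig_approx_imp[OF f]
  show "(\<lambda>t. z * f t) \<in> borel_measurable borel" using fm by simp
  show "integrable circ (\<lambda>t. norm (z * f t) powr p)"
    using fm by (intro integrable_scale_powr)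
  fix e :: real assume "0 < e"
  define \<delta> where "\<delta> = e / (norm z powr p + 1)"
  have pos: "0 < norm z powr p + 1" by (intro add_nonneg_pos) auto
  have "0 < \<delta>" using \<open>0 < e\<close> pos by (simp add: \<delta>_def)
  obtain F G where F: "poly G 0 = 0" "(\<integral>t. norm (f t - (poly F t + cnj (poly G t))) powr p \<partial>circ) < \<delta>"
    using fm(3)[OF \<open>0 < \<delta>\<close>] by blast
  have "z * f t - (poly (smult z F) t + cnj (poly (smult (cnj z) G) t)) = z * (f t - (poly F t + cnj (poly G t)))" for t
    by (simp add: algebra_simps)
  then have "(\<integral>t. norm (z * f t - (poly (smult z F) t + cnj (poly (smult (cnj z) G) t))) powr p \<partial>circ) =
      norm z powr p * (\<integral>t. norm (f t - (poly F t + cnj (poly G t))) powr p \<partial>circ)"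
    by (simp add: norm_mult powr_mult)
  also have "\<dots> \<le> norm z powr p * \<delta>"
    using F by (intro mult_left_mono) auto
  also have "\<dots> < e"
    using \<open>0 < e\<close> pos by (simp add: \<delta>_def field_simps)
  finally show "\<exists>F G. poly G 0 = 0 \<and> (\<integral>t. norm (z * f t - (poly F t + cnj (poly G t))) powr p \<partial>circ) < e"
    using F(1) by (intro exI[of _ "smult z F"] exI[of _ "smult (cnj z) G"]) simp
qed

lemma trig_approx_continuous:
  fixes \<phi> :: "complex \<Rightarrow> real"
  assumes p: "0 < p" and \<phi>: "continuous_on UNIV \<phi>"
  shows "trig_approx p (\<lambda>t. of_real (\<phi> t))"
  unfolding trig_approx_def
proof (intro conjI allI impI)
  have [measurable]: "\<phi> \<in> borel_measurable borel"
    by (rule borel_measurable_continuous_onI[OF \<phi>])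
  show "(\<lambda>t. complex_of_real (\<phi> t)) \<in> borel_measurable borel" by measurable
  show "integrable circ (\<lambda>t. norm (complex_of_real (\<phi> t)) powr p)"
    using p by (intro integrable_circ_continuous continuous_on_powr' continuous_intros
        continuous_on_subset[OF \<phi>]) auto
  fix e :: real assume "0 < e"
  define \<delta> where "\<delta> = (e / 2) powr (1 / p)"
  have "0 < \<delta>" using \<open>0 < e\<close> by (simp add: \<delta>_def)
  then obtain F where F: "\<And>t. norm t = 1 \<Longrightarrow> \<bar>\<phi> t - Re (poly F t)\<bar> < \<delta>"
    using continuous_on_circle_approx[OF continuous_on_subset[OF \<phi> subset_UNIV]] by blast
  \<comment> \<open>Re F is half of F plus half of its conjugate. Subtracting c makes the conjugated
    polynomial vanish at 0, and cnj c on the analytic side compensates.\<close>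
  define c where "c = poly F 0 / 2"
  define G H where "G = smult (1 / 2) F - [:c:]" and "H = smult (1 / 2) F + [:cnj c:]"
  have q: "poly H t + cnj (poly G t) = of_real (Re (poly F t))" for t
    by (simp add: G_def H_def complex_eq_iff)
  have "(\<integral>t. norm (complex_of_real (\<phi> t) - (poly H t + cnj (poly G t))) powr p \<partial>circ) \<le> (\<integral>t. \<delta> powr p \<partial>circ)"
  proof (rule integral_circ_mono)
    have "norm (complex_of_real (\<phi> t) - (poly H t + cnj (poly G t))) = \<bar>\<phi> t - Re (poly F t)\<bar>" for t
      unfolding q by (simp flip: of_real_diff)
    then show "norm (complex_of_real (\<phi> t) - (poly H t + cnj (poly G t))) powr p \<le> \<delta> powr p"
      if "norm t = 1" for t
      using F[OF that] p by (intro powr_mono2) auto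
    show "integrable circ (\<lambda>t. norm (complex_of_real (\<phi> t) - (poly H t + cnj (poly G t))) powr p)"
      using p by (intro integrable_circ_continuous continuous_on_powr' continuous_intros
        continuous_on_subset[OF \<phi>]) auto
  qed simp
  also have "\<dots> < e"
    using \<open>0 < e\<close> p by (simp add: \<delta>_def powr_powr)
  finally show "\<exists>F G. poly G 0 = 0 \<and> (\<integral>t. norm (complex_of_real (\<phi> t) - (poly F t + cnj (poly G t))) powr p \<partial>circ) < e"
    by (intro exI[of _ H] exI[of _ G]) (simp add: G_def c_def)
qed

lemma norm_of_real_diff_powr_le_1:
  assumes "0 \<le> x" "x \<le> 1" "0 \<le> y" "y \<le> 1" "0 < p"
  shows "norm (complex_of_real x - complex_of_real y) powr p \<le> 1"
proof -
  have "norm (complex_of_real x - complex_of_real y) \<le> 1"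
    using assms by (simp flip: of_real_diff)
  then have "norm (complex_of_real x - complex_of_real y) powr p \<le> 1 powr p"
    using assms by (intro powr_mono2) auto
  then show ?thesis by simp
qed

lemma trig_approx_indicator:
  assumes p: "0 < p" and "B \<in> sets borel"
  shows "trig_approx p (\<lambda>t. of_real (indicator B t))"
  using assms(2)
proof (induction rule: borel_set_induct)
  case (open_set U)
  obtain \<phi> :: "nat \<Rightarrow> complex \<Rightarrow> real"
    where \<phi>: "\<And>n. continuous_on UNIV (\<phi> n)" "\<And>n t. 0 \<le> \<phi> n t" "\<And>n t. \<phi> n t \<le> 1"
    "\<And>t. (\<lambda>n. \<phi> n t) \<longlonglongrightarrow> indicator U t"
    by (rule open_indicator_limit[OF open_set]) blast
  show ?case
  proof (rule trig_approx_lim[OF p, where g = "\<lambda>_. 1"])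
    show "trig_approx p (\<lambda>t. of_real (\<phi> n t))" for n
      by (rule trig_approx_continuous[OF p \<phi>(1)])
    show "norm (complex_of_real (\<phi> n t) - complex_of_real (indicator U t)) powr p \<le> 1" for n t
      using p \<phi>(2,3) by (intro norm_of_real_diff_powr_le_1) auto
  qed (auto intro!: tendsto_of_real \<phi>(4))
next
  case (compl A)
  have "trig_approx p (\<lambda>t. of_real 1 + (-1) * of_real (indicator A t))"
    by (intro trig_approx_add[OF p trig_approx_continuous[OF p continuous_on_const]
          trig_approx_scale[OF p compl(2)]])
  moreover have "of_real 1 + (-1) * of_real (indicator A t) = complex_of_real (indicator (- A) t)" for t
    by (simp add: indicator_def)
  ultimately show ?case by simp
next
  case (disjoint_union A)
  show ?case
  proof (rule trig_approx_lim[OF p, where g = "\<lambda>_. 1"])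
    show "trig_approx p (\<lambda>t. of_real (indicator (\<Union>i<n. A i) t))" for n
    proof (induction n)
      case 0
      show ?case using trig_approx_continuous[OF p, of "\<lambda>_. 0"] by simp
    next
      case (Suc n)
      have "A n \<inter> (\<Union>i<n. A i) = {}"
        using disjoint_family_onD[OF disjoint_union(1), of n] by force
      then have "complex_of_real (indicator (\<Union>i<Suc n. A i) t) =
          of_real (indicator (A n) t) + of_real (indicator (\<Union>i<n. A i) t)" for t
        by (auto simp: lessThan_Suc indicator_def disjoint_iff)
      then show ?case
        using trig_approx_add[OF p disjoint_union(3) Suc] by presburger
    qed
    show "norm (complex_of_real (indicator (\<Union>i<n. A i) t) - complex_of_real (indicator (\<Union>i. A i) t)) powr p \<le> 1" for n t
      using p by (intro norm_of_real_diff_powr_le_1) auto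
  qed (auto intro!: tendsto_of_real LIMSEQ_indicator_UN)
qed

lemma trig_approx_sum:
  assumes "0 < p" "finite I" "\<And>i. i \<in> I \<Longrightarrow> trig_approx p (f i)"
  shows "trig_approx p (\<lambda>t. \<Sum>i\<in>I. f i t)"
  using assms(2,3)
proof (induction I rule: finite_induct)
  case empty
  show ?case using trig_approx_continuous[OF \<open>0 < p\<close>, of "\<lambda>_. 0"] by simp
next
  case (insert i I)
  then show ?case using trig_approx_add[OF \<open>0 < p\<close>] by simp
qed

lemma trig_approx_Lp:
  assumes p: "0 < p" and f: "f \<in> borel_measurable borel" and I: "integrable circ (\<lambda>t. norm (f t) powr p)"
  shows "trig_approx p f"
proof -
  have "f \<in> borel_measurable circ" using f by simp
  from borel_measurable_implies_sequence_metric[OF this, of 0]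
  obtain s where s: "\<And>i. simple_function circ (s i)" "\<And>t. (\<lambda>i. s i t) \<longlonglongrightarrow> f t"
    "\<And>i t. norm (s i t) \<le> 2 * norm (f t)"
    by auto
  show ?thesis
  proof (rule trig_approx_lim[OF p])
    fix n
    have fin: "finite (range (s n))"
      using s(1)[of n] by (simp add: simple_function_def)
    have sets: "s n -` {y} \<in> sets borel" if "y \<in> range (s n)" for y
      using s(1)[of n] that by (auto simp: simple_function_def)
    have "s n t = (\<Sum>y\<in>range (s n). y * of_real (indicator (s n -` {y}) t))" for t
    proof -
      have "(\<Sum>y\<in>range (s n). y * of_real (indicator (s n -` {y}) t)) =
          (\<Sum>y\<in>range (s n). if y = s n t then y else 0)"
        by (intro sum.cong) (auto simp: indicator_def)
      then show ?thesis using fin by simp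
    qed
    then have "s n = (\<lambda>t. \<Sum>y\<in>range (s n). y * of_real (indicator (s n -` {y}) t))" by blast
    moreover have "trig_approx p (\<lambda>t. \<Sum>y\<in>range (s n). y * of_real (indicator (s n -` {y}) t))"
      using fin sets p by (intro trig_approx_sum trig_approx_scale trig_approx_indicator)
    ultimately show "trig_approx p (s n)" by simp
  next
    fix n t
    \<comment> \<open>The 3 is 2 + 1, from norm (s n t) \<le> 2 norm (f t). This bound also supplies
      the dominating function, left schematic so far.\<close>
    have "norm (s n t - f t) powr p \<le> (3 * norm (f t)) powr p"
      using norm_triangle_ineq4[of "s n t" "f t"] s(3)[of n t] p by (intro powr_mono2) auto
    then show "norm (s n t - f t) powr p \<le> 3 powr p * norm (f t) powr p"
      by (simp add: powr_mult)
  qed (use I s(2) in auto)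
qed

section \<open>Fourier integrals: continuity in the p-th mean, and vanishing for polynomials\<close>

lemma fourier_integrable:
  fixes f :: "complex \<Rightarrow> complex"
  assumes [measurable]: "f \<in> borel_measurable borel" and "integrable circ f"
  shows "integrable circ (\<lambda>t. f t * t powi n)"
  by (rule integrable_circ_mono[OF integrable_norm[OF assms(2)]]) (auto simp: norm_mult norm_power_int)

lemma fourier_diff_le:
  fixes f g :: "complex \<Rightarrow> complex"
  assumes "1 < p" and [measurable]: "f \<in> borel_measurable borel" "g \<in> borel_measurable borel"
    and I: "integrable circ (\<lambda>t. norm (f t) powr p)" "integrable circ (\<lambda>t. norm (g t) powr p)"
  shows "norm ((\<integral>t. f t * t powi n \<partial>circ) - (\<integral>t. g t * t powi n \<partial>circ)) powr p
    \<le> 2 powr p * (\<integral>t. norm (f t - g t) powr p \<partial>circ)"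
proof -
  have i: "integrable circ f" "integrable circ g"
    by (rule powr_integrable_imp_integrable[OF \<open>1 < p\<close> _ I(1)], simp,
        rule powr_integrable_imp_integrable[OF \<open>1 < p\<close> _ I(2)], simp)
  have I': "integrable circ (\<lambda>t. norm (f t - g t) powr p)"
    using integrable_diff_powr[OF _ _ I] \<open>1 < p\<close> by simp
  have I2: "integrable circ (\<lambda>t. norm ((f t - g t) * t powi n) powr p)"
    by (rule integrable_circ_mono[OF I']) (measurable, simp add: norm_mult norm_power_int)
  have "(\<integral>t. f t * t powi n \<partial>circ) - (\<integral>t. g t * t powi n \<partial>circ) = (\<integral>t. (f t - g t) * t powi n \<partial>circ)"
    using fourier_integrable[OF _ i(1)] fourier_integrable[OF _ i(2)] by (simp add: left_diff_distrib)
  also have "norm \<dots> powr p \<le> 2 powr p * (\<integral>t. norm ((f t - g t) * t powi n) powr p \<partial>circ)"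
    using I2 \<open>1 < p\<close> by (intro norm_integral_powr_le) auto
  also have "(\<integral>t. norm ((f t - g t) * t powi n) powr p \<partial>circ) \<le> (\<integral>t. norm (f t - g t) powr p \<partial>circ)"
    using I' I2 by (intro integral_circ_mono) (auto simp: norm_mult norm_power_int)
  finally show ?thesis by simp
qed

text \<open>Integration against \<open>t powi n\<close> gives the coefficient of index -n, so
  positive n are the negative frequencies. The integrand is a polynomial vanishing at 0, and its
  circle mean is its value there.\<close>

lemma poly_fourier_negative:
  assumes "0 < n"
  shows "(\<integral>t. poly F t * t powi n \<partial>circ) = 0"
proof -
  define k where "k = nat n"
  have "n = int k" "0 < k" using assms by (auto simp: k_def)
  then have "(\<integral>t. poly F t * t powi n \<partial>circ) = (\<integral>t. poly (F * monom 1 k) t \<partial>circ)"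
    by (simp add: poly_monom)
  also have "\<dots> = 0"
    using \<open>0 < k\<close> by (simp only: integral_poly) (simp add: poly_monom)
  finally show ?thesis .
qed

text \<open>On the circle the integrand is the conjugate of G(t) t^k with k = -n, so its mean is the
  conjugate of the value at 0. For k = 0 it is the condition on G that makes this vanish.\<close>

lemma cnj_poly_fourier_nonnegative:
  assumes "n \<le> 0" and "poly G 0 = 0"
  shows "(\<integral>t. cnj (poly G t) * t powi n \<partial>circ) = 0"
proof -
  define k where "k = nat (- n)"
  have k: "n = - int k" using assms by (auto simp: k_def)
  have "(\<integral>t. cnj (poly G t) * t powi n \<partial>circ) = (\<integral>t. cnj (poly (G * monom 1 k) t) \<partial>circ)"
  proof (rule integral_cong_AE)
    show "AE t in circ. cnj (poly G t) * t powi n = cnj (poly (G * monom 1 k) t)"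
      using AE_circ_norm
    proof eventually_elim
      case (elim t)
      note cnj = inverse_eq_cnj[OF elim, symmetric]
      show ?case by (simp add: cnj k power_int_minus power_inverse poly_monom)
    qed
  qed auto
  also have "\<dots> = cnj (\<integral>t. poly (G * monom 1 k) t \<partial>circ)"
    using integrable_poly[of "G * monom 1 k"] by (simp del: poly_mult)
  also have "\<dots> = 0"
    by (simp only: integral_poly) (simp add: assms)
  finally show ?thesis .
qed

section \<open>The Riesz projection\<close>

text \<open>The weights \<open>T ^ m\<close> leave integrals of size K 2^-m, whose sum is finite. So
  almost everywhere the weighted p-th powers of the increments are summable and tend to 0.\<close>

lemma Lp_limit_AE_convergent:
  fixes h :: "nat \<Rightarrow> complex \<Rightarrow> complex" and p K :: real
  assumes "0 < p" and [measurable]: "\<And>m. h m \<in> borel_measurable borel"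
    and I: "\<And>m. integrable circ (\<lambda>t. norm (h (Suc m) t - h m t) powr p)"
    and K: "\<And>m. (\<integral>t. norm (h (Suc m) t - h m t) powr p \<partial>circ) \<le> K * (1 / (2 * 2 powr p)) ^ m"
  shows "AE t in circ. convergent (\<lambda>m. h m t)"
proof -
  define T where "T = (2::real) powr p"
  have T: "0 < T" by (simp add: T_def)
  \<comment> \<open>Since T^m = (2^m)^p, the inequality a m t < 1 says that the increment is below
    2^-m; this makes the telescoping series converge.\<close>
  define a where "a m t = T ^ m * norm (h (Suc m) t - h m t) powr p" for m t
  have a0: "0 \<le> a m t" for m t using T by (simp add: a_def)
  have [measurable]: "a m \<in> borel_measurable borel" for m
    unfolding a_def by measurable
  have "(\<integral>\<^sup>+t. ennreal (a m t) \<partial>circ) \<le> ennreal (K * (1 / 2) ^ m)" for m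
  proof -
    have "(\<integral>\<^sup>+t. ennreal (a m t) \<partial>circ) = ennreal (\<integral>t. a m t \<partial>circ)"
      using I[of m] a0 by (intro nn_integral_eq_integral) (auto simp: a_def)
    also have "(\<integral>t. a m t \<partial>circ) \<le> T ^ m * (K * (1 / (2 * T)) ^ m)"
      using K[of m] T I[of m] by (simp add: a_def T_def[symmetric] mult_left_mono)
    also have "\<dots> = K * (1 / 2) ^ m"
      using T by (simp add: power_mult_distrib power_divide field_simps)
    finally show ?thesis using ennreal_leI by blast
  qed
  then have "(\<Sum>m. \<integral>\<^sup>+t. ennreal (a m t) \<partial>circ) \<le> (\<Sum>m. ennreal (K * (1 / 2) ^ m))"
    by (intro suminf_le) auto
  also have "\<dots> \<le> (\<Sum>m. ennreal (\<bar>K\<bar> * (1 / 2) ^ m))"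
    by (intro suminf_le ennreal_leI mult_right_mono) auto
  also have "\<dots> < top"
    unfolding less_top[symmetric] by (intro ennreal_suminf_neq_top summable_mult summable_geometric) auto
  finally have "(\<integral>\<^sup>+t. (\<Sum>m. ennreal (a m t)) \<partial>circ) < top"
    by (subst nn_integral_suminf) auto
  then have "AE t in circ. (\<Sum>m. ennreal (a m t)) \<noteq> \<infinity>"
    by (intro nn_integral_noteq_infinite) auto
  then show ?thesis
  proof eventually_elim
    case (elim t)
    then have "summable (\<lambda>m. a m t)"
      using a0 by (intro summable_suminf_not_top) (auto simp: infinity_ennreal_def)
    then have "(\<lambda>m. a m t) \<longlonglongrightarrow> 0" by (rule summable_LIMSEQ_zero)
    then have "\<forall>\<^sub>F m in sequentially. a m t < 1"
      by (rule order_tendstoD(2)) simp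
    then have "\<forall>\<^sub>F m in sequentially. norm (h (Suc m) t - h m t) \<le> (1 / 2) ^ m"
    proof eventually_elim
      case (elim m)
      let ?x = "norm (h (Suc m) t - h m t)"
      have "(2 ^ m * ?x) powr p = (2 ^ m) powr p * ?x powr p"
        by (simp add: powr_mult)
      also have "(2 ^ m) powr p = T ^ m"
        by (simp add: T_def powr_power powr_realpow[symmetric] powr_powr mult.commute)
      finally have "(2 ^ m * ?x) powr p < 1 powr p"
        using elim by (simp add: a_def)
      then have "2 ^ m * ?x < 1"
        using powr_mono2[of p 1 "2 ^ m * ?x"] \<open>0 < p\<close> by (meson less_eq_real_def not_less zero_le_one)
      then show ?case by (simp add: power_divide field_simps)
    qed
    then have "summable (\<lambda>m. h (Suc m) t - h m t)"
      by (rule summable_comparison_test_ev) (simp add: summable_geometric)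
    then have "convergent (\<lambda>n. h 0 t + (\<Sum>m<n. h (Suc m) t - h m t))"
      by (intro convergent_add convergent_const) (simp add: summable_iff_convergent)
    moreover have "h 0 t + (\<Sum>m<n. h (Suc m) t - h m t) = h n t" for n
      using sum_lessThan_telescope[of "\<lambda>m. h m t" n] by simp
    ultimately show ?case by simp
  qed
qed

text \<open>Under this rate of decay the sequence itself converges almost everywhere, and Fatou's
  lemma carries the bound on h k - h m over to g - h m.\<close>

lemma Lp_complete_fast:
  fixes h :: "nat \<Rightarrow> complex \<Rightarrow> complex" and p K :: real
  assumes "0 < p" and h [measurable]: "\<And>m. h m \<in> borel_measurable borel"
    and I: "\<And>m. integrable circ (\<lambda>t. norm (h m t) powr p)"
    and K: "\<And>m k. m \<le> k \<Longrightarrow> (\<integral>t. norm (h k t - h m t) powr p \<partial>circ) \<le> K * (1 / (2 * 2 powr p)) ^ m"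
  obtains g where "g \<in> borel_measurable borel" "integrable circ (\<lambda>t. norm (g t) powr p)"
    "\<And>m. (\<integral>t. norm (g t - h m t) powr p \<partial>circ) \<le> K * (1 / (2 * 2 powr p)) ^ m"
proof -
  define r where "r = (1 / (2 * (2::real) powr p))"
  define g where "g t = lim (\<lambda>m. h m t)" for t
  have [measurable]: "g \<in> borel_measurable borel"
    unfolding g_def by measurable
  have Id: "integrable circ (\<lambda>t. norm (h k t - h m t) powr p)" for k m
    using I \<open>0 < p\<close> by (intro integrable_diff_powr h) auto
  have "AE t in circ. convergent (\<lambda>m. h m t)"
    by (rule Lp_limit_AE_convergent[OF \<open>0 < p\<close> h Id K]) simp
  then have lim: "AE t in circ. (\<lambda>m. h m t) \<longlonglongrightarrow> g t"
    by eventually_elim (simp add: g_def convergent_LIMSEQ_iff)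
  have nn: "(\<integral>\<^sup>+t. ennreal (norm (g t - h m t) powr p) \<partial>circ) \<le> ennreal (K * r ^ m)" for m
  proof -
    have "(\<integral>\<^sup>+t. ennreal (norm (g t - h m t) powr p) \<partial>circ) =
        (\<integral>\<^sup>+t. liminf (\<lambda>k. ennreal (norm (h k t - h m t) powr p)) \<partial>circ)"
    proof (rule nn_integral_cong_AE)
      show "AE t in circ. ennreal (norm (g t - h m t) powr p) =
          liminf (\<lambda>k. ennreal (norm (h k t - h m t) powr p))"
        using lim
      proof eventually_elim
        case (elim t)
        have "(\<lambda>k. ennreal (norm (h k t - h m t) powr p)) \<longlonglongrightarrow> ennreal (norm (g t - h m t) powr p)"
          using \<open>0 < p\<close> by (intro tendsto_ennrealI tendsto_powr' tendsto_intros elim) auto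
        from lim_imp_Liminf[OF _ this] show ?case by simp
      qed
    qed
    also have "\<dots> \<le> liminf (\<lambda>k. \<integral>\<^sup>+t. ennreal (norm (h k t - h m t) powr p) \<partial>circ)"
      by (intro nn_integral_liminf) measurable
    also have "\<dots> \<le> liminf (\<lambda>k. ennreal (K * r ^ m))"
    proof (rule Liminf_mono)
      show "\<forall>\<^sub>F k in sequentially. (\<integral>\<^sup>+t. ennreal (norm (h k t - h m t) powr p) \<partial>circ) \<le> ennreal (K * r ^ m)"
        using eventually_ge_at_top[of m]
      proof eventually_elim
        case (elim k)
        have "(\<integral>\<^sup>+t. ennreal (norm (h k t - h m t) powr p) \<partial>circ) =
            ennreal (\<integral>t. norm (h k t - h m t) powr p \<partial>circ)"
          using Id by (intro nn_integral_eq_integral) auto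
        then show ?case using K[OF elim] by (simp add: r_def ennreal_leI)
      qed
    qed
    also have "\<dots> = ennreal (K * r ^ m)" by (simp add: Liminf_const)
    finally show ?thesis .
  qed
  have Ig: "integrable circ (\<lambda>t. norm (g t - h m t) powr p)" for m
  proof (rule integrableI_nonneg)
    show "(\<integral>\<^sup>+t. ennreal (norm (g t - h m t) powr p) \<partial>circ) < \<infinity>"
      using nn[of m] by (simp add: le_less_trans)
  qed auto
  \<comment> \<open>\<open>ennreal\<close> sends negative numbers to 0, so returning to real
    integrals requires a nonnegative bound; the case k = m of the hypothesis provides it.\<close>
  have K0: "0 \<le> K * r ^ m" for m
    by (rule order_trans[OF _ K[of m m, folded r_def]]) simp_all
  have "(\<integral>t. norm (g t - h m t) powr p \<partial>circ) \<le> K * r ^ m" for m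
    using nn[of m] K0[of m] Ig[of m] by (simp add: nn_integral_eq_integral)
  moreover have "integrable circ (\<lambda>t. norm (g t) powr p)"
    using integrable_add_powr[OF _ _ Ig[of 0] I[of 0]] \<open>0 < p\<close> by simp
  ultimately show thesis
    by (intro that[of g]) (auto simp: r_def)
qed

text \<open>Take trigonometric polynomials approaching f at a geometric rate. The a priori bound
  makes their analytic parts approach some g at the same rate, and Fourier integrals are continuous
  under such limits. The exponent n is minus the Fourier index, so n \<le> 0 is the analytic
  half.\<close>

theorem riesz_projection_exists:
  fixes f :: "complex \<Rightarrow> complex"
  assumes p: "1 < p" and f [measurable]: "f \<in> borel_measurable borel"
    and I: "integrable circ (\<lambda>t. norm (f t) powr p)"
  obtains g where "g \<in> borel_measurable borel" "integrable circ (\<lambda>t. norm (g t) powr p)"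
    "\<And>n. 0 < n \<Longrightarrow> (\<integral>t. g t * t powi n \<partial>circ) = 0"
    "\<And>n. n \<le> 0 \<Longrightarrow> (\<integral>t. g t * t powi n \<partial>circ) = (\<integral>t. f t * t powi n \<partial>circ)"
proof -
  have p0: "0 < p" "0 \<le> p" using p by auto
  obtain C where C: "0 \<le> C" "\<And>F G. poly G 0 = 0 \<Longrightarrow>
      (\<integral>t. norm (poly F t) powr p \<partial>circ) \<le> C * (\<integral>t. norm (poly F t + cnj (poly G t)) powr p \<partial>circ)"
    using integral_poly_powr_le_trig_poly[OF p] by blast
  define T where "T = (2::real) powr p"
  \<comment> \<open>The rate demanded by \<open>Lp_complete_fast\<close>.\<close>
  define r where "r = 1 / (2 * T)"
  have T: "1 < T" unfolding T_def using powr_less_mono[of 0 p 2] p by simp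
  have r: "0 < r" "r < 1" using T by (auto simp: r_def)
  have "\<exists>F G. poly G 0 = 0 \<and> (\<integral>t. norm (f t - (poly F t + cnj (poly G t))) powr p \<partial>circ) < r ^ m" for m
    using trig_approx_imp(3)[OF trig_approx_Lp[OF p0(1) f I]] r by simp
  then obtain F G where FG: "\<And>m. poly (G m) 0 = 0"
    "\<And>m. (\<integral>t. norm (f t - (poly (F m) t + cnj (poly (G m) t))) powr p \<partial>circ) < r ^ m"
    by metis
  let ?q = "\<lambda>m t. poly (F m) t + cnj (poly (G m) t)"
  have Iq: "integrable circ (\<lambda>t. norm (?q m t) powr p)" for m
    by (rule integrable_trig_poly_powr[OF p0(1)])
  have Ifq: "integrable circ (\<lambda>t. norm (f t - ?q m t) powr p)" for m
    using I Iq p0 by (intro integrable_diff_powr) auto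
  \<comment> \<open>F k - F m is the analytic part of the difference of two approximants, which
    equals (f - q m) - (f - q k), a difference of two small terms.\<close>
  have cauchy: "(\<integral>t. norm (poly (F k) t - poly (F m) t) powr p \<partial>circ) \<le> (C * (T * 2)) * r ^ m"
    if "m \<le> k" for m k
  proof -
    have "(\<integral>t. norm (poly (F k) t - poly (F m) t) powr p \<partial>circ) =
        (\<integral>t. norm (poly (F k - F m) t) powr p \<partial>circ)"
      by simp
    also have "\<dots> \<le> C * (\<integral>t. norm (poly (F k - F m) t + cnj (poly (G k - G m) t)) powr p \<partial>circ)"
      by (rule C(2)) (simp add: FG(1))
    also have "(\<integral>t. norm (poly (F k - F m) t + cnj (poly (G k - G m) t)) powr p \<partial>circ) =
        (\<integral>t. norm ((f t - ?q m t) + - (f t - ?q k t)) powr p \<partial>circ)"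
      by (simp add: algebra_simps)
    also have "\<dots> \<le> T * ((\<integral>t. norm (f t - ?q m t) powr p \<partial>circ) + (\<integral>t. norm (- (f t - ?q k t)) powr p \<partial>circ))"
      unfolding T_def
    proof (rule integral_add_powr_le)
      show "integrable circ (\<lambda>t. norm (- (f t - ?q k t)) powr p)"
        using Ifq[of k] by (simp only: norm_minus_cancel)
    qed (use Ifq p0 in auto)
    also have "\<dots> \<le> T * (r ^ m + r ^ m)"
    proof (intro mult_left_mono add_mono)
      show "(\<integral>t. norm (f t - ?q m t) powr p \<partial>circ) \<le> r ^ m"
        using FG(2)[of m] by simp
      have "(\<integral>t. norm (- (f t - ?q k t)) powr p \<partial>circ) \<le> r ^ k"
        using FG(2)[of k] by (simp only: norm_minus_cancel)
      also have "r ^ k \<le> r ^ m"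
        using r that by (intro power_decreasing) auto
      finally show "(\<integral>t. norm (- (f t - ?q k t)) powr p \<partial>circ) \<le> r ^ m" .
    qed (use T in simp)
    finally show ?thesis using C(1) by (simp add: mult_left_mono)
  qed
  obtain g where g [measurable]: "g \<in> borel_measurable borel" and Ig: "integrable circ (\<lambda>t. norm (g t) powr p)"
    and gF: "\<And>m. (\<integral>t. norm (g t - poly (F m) t) powr p \<partial>circ) \<le> (C * (T * 2)) * r ^ m"
    using Lp_complete_fast[OF p0(1) borel_measurable_poly integrable_poly_powr[OF p0(1)],
        of F "C * (T * 2)", folded T_def, folded r_def] cauchy
    by blast
  have rlim: "(\<lambda>m. c * r ^ m) \<longlonglongrightarrow> 0" for c
    using r by (intro tendsto_mult_right_zero LIMSEQ_power_zero) auto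
  have zero: "norm z = 0" if z: "\<And>m. norm z powr p \<le> c * r ^ m" for z :: complex and c
  proof -
    have "norm z powr p \<le> 0"
      using z by (intro LIMSEQ_le_const[OF rlim[of c]]) auto
    then show ?thesis by simp
  qed
  have gF': "norm ((\<integral>t. g t * t powi n \<partial>circ) - (\<integral>t. poly (F m) t * t powi n \<partial>circ)) powr p
      \<le> T * ((C * (T * 2)) * r ^ m)" for n m
  proof -
    have "norm ((\<integral>t. g t * t powi n \<partial>circ) - (\<integral>t. poly (F m) t * t powi n \<partial>circ)) powr p
      \<le> T * (\<integral>t. norm (g t - poly (F m) t) powr p \<partial>circ)"
      unfolding T_def using p0 Ig by (intro fourier_diff_le p integrable_poly_powr) auto
    also have "\<dots> \<le> T * ((C * (T * 2)) * r ^ m)"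
      using gF T by (intro mult_left_mono) auto
    finally show ?thesis .
  qed
  have fq: "norm ((\<integral>t. f t * t powi n \<partial>circ) - (\<integral>t. ?q m t * t powi n \<partial>circ)) powr p \<le> T * r ^ m" for n m
  proof -
    have "norm ((\<integral>t. f t * t powi n \<partial>circ) - (\<integral>t. ?q m t * t powi n \<partial>circ)) powr p
      \<le> T * (\<integral>t. norm (f t - ?q m t) powr p \<partial>circ)"
      unfolding T_def using p0 I Iq by (intro fourier_diff_le p) auto
    also have "\<dots> \<le> T * r ^ m"
      using FG(2)[of m] T by (intro mult_left_mono) auto
    finally show ?thesis .
  qed
  have q: "(\<integral>t. ?q m t * t powi n \<partial>circ) = (\<integral>t. poly (F m) t * t powi n \<partial>circ)" if "n \<le> 0" for n m
  proof -
    have 1: "integrable circ (\<lambda>t. poly (F m) t * t powi n)"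
      by (intro fourier_integrable integrable_poly) simp
    have 2: "integrable circ (\<lambda>t. cnj (poly (G m) t) * t powi n)"
      using integrable_poly[of "G m"] by (intro fourier_integrable) auto
    show ?thesis
      using 1 2 cnj_poly_fourier_nonnegative[OF that FG(1), of m] by (simp add: distrib_right)
  qed
  show thesis
  proof (rule that[OF g Ig])
    fix n :: int
    show "(\<integral>t. g t * t powi n \<partial>circ) = 0" if "0 < n"
      using zero[of "\<integral>t. g t * t powi n \<partial>circ" "T * (C * (T * 2))"] gF'[of n]
      by (simp add: poly_fourier_negative[OF that] mult.assoc)
    show "(\<integral>t. g t * t powi n \<partial>circ) = (\<integral>t. f t * t powi n \<partial>circ)" if n: "n \<le> 0"
    proof -
      let ?g = "\<integral>t. g t * t powi n \<partial>circ" and ?f = "\<integral>t. f t * t powi n \<partial>circ"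
      have "norm (?g - ?f) powr p \<le> (T * (T * (C * (T * 2)) + T)) * r ^ m" for m
      proof -
        let ?F = "\<integral>t. poly (F m) t * t powi n \<partial>circ"
        have "norm (?g - ?f) powr p = norm ((?g - ?F) - (?f - ?F)) powr p"
          by simp
        also have "\<dots> \<le> T * (norm (?g - ?F) powr p + norm (?f - ?F) powr p)"
          unfolding T_def by (rule norm_diff_powr_le[OF p0(2)])
        also have "\<dots> \<le> T * (T * ((C * (T * 2)) * r ^ m) + T * r ^ m)"
          using gF'[of n m] fq[of n m] T unfolding q[OF n] by (intro mult_left_mono add_mono) auto
        finally show ?thesis by (simp add: algebra_simps)
      qed
      from zero[OF this] show ?thesis by simp
    qed
  qed
qed

section \<open>Operations on functions modulo equality almost everywhere\<close>

lemma distr_circ_cnj: "distr circ borel cnj = circ"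
proof -
  let ?U = "uniform_measure lborel {-pi..pi::real}"
  have U: "distr ?U borel uminus = ?U"
  proof (rule measure_eqI)
    fix B assume "B \<in> sets (distr ?U borel uminus)"
    then have [measurable]: "B \<in> sets borel" by simp
    have "emeasure lborel ({-pi..pi} \<inter> uminus -` B) = emeasure lborel (uminus -` ({-pi..pi} \<inter> B))"
      by (rule arg_cong[of _ _ "emeasure lborel"]) auto
    also have "\<dots> = emeasure (distr lborel borel uminus) ({-pi..pi} \<inter> B)"
      by (subst emeasure_distr) auto
    also have "\<dots> = emeasure lborel ({-pi..pi} \<inter> B)"
      by (simp only: lborel_distr_uminus)
    finally show "emeasure (distr ?U borel uminus) B = emeasure ?U B"
      by (simp add: emeasure_distr measurable_sets_borel[of uminus borel])
  qed simp
  have "distr circ borel cnj = distr ?U borel (cnj \<circ> cis)"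
    unfolding circ_def by (subst distr_distr) auto
  also have "cnj \<circ> cis = cis \<circ> uminus"
    by (auto simp: cis_cnj)
  also have "distr ?U borel (cis \<circ> uminus) = distr (distr ?U borel uminus) borel cis"
    by (subst distr_distr) auto
  finally show ?thesis by (simp add: U circ_def)
qed

lemma integrable_circ_cnj:
  fixes f :: "complex \<Rightarrow> 'b::{banach, second_countable_topology}"
  assumes "f \<in> borel_measurable borel"
  shows "integrable circ (\<lambda>t. f (cnj t)) \<longleftrightarrow> integrable circ f"
proof -
  have "integrable (distr circ borel cnj) f \<longleftrightarrow> integrable circ (\<lambda>t. f (cnj t))"
    using assms by (intro integrable_distr_eq) auto
  then show ?thesis by (simp add: distr_circ_cnj)
qed

lemma integral_circ_cnj:
  fixes f :: "complex \<Rightarrow> 'b::{banach, second_countable_topology}"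
  assumes "f \<in> borel_measurable borel"
  shows "(\<integral>t. f (cnj t) \<partial>circ) = (\<integral>t. f t \<partial>circ)"
proof -
  have "(\<integral>t. f t \<partial>distr circ borel cnj) = (\<integral>t. f (cnj t) \<partial>circ)"
    using assms by (intro integral_distr) auto
  then show ?thesis by (simp add: distr_circ_cnj)
qed

lemma Lp_zero [simp]: "0 \<in> Lp p"
  unfolding Lp_def mem_Collect_eq by transfer simp

lemma Lp_add: "1 < p \<Longrightarrow> f \<in> Lp p \<Longrightarrow> g \<in> Lp p \<Longrightarrow> f + g \<in> Lp p"
  unfolding Lp_def mem_Collect_eq
  by transfer (auto simp: eq_ae_def intro!: integrable_add_powr)

lemma Lp_cscale: "f \<in> Lp p \<Longrightarrow> cscale z f \<in> Lp p"
  unfolding Lp_def mem_Collect_eq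
  by transfer (intro integrable_scale_powr)

lemma Lp_mult_Linf:
  assumes "1 < p" "a \<in> Linf" "f \<in> Lp p"
  shows "a * f \<in> Lp p"
  using assms unfolding Lp_def Linf_def mem_Collect_eq
proof (transfer, clarify)
  fix p :: real and a f :: "complex \<Rightarrow> complex" and K
  assume "1 < p" and "eq_ae a a" "eq_ae f f" and K: "AE t in circ. norm (a t) \<le> K"
    and I: "integrable circ (\<lambda>t. norm (f t) powr p)"
  then have [measurable]: "a \<in> borel_measurable borel" "f \<in> borel_measurable borel"
    by (auto simp: eq_ae_def)
  show "integrable circ (\<lambda>t. norm (a t * f t) powr p)"
  proof (rule Bochner_Integration.integrable_bound)
    show "integrable circ (\<lambda>t. K powr p * norm (f t) powr p)"
      using I by simp
    show "AE t in circ. norm (norm (a t * f t) powr p) \<le> norm (K powr p * norm (f t) powr p)"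
      using K
    proof eventually_elim
      case (elim t)
      then have "norm (a t) powr p \<le> K powr p"
        using \<open>1 < p\<close> by (intro powr_mono2) auto
      then show ?case
        by (simp add: norm_mult powr_mult mult_right_mono)
    qed
  qed measurable
qed

lemma Lp_flipJ:
  assumes "f \<in> Lp p"
  shows "flipJ f \<in> Lp p"
  using assms unfolding Lp_def mem_Collect_eq
proof (transfer, clarify)
  fix p :: real and f :: "complex \<Rightarrow> complex"
  assume "eq_ae f f" and I: "integrable circ (\<lambda>t. norm (f t) powr p)"
  then have [measurable]: "f \<in> borel_measurable borel"
    by (auto simp: eq_ae_def)
  have "integrable circ (\<lambda>t. norm (f (cnj t)) powr p)"
    using integrable_circ_cnj[of "\<lambda>t. norm (f t) powr p"] I by simp
  then show "integrable circ (\<lambda>t. norm (cnj t * f (cnj t)) powr p)"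
    by (rule integrable_circ_mono) (measurable, simp add: norm_mult)
qed

lemma tilde_mult: "tilde (a * b) = tilde a * tilde b"
  by transfer (simp add: eq_ae_def)

lemma tilde_one [simp]: "tilde 1 = 1"
  by transfer (simp add: eq_ae_def)

lemma tilde_tilde [simp]: "tilde (tilde a) = a"
  by transfer (simp add: eq_ae_def)

lemma flipJ_add: "flipJ (f + g) = flipJ f + flipJ g"
  by transfer (simp add: eq_ae_def algebra_simps)

lemma flipJ_diff: "flipJ (f - g) = flipJ f - flipJ g"
  by transfer (simp add: eq_ae_def algebra_simps)

lemma flipJ_cscale: "flipJ (cscale z f) = cscale z (flipJ f)"
  by transfer (simp add: eq_ae_def algebra_simps)

lemma flipJ_flipJ [simp]: "flipJ (flipJ f) = f"
proof (transfer, clarify)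
  fix f :: "complex \<Rightarrow> complex" assume "eq_ae f f"
  then have [measurable]: "f \<in> borel_measurable borel" by (simp add: eq_ae_def)
  have "AE t in circ. cnj t * (cnj (cnj t) * f (cnj (cnj t))) = f t"
    using AE_circ_norm by eventually_elim
      (simp add: mult.assoc[symmetric] complex_norm_square[symmetric] mult.commute[of "cnj _"])
  then show "eq_ae (\<lambda>t. cnj t * (cnj (cnj t) * f (cnj (cnj t)))) f"
    by (simp add: eq_ae_def)
qed

lemma flipJ_mult: "flipJ (a * f) = tilde a * flipJ f"
proof (transfer, clarify)
  fix a f :: "complex \<Rightarrow> complex" assume "eq_ae a a" "eq_ae f f"
  then have [measurable]: "a \<in> borel_measurable borel" "f \<in> borel_measurable borel"
    by (auto simp: eq_ae_def)
  have "AE t in circ. cnj t * (a (cnj t) * f (cnj t)) = a (1 / t) * (cnj t * f (cnj t))"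
    using AE_circ_norm by eventually_elim (simp add: divide_inverse inverse_eq_cnj)
  then show "eq_ae (\<lambda>t. cnj t * (a (cnj t) * f (cnj t))) (\<lambda>t. a (1 / t) * (cnj t * f (cnj t)))"
    by (simp add: eq_ae_def)
qed

lemma flipJ_zero [simp]: "flipJ 0 = 0"
  using flipJ_diff[of 0 0] by simp

lemma Linf_tilde: "a \<in> Linf \<Longrightarrow> tilde a \<in> Linf"
  unfolding Linf_def mem_Collect_eq
proof (transfer, clarify)
  fix a :: "complex \<Rightarrow> complex" and K
  assume "eq_ae a a" and K: "AE t in circ. norm (a t) \<le> K"
  then have [measurable]: "a \<in> borel_measurable borel" by (simp add: eq_ae_def)
  have "AE t in circ. norm (a (cnj t)) \<le> K"
    by (rule AE_circ_cnj[OF _ K]) measurable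
  then have "AE t in circ. norm (a (1 / t)) \<le> K"
    using AE_circ_norm by eventually_elim (simp add: divide_inverse inverse_eq_cnj)
  then show "\<exists>K. AE t in circ. norm (a (1 / t)) \<le> K" by blast
qed

lemma Linf_mult: "a \<in> Linf \<Longrightarrow> b \<in> Linf \<Longrightarrow> a * b \<in> Linf"
  unfolding Linf_def mem_Collect_eq
proof (transfer, clarify)
  fix a b :: "complex \<Rightarrow> complex" and K L
  assume "AE t in circ. norm (a t) \<le> K" "AE t in circ. norm (b t) \<le> L"
  then have "AE t in circ. norm (a t * b t) \<le> K * L"
  proof eventually_elim
    case (elim t)
    then show ?case unfolding norm_mult
      by (intro mult_mono) (auto intro: order_trans[OF norm_ge_zero])
  qed
  then show "\<exists>K. AE t in circ. norm (a t * b t) \<le> K" by blast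
qed

text \<open>\<open>circ_fun\<close> is a ring with zero divisors and its \<open>inverse\<close> is
  taken pointwise; this connects it with inverses in the ring.\<close>

lemma inverse_eqI: "a * b = 1 \<Longrightarrow> inverse a = (b :: circ_fun)"
proof (transfer, clarify)
  fix a b :: "complex \<Rightarrow> complex"
  assume "eq_ae a a" "eq_ae b b" "eq_ae (\<lambda>t. a t * b t) (\<lambda>_. 1)"
  then have [measurable]: "a \<in> borel_measurable borel" "b \<in> borel_measurable borel"
    and ab: "AE t in circ. a t * b t = 1"
    by (auto simp: eq_ae_def)
  from ab have "AE t in circ. inverse (a t) = b t"
    by eventually_elim (rule inverse_unique)
  then show "eq_ae (\<lambda>t. inverse (a t)) b" by (simp add: eq_ae_def)
qed

lemma mult_cscale: "a * cscale z f = cscale z (a * f)"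
  by transfer (simp add: eq_ae_def algebra_simps)

lemma cscale_half_add: "cscale (1 / 2) (f + f) = f"
  by transfer (auto simp: eq_ae_def)

lemma Linf_tpow: "tpow k \<in> Linf"
  unfolding Linf_def mem_Collect_eq
proof transfer
  fix k
  have "AE t in circ. norm (t powi k :: complex) \<le> 1"
    using AE_circ_norm by eventually_elim (simp add: norm_power_int)
  then show "\<exists>K. AE t in circ. norm (t powi k :: complex) \<le> K" by blast
qed

lemma tpow_add: "tpow k * tpow l = tpow (k + l)"
proof transfer
  fix k l
  have "AE t in circ. t powi k * t powi l = (t powi (k + l) :: complex)"
    using AE_circ_norm
  proof eventually_elim
    case (elim t)
    then have "t \<noteq> 0" by auto
    then show ?case by (simp add: power_int_add)
  qed
  then show "eq_ae (\<lambda>t. t powi k * t powi l) (\<lambda>t. t powi (k + l))"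
    by (simp add: eq_ae_def)
qed

lemma tpow_zero [simp]: "tpow 0 = 1"
  by transfer (simp add: eq_ae_def)

lemma Lp_integrable:
  assumes "1 < p" "eq_ae f f" "p_integrable p (abs_circ_fun f)"
  shows "f \<in> borel_measurable borel" "integrable circ (\<lambda>t. norm (f t) powr p)"
    "integrable circ (\<lambda>t. f t * t powi n)"
proof -
  show f: "f \<in> borel_measurable borel" using assms by (simp add: eq_ae_def)
  show I: "integrable circ (\<lambda>t. norm (f t) powr p)"
    using assms by (simp add: p_integrable.abs_eq)
  show "integrable circ (\<lambda>t. f t * t powi n)"
    by (intro fourier_integrable powr_integrable_imp_integrable[OF assms(1) f I] f)
qed

lemma fourier_add:
  assumes "1 < p" "f \<in> Lp p" "g \<in> Lp p"
  shows "fourier (f + g) n = fourier f n + fourier g n"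
  using assms unfolding Lp_def mem_Collect_eq
proof (induction f rule: circ_fun.abs_induct)
  case (1 f)
  then show ?case
  proof (induction g rule: circ_fun.abs_induct)
    case (1 g)
    have "eq_ae (\<lambda>t. f t + g t) (\<lambda>t. f t + g t)"
      using 1 by (auto simp: eq_ae_def)
    then show ?case
      using Lp_integrable(3)[OF 1(3,2,4)] Lp_integrable(3)[OF 1(3,1,5)] 1(1,2)
      by (simp add: plus_circ_fun.abs_eq fourier.abs_eq distrib_right)
  qed
qed

lemma fourier_cscale: "fourier (cscale z f) n = z * fourier f n"
proof (induction f rule: circ_fun.abs_induct)
  case (1 f)
  then have "eq_ae (\<lambda>t. z * f t) (\<lambda>t. z * f t)" by (auto simp: eq_ae_def)
  with 1 show ?case by (simp add: cscale.abs_eq fourier.abs_eq mult.assoc)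
qed

text \<open>The factor cnj t in J shifts the reflected index by one, so that nonnegative and
  negative indices are exchanged exactly.\<close>

lemma fourier_flipJ: "fourier (flipJ f) n = fourier f (- n - 1)"
proof (induction f rule: circ_fun.abs_induct)
  case (1 f)
  then have [measurable]: "f \<in> borel_measurable borel" by (simp add: eq_ae_def)
  have "(\<integral>t. cnj t * f (cnj t) * t powi (- n) \<partial>circ) = (\<integral>t. f (cnj t) * cnj t powi (n + 1) \<partial>circ)"
  proof (rule integral_cong_AE)
    show "AE t in circ. cnj t * f (cnj t) * t powi (- n) = f (cnj t) * cnj t powi (n + 1)"
      using AE_circ_norm
    proof eventually_elim
      case (elim t)
      then have "t \<noteq> 0" by auto
      have "t powi (- n) = cnj t powi n"
        using inverse_eq_cnj[OF elim] by (metis power_int_inverse power_int_minus)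
      then show ?case using \<open>t \<noteq> 0\<close> by (simp add: power_int_add mult_ac)
    qed
  qed auto
  also have "\<dots> = (\<integral>t. f t * t powi (n + 1) \<partial>circ)"
    by (rule integral_circ_cnj[of "\<lambda>t. f t * t powi (n + 1)"]) measurable
  finally show ?case
    using 1 by (simp add: flipJ.abs_eq fourier.abs_eq eq_ae_def add.commute)
qed

lemma fourier_tpow_mult: "fourier (tpow k * f) n = fourier f (n - k)"
proof (induction f rule: circ_fun.abs_induct)
  case (1 f)
  then have [measurable]: "f \<in> borel_measurable borel" by (simp add: eq_ae_def)
  have "(\<integral>t. t powi k * f t * t powi (- n) \<partial>circ) = (\<integral>t. f t * t powi (- (n - k)) \<partial>circ)"
  proof (rule integral_cong_AE)
    show "AE t in circ. t powi k * f t * t powi (- n) = f t * t powi (- (n - k))"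
      using AE_circ_norm
    proof eventually_elim
      case (elim t)
      then have "t \<noteq> 0" by auto
      then have "t powi k * t powi (- n) = t powi (- (n - k))"
        by (simp add: power_int_add[symmetric])
      then show ?case by (simp add: mult_ac)
    qed
  qed auto
  moreover have "eq_ae (\<lambda>t. t powi k) (\<lambda>t. t powi k)" by (simp add: eq_ae_def)
  ultimately show ?case
    using 1 by (simp add: tpow_def times_circ_fun.abs_eq fourier.abs_eq eq_ae_def)
qed

lemma fourier_unique:
  assumes "1 < p" "f \<in> Lp p" "\<And>n. fourier f n = 0"
  shows "f = 0"
  using assms unfolding Lp_def mem_Collect_eq
proof (induction f rule: circ_fun.abs_induct)
  case (1 f)
  note f = Lp_integrable(1,2)[OF 1(2,1,3)]
  have "(\<integral>t. f t * t powi n \<partial>circ) = 0" for n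
    using 1(4)[of "- n"] 1(1) by (simp add: fourier.abs_eq)
  from integral_fourier_zero_imp_AE_zero[OF f(1) powr_integrable_imp_integrable[OF 1(2) f] this]
  have "eq_ae f (\<lambda>_. 0)"
    using f(1) by (simp add: eq_ae_def)
  then show ?case
    using Quotient3_rel_abs[OF Quotient3_circ_fun] by (simp add: zero_circ_fun_def)
qed

lemma riesz_projection_Lp:
  assumes "1 < p" "f \<in> Lp p"
  shows "\<exists>g. g \<in> Lp p \<and> (\<forall>n. fourier g n = (if 0 \<le> n then fourier f n else 0))"
  using assms unfolding Lp_def mem_Collect_eq
proof (induction f rule: circ_fun.abs_induct)
  case (1 f)
  note f = Lp_integrable(1,2)[OF 1(2,1,3)]
  obtain g where g: "g \<in> borel_measurable borel" "integrable circ (\<lambda>t. norm (g t) powr p)"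
    "\<And>n. 0 < n \<Longrightarrow> (\<integral>t. g t * t powi n \<partial>circ) = 0"
    "\<And>n. n \<le> 0 \<Longrightarrow> (\<integral>t. g t * t powi n \<partial>circ) = (\<integral>t. f t * t powi n \<partial>circ)"
    using riesz_projection_exists[OF 1(2) f] by blast
  have "eq_ae g g" using g(1) by (simp add: eq_ae_def)
  then show ?case
    using 1(1) g by (intro exI[of _ "abs_circ_fun g"]) (auto simp: p_integrable.abs_eq fourier.abs_eq)
qed

lemma cscale_half: "cscale (1 / 2) (2 * f) = f"
  by (simp only: mult_2 cscale_half_add)

section \<open>Toeplitz and Hankel operators\<close>

locale hardy =
  fixes p :: real
  assumes p_gt_1: "1 < p"
begin

abbreviation "L \<equiv> Lp p"
abbreviation "H \<equiv> Hp p"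
abbreviation "P \<equiv> rieszP p"
abbreviation "Q \<equiv> rieszQ p"
abbreviation "T \<equiv> toeplitz p"

definition Hm :: "circ_fun set" where
  "Hm = {f \<in> L. \<forall>n\<ge>0. fourier f n = 0}"

lemmas L_add = Lp_add[OF p_gt_1]
lemmas L_mult = Lp_mult_Linf[OF p_gt_1]
lemmas L_fourier_add = fourier_add[OF p_gt_1]

lemma L_uminus: "f \<in> L \<Longrightarrow> - f \<in> L"
  using Lp_cscale[of f p "-1"] by (simp add: circ_fun.scale_minus_left)

lemma L_diff: "f \<in> L \<Longrightarrow> g \<in> L \<Longrightarrow> f - g \<in> L"
  using L_add[of f "- g"] L_uminus by simp

lemma fourier_zero [simp]: "fourier 0 n = 0"
  using fourier_cscale[of 0 0 n] by simp

lemma fourier_uminus: "fourier (- f) n = - fourier f n"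
  using fourier_cscale[of "-1" f n] by (simp add: circ_fun.scale_minus_left)

lemma L_fourier_diff: "f \<in> L \<Longrightarrow> g \<in> L \<Longrightarrow> fourier (f - g) n = fourier f n - fourier g n"
  using L_fourier_add[of f "- g" n] L_uminus fourier_uminus by simp

lemma L_eqI: "f \<in> L \<Longrightarrow> g \<in> L \<Longrightarrow> (\<And>n. fourier f n = fourier g n) \<Longrightarrow> f = g"
  using fourier_unique[OF p_gt_1 L_diff, of f g] L_fourier_diff by simp

text \<open>\<open>rieszP\<close> is a definite description, so its defining property takes
  uniqueness (\<open>L_eqI\<close>) besides existence.\<close>

lemma P_props:
  assumes "f \<in> L"
  shows "P f \<in> L \<and> (\<forall>n. fourier (P f) n = (if 0 \<le> n then fourier f n else 0))"
  unfolding rieszP_def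
proof (rule theI')
  show "\<exists>!g. g \<in> L \<and> (\<forall>n. fourier g n = (if 0 \<le> n then fourier f n else 0))"
    using riesz_projection_Lp[OF p_gt_1 assms] by (metis L_eqI)
qed

lemma P_L: "f \<in> L \<Longrightarrow> P f \<in> L"
  and fourier_P: "f \<in> L \<Longrightarrow> fourier (P f) n = (if 0 \<le> n then fourier f n else 0)"
  using P_props by auto

lemma H_L: "f \<in> H \<Longrightarrow> f \<in> L"
  and Hm_L: "f \<in> Hm \<Longrightarrow> f \<in> L"
  by (auto simp: Hp_def Hm_def)

lemma P_H: "f \<in> L \<Longrightarrow> P f \<in> H"
  by (auto simp: Hp_def P_L fourier_P)

lemma P_eqI: "f \<in> L \<Longrightarrow> g \<in> H \<Longrightarrow> (\<And>n. 0 \<le> n \<Longrightarrow> fourier f n = fourier g n) \<Longrightarrow> P f = g"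
  by (rule L_eqI) (auto simp: Hp_def P_L fourier_P)

lemma P_ident: "f \<in> H \<Longrightarrow> P f = f"
  by (rule P_eqI) (auto simp: Hp_def)

lemma H_add: "f \<in> H \<Longrightarrow> g \<in> H \<Longrightarrow> f + g \<in> H"
  by (auto simp: Hp_def L_add L_fourier_add)

lemma H_cscale: "f \<in> H \<Longrightarrow> cscale z f \<in> H"
  by (auto simp: Hp_def Lp_cscale fourier_cscale)

lemma H_diff: "f \<in> H \<Longrightarrow> g \<in> H \<Longrightarrow> f - g \<in> H"
  by (auto simp: Hp_def L_diff L_fourier_diff)

lemma H_zero: "0 \<in> H"
  by (auto simp: Hp_def)

lemma Hm_add: "f \<in> Hm \<Longrightarrow> g \<in> Hm \<Longrightarrow> f + g \<in> Hm"
  by (auto simp: Hm_def L_add L_fourier_add)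

lemma Hm_diff: "f \<in> Hm \<Longrightarrow> g \<in> Hm \<Longrightarrow> f - g \<in> Hm"
  by (auto simp: Hm_def L_diff L_fourier_diff)

lemma P_add: "f \<in> L \<Longrightarrow> g \<in> L \<Longrightarrow> P (f + g) = P f + P g"
  by (rule P_eqI) (auto simp: L_add H_add P_H L_fourier_add P_L fourier_P)

lemma P_diff: "f \<in> L \<Longrightarrow> g \<in> L \<Longrightarrow> P (f - g) = P f - P g"
  by (rule P_eqI) (auto simp: L_diff H_diff P_H L_fourier_diff P_L fourier_P)

lemma P_cscale: "f \<in> L \<Longrightarrow> P (cscale z f) = cscale z (P f)"
  by (rule P_eqI) (auto simp: Lp_cscale H_cscale P_H fourier_cscale P_L fourier_P)

lemma P_eq_zero_iff: "f \<in> L \<Longrightarrow> P f = 0 \<longleftrightarrow> f \<in> Hm"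
proof
  assume "f \<in> L" "P f = 0"
  have "fourier f n = 0" if "0 \<le> n" for n
    using fourier_P[OF \<open>f \<in> L\<close>, of n] that by (simp add: \<open>P f = 0\<close>)
  then show "f \<in> Hm" using \<open>f \<in> L\<close> by (simp add: Hm_def)
next
  assume "f \<in> L" "f \<in> Hm"
  then show "P f = 0" by (intro P_eqI) (auto simp: Hm_def H_zero)
qed

lemma Q_Hm: "f \<in> L \<Longrightarrow> Q f \<in> Hm"
  by (auto simp: rieszQ_def Hm_def L_diff P_L L_fourier_diff fourier_P)

lemma Q_ident: "f \<in> Hm \<Longrightarrow> Q f = f"
  using P_eq_zero_iff[of f] Hm_L[of f] by (simp add: rieszQ_def)

lemma flipJ_H: "f \<in> H \<Longrightarrow> flipJ f \<in> Hm"
  by (auto simp: Hp_def Hm_def Lp_flipJ fourier_flipJ)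

lemma flipJ_Hm: "f \<in> Hm \<Longrightarrow> flipJ f \<in> H"
  by (auto simp: Hp_def Hm_def Lp_flipJ fourier_flipJ)

lemma T_H: "a \<in> Linf \<Longrightarrow> f \<in> H \<Longrightarrow> T a f \<in> H"
  by (simp add: toeplitz_def P_H L_mult H_L)

lemma T_add: "a \<in> Linf \<Longrightarrow> f \<in> H \<Longrightarrow> g \<in> H \<Longrightarrow> T a (f + g) = T a f + T a g"
  by (simp add: toeplitz_def P_add L_mult H_L distrib_left)

lemma T_diff: "a \<in> Linf \<Longrightarrow> f \<in> H \<Longrightarrow> g \<in> H \<Longrightarrow> T a (f - g) = T a f - T a g"
  by (simp add: toeplitz_def P_diff L_mult H_L right_diff_distrib)

lemma T_cscale: "a \<in> Linf \<Longrightarrow> f \<in> H \<Longrightarrow> T a (cscale z f) = cscale z (T a f)"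
  by (simp add: toeplitz_def P_cscale L_mult H_L mult_cscale)

lemma T_eq_zero_iff: "a \<in> Linf \<Longrightarrow> f \<in> H \<Longrightarrow> T a f = 0 \<longleftrightarrow> a * f \<in> Hm"
  by (simp add: toeplitz_def P_eq_zero_iff L_mult H_L)

section \<open>Images of the projections and the splitting of the kernel\<close>

text \<open>If g * tilde g = 1, then s to J(g s) is an involution, and for e = 1 or -1 these are its
  eigenvectors in H with eigenvalue e. The sign is a ring element so that one computation serves
  both cases.\<close>

definition J_eigen :: "circ_fun \<Rightarrow> circ_fun \<Rightarrow> circ_fun set" where
  "J_eigen e g = {s \<in> H. g * s = e * flipJ s}"

text \<open>For f in the kernel of T(g), the product g f lies in \<open>Hm\<close>, so
  \<open>PP p g f\<close> is simply J(g f), and averaging f with it gives a fixed vector.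
  Conversely, g s = J s lies in \<open>Hm\<close>, so s is in the kernel and is fixed by
  \<open>PP_plus\<close>.\<close>

lemma im_PP_plus_eq:
  assumes g: "g \<in> Linf" and gg: "g * tilde g = 1"
  shows "im_PP_plus p g = J_eigen 1 g"
proof (intro equalityI subsetI)
  fix s assume "s \<in> im_PP_plus p g"
  then obtain f where f: "f \<in> H" "T g f = 0" and s: "s = PP_plus p g f"
    by (auto simp: im_PP_plus_def op_kernel_def)
  have gf: "g * f \<in> Hm" using f g by (simp add: T_eq_zero_iff)
  have s: "s = cscale (1 / 2) (f + flipJ (g * f))"
    using f gf by (simp add: s PP_plus_def PP_def P_ident Q_ident)
  have "g * (f + flipJ (g * f)) = g * f + (g * tilde g) * flipJ f"
    unfolding flipJ_mult[of g f] by (simp add: algebra_simps)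
  then have "g * (f + flipJ (g * f)) = flipJ (f + flipJ (g * f))"
    by (simp add: gg flipJ_add add.commute)
  then have "g * s = flipJ s" by (simp add: s mult_cscale flipJ_cscale)
  moreover have "s \<in> H" using f gf by (simp add: s H_cscale H_add flipJ_Hm)
  ultimately show "s \<in> J_eigen 1 g" by (simp add: J_eigen_def)
next
  fix s assume "s \<in> J_eigen 1 g"
  then have s: "s \<in> H" "g * s = flipJ s" by (auto simp: J_eigen_def)
  have Hm: "g * s \<in> Hm" using s by (simp add: flipJ_H)
  have "PP_plus p g s = s"
    using s Hm Q_ident[OF Hm] by (simp add: PP_plus_def PP_def P_ident cscale_half)
  moreover have "s \<in> op_kernel p (T g)" using s Hm g by (simp add: op_kernel_def T_eq_zero_iff)
  ultimately show "s \<in> im_PP_plus p g" unfolding im_PP_plus_def by (metis imageI)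
qed

lemma im_PP_minus_eq:
  assumes g: "g \<in> Linf" and gg: "g * tilde g = 1"
  shows "im_PP_minus p g = J_eigen (-1) g"
proof (intro equalityI subsetI)
  fix s assume "s \<in> im_PP_minus p g"
  then obtain f where f: "f \<in> H" "T g f = 0" and s: "s = PP_minus p g f"
    by (auto simp: im_PP_minus_def op_kernel_def)
  have gf: "g * f \<in> Hm" using f g by (simp add: T_eq_zero_iff)
  have s: "s = cscale (1 / 2) (f - flipJ (g * f))"
    using f gf by (simp add: s PP_minus_def PP_def P_ident Q_ident)
  have "g * (f - flipJ (g * f)) = g * f - (g * tilde g) * flipJ f"
    unfolding flipJ_mult[of g f] by (simp add: algebra_simps)
  then have "g * (f - flipJ (g * f)) = - flipJ (f - flipJ (g * f))"
    by (simp add: gg flipJ_diff)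
  then have "g * s = - flipJ s"
    by (simp add: s mult_cscale flipJ_cscale circ_fun.scale_minus_right del: minus_diff_eq)
  moreover have "s \<in> H" using f gf by (simp add: s H_cscale H_diff flipJ_Hm)
  ultimately show "s \<in> J_eigen (-1) g" by (simp add: J_eigen_def)
next
  fix s assume "s \<in> J_eigen (-1) g"
  then have s: "s \<in> H" "g * s = - flipJ s" by (auto simp: J_eigen_def)
  have Hm: "g * s \<in> Hm" using s flipJ_H[of s] Hm_diff[of 0 "flipJ s"] by (simp add: Hm_def)
  have "flipJ (g * s) = - s"
    using flipJ_diff[of 0 "flipJ s"] by (simp add: s(2))
  then have "PP_minus p g s = s"
    using s Hm Q_ident[OF Hm] by (simp add: PP_minus_def PP_def P_ident cscale_half)
  moreover have "s \<in> op_kernel p (T g)" using s Hm g by (simp add: op_kernel_def T_eq_zero_iff)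
  ultimately show "s \<in> im_PP_minus p g" unfolding im_PP_minus_def by (metis imageI)
qed

lemma cscale_half_twice: "cscale (1 / 2) f + cscale (1 / 2) f = f"
  by (simp only: circ_fun.scale_right_distrib[symmetric] cscale_half_add)

lemma kernel_direct_sum:
  fixes a b c d e ai bi :: circ_fun and R :: "circ_fun \<Rightarrow> circ_fun"
  assumes Linf: "a \<in> Linf" "b \<in> Linf" "ai \<in> Linf" "bi \<in> Linf"
    and inv: "a * ai = 1" "b * bi = 1" and match: "a * tilde a = b * tilde b"
    and c: "c = a * bi" and d: "d = b * tilde ai"
    and R_H: "\<And>f. f \<in> H \<Longrightarrow> R f \<in> H"
    and R_add: "\<And>f g. f \<in> H \<Longrightarrow> g \<in> H \<Longrightarrow> R (f + g) = R f + R g"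
    and R_cscale: "\<And>z f. f \<in> H \<Longrightarrow> R (cscale z f) = cscale z (R f)"
    and R_inv: "\<And>f. f \<in> H \<Longrightarrow> T c (R f) = f"
    and e: "e = 1 \<or> e = -1"
  defines "\<phi> \<equiv> (\<lambda>s. R (T (tilde ai) s) - e * flipJ (Q (c * P (R (T (tilde ai) s))))
      + e * flipJ (Q (tilde ai * s)))"
  shows "is_direct_sum {f \<in> H. P (a * f + e * (b * flipJ f)) = 0} (\<phi> ` J_eigen e d) (J_eigen (- e) c)"
proof -
  have ee: "e * e = 1" "e * (e * f) = f" for f
    using e by auto
  have e_H: "e * f \<in> H" if "f \<in> H" for f
    using e that H_diff[OF H_zero that] by auto
  have e_Hm: "e * f \<in> Hm" if "f \<in> Hm" for f
    using e that Hm_diff[OF _ that, of 0] by (auto simp: Hm_def)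
  have e_L: "e * f \<in> L" if "f \<in> L" for f
    using e that L_uminus by auto
  have flipJ_e: "flipJ (e * f) = e * flipJ f" for f
    using e flipJ_diff[of 0 f] by auto
  have tinv: "tilde a * tilde ai = 1" "tilde b * tilde bi = 1"
    using inv by (simp_all flip: tilde_mult)
  have tai: "tilde ai \<in> Linf" and cL: "c \<in> Linf" and dL: "d \<in> Linf"
    using Linf by (simp_all add: Linf_tilde Linf_mult c d)
  \<comment> \<open>These four products eliminate c and d: \<open>bc\<close> and \<open>acb\<close>
    serve the computation of \<psi> (\<phi> s), \<open>dta\<close> and \<open>dtb\<close> the
    equation d \<psi> f = e J \<psi> f. The matching condition enters in \<open>acb\<close> and
    \<open>dtb\<close>.\<close>
  have bc: "b * c = a" by (metis c inv(2) mult.assoc mult.commute mult_1_right)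
  have acb: "a * tilde c = b"
  proof -
    have "a * tilde c = (a * tilde a) * tilde bi" by (simp add: c tilde_mult mult.assoc)
    also have "\<dots> = b * (tilde b * tilde bi)" by (simp only: match mult.assoc)
    finally show ?thesis by (simp add: tinv)
  qed
  have dta: "d * tilde a = b"
  proof -
    have "d * tilde a = b * (tilde a * tilde ai)" by (simp add: d mult_ac)
    then show ?thesis by (simp add: tinv)
  qed
  have dtb: "d * tilde b = a"
  proof -
    have "d * tilde b = (b * tilde b) * tilde ai" by (simp add: d mult_ac)
    also have "\<dots> = a * (tilde a * tilde ai)" by (simp only: match[symmetric] mult.assoc)
    finally show ?thesis by (simp add: tinv)
  qed
  define \<psi> where "\<psi> f = flipJ (a * f + e * (b * flipJ f))" for f
  have \<psi>_diff: "\<psi> (f - g) = \<psi> f - \<psi> g" for f g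
    by (simp add: \<psi>_def flipJ_diff right_diff_distrib flipJ_add)
  have J_L: "a * f + e * (b * flipJ f) \<in> L" if "f \<in> H" for f
    using that Linf by (intro L_add e_L L_mult Lp_flipJ H_L)
  define K where "K = {f \<in> H. P (a * f + e * (b * flipJ f)) = 0}"
  have K_iff: "f \<in> K \<longleftrightarrow> f \<in> H \<and> a * f + e * (b * flipJ f) \<in> Hm" for f
    using P_eq_zero_iff[OF J_L] by (auto simp: K_def)
  have K_add: "f + g \<in> K" if "f \<in> K" "g \<in> K" for f g
  proof -
    have "a * (f + g) + e * (b * flipJ (f + g)) =
        (a * f + e * (b * flipJ f)) + (a * g + e * (b * flipJ g))"
      by (simp add: flipJ_add algebra_simps)
    then show ?thesis using that by (simp add: K_iff H_add Hm_add)
  qed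
  have \<psi>_zero_iff: "\<psi> f = 0 \<longleftrightarrow> c * f = - e * flipJ f" for f
  proof -
    have "\<psi> f = 0 \<longleftrightarrow> a * f + e * (b * flipJ f) = 0"
      unfolding \<psi>_def by (metis flipJ_flipJ flipJ_zero)
    also have "\<dots> \<longleftrightarrow> b * (c * f + e * flipJ f) = 0"
      by (simp add: bc[symmetric] algebra_simps)
    also have "\<dots> \<longleftrightarrow> c * f + e * flipJ f = 0"
      by (metis inv(2) mult.assoc mult.commute mult_1_left mult_zero_right)
    finally show ?thesis by (simp add: eq_neg_iff_add_eq_0)
  qed
  have Mc_iff: "f \<in> J_eigen (- e) c \<longleftrightarrow> f \<in> H \<and> \<psi> f = 0" for f
    by (simp add: J_eigen_def \<psi>_zero_iff)
  have Mc_K: "f \<in> K" if "f \<in> J_eigen (- e) c" for f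
  proof -
    have "a * f + e * (b * flipJ f) = 0"
      using that unfolding Mc_iff \<psi>_def by (metis flipJ_flipJ flipJ_zero)
    then show ?thesis using that by (simp add: K_iff Mc_iff) (simp add: Hm_def)
  qed
  have T_tai: "T (tilde ai) s \<in> H" if "s \<in> H" for s
    by (rule T_H[OF tai that])
  define w where "w s = R (T (tilde ai) s)" for s
  \<comment> \<open>Since w solves T(c) w = T(tilde ai) s, the analytic parts cancel and x lies in
    \<open>Hm\<close>. It joins both Q-terms of \<phi>, which leaves \<phi> s = w s - e J (x
    s).\<close>
  define x where "x s = c * w s - tilde ai * s" for s
  have w_H: "w s \<in> H" if "s \<in> H" for s
    by (simp add: w_def R_H T_tai that)
  have x: "x s \<in> Hm" "\<phi> s = w s - e * flipJ (x s)" if s: "s \<in> H" for s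
  proof -
    have L: "c * w s \<in> L" "tilde ai * s \<in> L"
      by (rule L_mult[OF cL H_L[OF w_H[OF s]]], rule L_mult[OF tai H_L[OF s]])
    have "P (c * w s) = P (tilde ai * s)"
      using R_inv[OF T_tai[OF s]] by (simp add: toeplitz_def w_def)
    then have xQ: "x s = Q (c * w s) - Q (tilde ai * s)"
      by (simp add: x_def rieszQ_def)
    then show "x s \<in> Hm" using L by (simp add: Hm_diff Q_Hm)
    show "\<phi> s = w s - e * flipJ (x s)"
      unfolding \<phi>_def xQ w_def[symmetric] using s
      by (simp add: P_ident w_H flipJ_diff algebra_simps)
  qed
  have \<phi>_H: "\<phi> s \<in> H" if "s \<in> H" for s
    using that by (simp add: x(2) H_diff e_H flipJ_Hm x(1) w_H)
  have Md_H: "s \<in> H" if "s \<in> J_eigen e d" for s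
    using that by (simp add: J_eigen_def)
  \<comment> \<open>With \<open>aJx\<close> and \<open>bx\<close> all terms in w cancel; what is
    left is e J s + d s, and the equation for s turns this into 2 e J s.\<close>
  have \<phi>_sym: "a * \<phi> s + e * (b * flipJ (\<phi> s)) = e * flipJ s + e * flipJ s" if s: "s \<in> J_eigen e d" for s
  proof -
    have ds: "d * s = e * flipJ s" using s by (simp add: J_eigen_def)
    have aJx: "a * flipJ (x s) = b * flipJ (w s) - flipJ s"
    proof -
      have "flipJ (x s) = tilde c * flipJ (w s) - ai * flipJ s"
        by (simp add: x_def flipJ_diff flipJ_mult)
      then have "a * flipJ (x s) = (a * tilde c) * flipJ (w s) - (a * ai) * flipJ s"
        by (simp add: right_diff_distrib mult.assoc)
      then show ?thesis by (simp add: acb inv)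
    qed
    have bx: "b * x s = a * w s - d * s"
    proof -
      have "b * x s = (b * c) * w s - (b * tilde ai) * s"
        by (simp add: x_def algebra_simps)
      then show ?thesis by (simp add: bc d)
    qed
    have "a * \<phi> s + e * (b * flipJ (\<phi> s)) =
        a * w s - e * (a * flipJ (x s)) + e * (b * flipJ (w s)) - e * (e * (b * x s))"
      by (simp add: x(2)[OF Md_H[OF s]] flipJ_diff flipJ_e algebra_simps)
    also have "\<dots> = e * flipJ s + d * s"
      unfolding ee(2) aJx bx by (simp add: algebra_simps)
    finally show ?thesis by (simp add: ds)
  qed
  have \<psi>\<phi>: "\<psi> (\<phi> s) = e * s + e * s" if "s \<in> J_eigen e d" for s
    by (simp only: \<psi>_def \<phi>_sym[OF that] flipJ_add flipJ_e flipJ_flipJ)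
  have \<phi>_K: "\<phi> s \<in> K" if "s \<in> J_eigen e d" for s
    unfolding K_iff \<phi>_sym[OF that] by (intro conjI Hm_add e_Hm flipJ_H \<phi>_H Md_H that)
  have \<psi>_M: "\<psi> f \<in> J_eigen e d" if "f \<in> K" for f
  proof -
    have "\<psi> f = tilde a * flipJ f + e * (tilde b * f)"
      by (simp only: \<psi>_def flipJ_add flipJ_e) (simp add: flipJ_mult)
    \<comment> \<open>Multiplication by d turns tilde a into b and tilde b into a, which swaps the
      two terms up to the factor e.\<close>
    then have "d * \<psi> f = (d * tilde a) * flipJ f + e * ((d * tilde b) * f)"
      by (simp add: algebra_simps)
    also have "\<dots> = e * (a * f + e * (b * flipJ f))"
      by (simp add: dta dtb distrib_left ee(2) add.commute)
    also have "\<dots> = e * flipJ (\<psi> f)" by (simp add: \<psi>_def)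
    finally show ?thesis using that by (simp add: J_eigen_def K_iff) (simp add: \<psi>_def flipJ_Hm)
  qed
  have M_sub: "circ_fun.subspace (J_eigen e' g)" for e' g
    unfolding circ_fun.subspace_def J_eigen_def
    by (auto simp: H_zero H_add H_cscale flipJ_add flipJ_cscale mult_cscale distrib_left)
  have \<phi>_add: "\<phi> (s + s') = \<phi> s + \<phi> s'" if "s \<in> H" "s' \<in> H" for s s'
  proof -
    have "w (s + s') = w s + w s'"
      using that by (simp add: w_def T_add[OF tai] R_add T_tai)
    then show ?thesis
      using that by (simp add: x(2) H_add) (simp add: x_def flipJ_add flipJ_diff algebra_simps)
  qed
  have \<phi>_cscale: "\<phi> (cscale z s) = cscale z (\<phi> s)" if "s \<in> H" for z s
  proof -
    have "w (cscale z s) = cscale z (w s)"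
      using that by (simp add: w_def T_cscale[OF tai] R_cscale T_tai)
    then have "x (cscale z s) = cscale z (x s)"
      by (simp add: x_def mult_cscale circ_fun.scale_right_diff_distrib)
    then show ?thesis
      using that \<open>w (cscale z s) = cscale z (w s)\<close>
      by (simp add: x(2) H_cscale flipJ_cscale mult_cscale circ_fun.scale_right_diff_distrib)
  qed
  have \<phi>_0: "\<phi> 0 = 0"
    using \<phi>_cscale[OF H_zero, of 0] by simp
  have M0: "0 \<in> J_eigen e' g" for e' g
    using M_sub by (simp add: circ_fun.subspace_def)
  have "circ_fun.subspace (\<phi> ` J_eigen e d)"
    unfolding circ_fun.subspace_def
  proof (intro conjI ballI allI)
    show "0 \<in> \<phi> ` J_eigen e d" using \<phi>_0 M0 by (metis imageI)
  next
    fix u v assume "u \<in> \<phi> ` J_eigen e d" "v \<in> \<phi> ` J_eigen e d"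
    then obtain s s' where "s \<in> J_eigen e d" "s' \<in> J_eigen e d" "u = \<phi> s" "v = \<phi> s'" by blast
    moreover from this have "s + s' \<in> J_eigen e d" using M_sub by (simp add: circ_fun.subspace_def)
    ultimately show "u + v \<in> \<phi> ` J_eigen e d" by (metis \<phi>_add Md_H imageI)
  next
    fix z u assume "u \<in> \<phi> ` J_eigen e d"
    then obtain s where "s \<in> J_eigen e d" "u = \<phi> s" by blast
    moreover from this have "cscale z s \<in> J_eigen e d" using M_sub by (simp add: circ_fun.subspace_def)
    ultimately show "cscale z u \<in> \<phi> ` J_eigen e d" by (metis \<phi>_cscale Md_H imageI)
  qed
  moreover have "\<phi> ` J_eigen e d \<inter> J_eigen (- e) c = {0}"
  proof (intro equalityI subsetI)
    fix v assume "v \<in> \<phi> ` J_eigen e d \<inter> J_eigen (- e) c"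
    then obtain s where s: "s \<in> J_eigen e d" "v = \<phi> s" "\<psi> v = 0"
      by (auto simp: Mc_iff)
    then have "e * s + e * s = 0" using \<psi>\<phi> by simp
    then have "e * s = 0" using cscale_half_add[of "e * s"] by (metis circ_fun.scale_zero_right)
    then have "s = 0" by (metis ee(2) mult_zero_right)
    then show "v \<in> {0}" using s \<phi>_0 by simp
  qed (use \<phi>_0 M0 in \<open>auto intro!: image_eqI[of _ _ 0]\<close>)
  moreover have "K = {u + v | u v. u \<in> \<phi> ` J_eigen e d \<and> v \<in> J_eigen (- e) c}"
  proof (intro equalityI subsetI)
    fix f assume f: "f \<in> K"
    \<comment> \<open>As \<psi> (\<phi> s) = 2 e s and e * e = 1, this is the choice for which f and
      \<phi> s have the same image under \<psi>.\<close>
    define s where "s = cscale (1 / 2) (e * \<psi> f)"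
    have "e * s = cscale (1 / 2) (\<psi> f)"
      by (simp add: s_def mult_cscale ee)
    then have es: "e * s + e * s = \<psi> f"
      by (simp only: cscale_half_twice)
    have "e * \<psi> f \<in> J_eigen e d"
      using \<psi>_M[OF f] e_H by (auto simp: J_eigen_def flipJ_e ee mult.left_commute[of d])
    then have s: "s \<in> J_eigen e d"
      using M_sub by (simp add: s_def circ_fun.subspace_def)
    have "\<psi> (f - \<phi> s) = 0"
      by (simp add: \<psi>_diff \<psi>\<phi>[OF s] es)
    moreover have "f - \<phi> s \<in> H"
      using f s by (simp add: H_diff \<phi>_H Md_H K_iff)
    ultimately have "f - \<phi> s \<in> J_eigen (- e) c" by (simp add: Mc_iff)
    moreover have "f = \<phi> s + (f - \<phi> s)" by simp
    ultimately show "f \<in> {u + v | u v. u \<in> \<phi> ` J_eigen e d \<and> v \<in> J_eigen (- e) c}"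
      using s by blast
  next
    fix f assume "f \<in> {u + v | u v. u \<in> \<phi> ` J_eigen e d \<and> v \<in> J_eigen (- e) c}"
    then show "f \<in> K" using K_add \<phi>_K Mc_K by blast
  qed
  ultimately show ?thesis
    unfolding is_direct_sum_def K_def[symmetric] using M_sub by blast
qed

end

section \<open>Orders of vanishing and kernels of Toeplitz operators\<close>

context hardy
begin

lemma fourier_sum:
  assumes "finite I" "\<And>i. i \<in> I \<Longrightarrow> f i \<in> L"
  shows "(\<Sum>i\<in>I. f i) \<in> L" "fourier (\<Sum>i\<in>I. f i) n = (\<Sum>i\<in>I. fourier (f i) n)"
  using assms by (induction I rule: finite_induct) (auto simp: L_add L_fourier_add)

definition has_order :: "circ_fun \<Rightarrow> nat \<Rightarrow> bool" where
  "has_order f v \<longleftrightarrow> fourier f (int v) \<noteq> 0 \<and> (\<forall>i<v. fourier f (int i) = 0)"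

lemma has_order_exists:
  assumes "f \<in> H" "f \<noteq> 0"
  obtains v where "has_order f v"
proof -
  obtain n where n: "fourier f n \<noteq> 0"
    using fourier_unique[OF p_gt_1 H_L[OF assms(1)]] assms(2) by blast
  then have "0 \<le> n" using assms(1) unfolding Hp_def by force
  then have "\<exists>v. fourier f (int v) \<noteq> 0" using n by (metis zero_le_imp_eq_int)
  then have "has_order f (LEAST v. fourier f (int v) \<noteq> 0)"
    unfolding has_order_def by (metis (mono_tags, lifting) LeastI not_less_Least)
  then show thesis using that by blast
qed

text \<open>The coefficients are triangular. In a vanishing combination, look at index v: functions
  of higher order do not contribute, and the scalars of those of lower order are already known to be
  0.\<close>

lemma independent_has_order:
  assumes "finite D" "\<And>v. v \<in> D \<Longrightarrow> F v \<in> L" "\<And>v. v \<in> D \<Longrightarrow> has_order (F v) v"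
  shows "inj_on F D" "circ_fun.independent (F ` D)"
proof -
  show inj: "inj_on F D"
    by (rule inj_onI) (metis assms(3) has_order_def linorder_neqE_nat)
  show "circ_fun.independent (F ` D)"
  proof (rule circ_fun.independent_if_scalars_zero)
    show "finite (F ` D)" using assms(1) by simp
    fix u y assume sum: "(\<Sum>y\<in>F ` D. cscale (u y) y) = 0" and "y \<in> F ` D"
    then have sum': "(\<Sum>v\<in>D. cscale (u (F v)) (F v)) = 0"
      by (simp add: sum.reindex[OF inj])
    have "u (F v) = 0" if "v \<in> D" for v
      using that
    proof (induction v rule: less_induct)
      case (less v)
      have "0 = (\<Sum>w\<in>D. u (F w) * fourier (F w) (int v))"
        using fourier_sum(2)[OF assms(1), of "\<lambda>v. cscale (u (F v)) (F v)" "int v"]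
        by (simp add: sum' assms(2) Lp_cscale fourier_cscale)
      also have "\<dots> = (\<Sum>w\<in>D. if w = v then u (F v) * fourier (F v) (int v) else 0)"
      proof (rule sum.cong[OF refl])
        fix w assume w: "w \<in> D"
        consider "w < v" | "w = v" | "v < w" by linarith
        then show "u (F w) * fourier (F w) (int v) = (if w = v then u (F v) * fourier (F v) (int v) else 0)"
        proof cases
          case 1
          then show ?thesis using less.IH[OF 1 w] by simp
        next
          case 3
          then show ?thesis using assms(3)[OF w] by (simp add: has_order_def)
        qed simp
      qed
      also have "\<dots> = u (F v) * fourier (F v) (int v)"
        using assms(1) less.prems by simp
      finally show ?case using assms(3)[OF less.prems] by (simp add: has_order_def)
    qed
    then show "u y = 0" using \<open>y \<in> F ` D\<close> by blast
  qed
qed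

lemma H_shift_down:
  assumes "f \<in> H" "\<And>i. i < k \<Longrightarrow> fourier f (int i) = 0"
  shows "tpow (- int k) * f \<in> H"
proof -
  have "fourier f (n + int k) = 0" if "n < 0" for n
  proof (cases "n + int k < 0")
    case True
    then show ?thesis using assms(1) by (simp add: Hp_def)
  next
    case False
    then obtain i where i: "n + int k = int i" by (metis not_less zero_le_imp_eq_int)
    then have "i < k" using that by linarith
    then show ?thesis using assms(2) i by simp
  qed
  then show ?thesis
    using assms(1) by (simp add: Hp_def L_mult Linf_tpow fourier_tpow_mult)
qed

lemma H_shift_up: "f \<in> H \<Longrightarrow> tpow (int k) * f \<in> H"
  by (auto simp: Hp_def L_mult Linf_tpow fourier_tpow_mult)

lemma Hm_shift_down: "f \<in> Hm \<Longrightarrow> tpow (- int k) * f \<in> Hm"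
  by (auto simp: Hm_def L_mult Linf_tpow fourier_tpow_mult)

lemma tpow_cancel: "tpow k * (tpow (- k) * f) = f" "tpow (- k) * (tpow k * f) = f"
  by (simp_all add: mult.assoc[symmetric] tpow_add)

abbreviation ker :: "circ_fun \<Rightarrow> circ_fun set" where
  "ker c \<equiv> op_kernel p (T c)"

lemma ker_iff: "c \<in> Linf \<Longrightarrow> f \<in> ker c \<longleftrightarrow> f \<in> H \<and> c * f \<in> Hm"
  by (auto simp: op_kernel_def T_eq_zero_iff)

lemma ker_subspace: "c \<in> Linf \<Longrightarrow> circ_fun.subspace (ker c)"
  by (auto simp: circ_fun.subspace_def op_kernel_def H_zero H_add H_cscale T_add T_cscale)
     (simp add: toeplitz_def P_ident H_zero)

text \<open>Near invariance: the vanishing coefficients keep the quotient analytic, and multiplying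
  c f by a negative power of t leaves it in \<open>Hm\<close>.\<close>

lemma ker_shift_down:
  assumes "c \<in> Linf" "f \<in> ker c" "\<And>i. i < k \<Longrightarrow> fourier f (int i) = 0"
  shows "tpow (- int k) * f \<in> ker c"
  using assms H_shift_down[of f k] Hm_shift_down[of "c * f" k]
  by (simp add: ker_iff mult.left_commute)

text \<open>The kernel of a Toeplitz operator is nearly invariant under the backward shift, so the orders
  of vanishing of its elements at the origin form an initial segment \<open>{..<m}\<close>, where \<open>m\<close> is its
  dimension. Hence \<open>H\<^sup>p\<close> is the direct sum of the kernel and \<open>t\<^sup>m H\<^sup>p\<close>.\<close>

lemma ker_complement:
  assumes c: "c \<in> Linf" and fin: "finite_dim (ker c)"
  shows "\<And>f. f \<in> ker c \<Longrightarrow> (\<And>i. i < circ_fun.dim (ker c) \<Longrightarrow> fourier f (int i) = 0) \<Longrightarrow> f = 0"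
    and "\<And>f. f \<in> H \<Longrightarrow> \<exists>k\<in>ker c. \<forall>i<circ_fun.dim (ker c). fourier (f - k) (int i) = 0"
proof -
  obtain B where B: "finite B" "ker c \<subseteq> circ_fun.span B"
    using fin by (auto simp: finite_dim_def)
  have kH: "f \<in> H" if "f \<in> ker c" for f
    using that by (simp add: op_kernel_def)
  have kL: "f \<in> L" if "f \<in> ker c" for f
    using kH[OF that] H_L by blast
  define D where "D = {v. \<exists>f\<in>ker c. has_order f v}"
  then have "\<forall>v\<in>D. \<exists>f. f \<in> ker c \<and> has_order f v" by blast
  from bchoice[OF this] obtain F
    where F: "\<And>v. v \<in> D \<Longrightarrow> F v \<in> ker c" "\<And>v. v \<in> D \<Longrightarrow> has_order (F v) v"
    by blast
  \<comment> \<open>Kernel elements of distinct orders are independent, so a finite spanning set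
    bounds the number of orders.\<close>
  have card_le: "card E \<le> card B" if "E \<subseteq> D" "finite E" for E
  proof -
    have 1: "inj_on F E" "circ_fun.independent (F ` E)"
      by (rule independent_has_order; use that F kL in auto)+
    have "F ` E \<subseteq> circ_fun.span B" using that F B by blast
    then have "card (F ` E) \<le> card B"
      using circ_fun.independent_span_bound[OF B(1) 1(2)] by blast
    then show ?thesis using 1 by (simp add: card_image)
  qed
  have finD: "finite D"
    by (metis card_le finite_if_finite_subsets_card_bdd)
  \<comment> \<open>Dividing F v by t^(v - i) lowers its order to i without leaving the
    kernel.\<close>
  have down: "i \<in> D" if "v \<in> D" "i < v" for v i
  proof -
    have v: "F v \<in> ker c" "has_order (F v) v" using F that by auto
    define k where "k = v - i"
    have k: "v = i + k" using that by (simp add: k_def)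
    have "tpow (- int k) * F v \<in> ker c"
      using v k by (intro ker_shift_down c) (auto simp: has_order_def)
    moreover have shift: "fourier (tpow (- int k) * F v) (int l) = fourier (F v) (int (l + k))" for l
      by (simp add: fourier_tpow_mult)
    have "has_order (tpow (- int k) * F v) i"
      using v(2) unfolding has_order_def shift by (simp add: k del: of_nat_add)
    ultimately show ?thesis by (auto simp: D_def)
  qed
  obtain m where D: "D = {..<m}"
  proof -
    have "D = {..<card D}"
    proof (rule card_subset_eq[symmetric])
      show "{..<card D} \<subseteq> D"
      proof (rule ccontr)
        assume "\<not> {..<card D} \<subseteq> D"
        then obtain i where i: "i < card D" "i \<notin> D" by auto
        then have "D \<subseteq> {..<i}" using down by (metis lessThan_iff linorder_neqE_nat subsetI)
        then have "card D \<le> i" by (metis card_lessThan card_mono finite_lessThan)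
        then show False using i by simp
      qed
    qed (use finD in auto)
    then show thesis using that by blast
  qed
  have zero: "f = 0" if "f \<in> ker c" "\<And>i. i < m \<Longrightarrow> fourier f (int i) = 0" for f
  proof (rule ccontr)
    assume "f \<noteq> 0"
    then obtain v where v: "has_order f v"
      using has_order_exists[OF kH[OF \<open>f \<in> ker c\<close>]] by blast
    then have "v \<in> D" using \<open>f \<in> ker c\<close> by (auto simp: D_def)
    then show False
      using \<open>\<And>i. i < m \<Longrightarrow> fourier f (int i) = 0\<close>[of v] v D by (simp add: has_order_def)
  qed
  let ?S = "circ_fun.span (F ` {..<m})"
  have S: "?S \<subseteq> ker c"
    using F D by (intro circ_fun.span_minimal ker_subspace c) auto
  \<comment> \<open>Gaussian elimination: subtracting a multiple of F j removes coefficient j and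
    leaves the earlier ones alone.\<close>
  have elim: "\<exists>k\<in>?S. \<forall>i<j. fourier (f - k) (int i) = 0" if "f \<in> H" "j \<le> m" for f j
    using that(2)
  proof (induction j)
    case 0
    show ?case by (intro bexI[of _ 0]) (auto simp: circ_fun.span_zero)
  next
    case (Suc j)
    then obtain k where k: "k \<in> ?S" "\<And>i. i < j \<Longrightarrow> fourier (f - k) (int i) = 0" by auto
    have j: "has_order (F j) j" "F j \<in> ker c" "F j \<in> ?S"
      using Suc.prems F D by (auto intro: circ_fun.span_base)
    define z where "z = fourier (f - k) (int j) / fourier (F j) (int j)"
    have "fourier (f - (k + cscale z (F j))) (int i) = 0" if "i < Suc j" for i
    proof -
      have "f - k \<in> L" using k(1) S kL \<open>f \<in> H\<close> by (intro L_diff) (auto simp: H_L)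
      moreover have "cscale z (F j) \<in> L" using j kL by (simp add: Lp_cscale)
      ultimately have "fourier (f - (k + cscale z (F j))) (int i) =
          fourier (f - k) (int i) - z * fourier (F j) (int i)"
        using L_fourier_diff[of "f - k" "cscale z (F j)" "int i"]
        by (simp add: fourier_cscale diff_diff_eq)
      then show ?thesis
        using that k(2) j(1) by (auto simp: has_order_def z_def less_Suc_eq)
    qed
    moreover have "k + cscale z (F j) \<in> ?S"
      using k j by (intro circ_fun.span_add circ_fun.span_scale) auto
    ultimately show ?case by blast
  qed
  \<comment> \<open>After elimination the remainder is a kernel element whose first m coefficients
    vanish, hence 0. So the F v form a basis, and m is the dimension.\<close>
  have "ker c \<subseteq> ?S"
  proof
    fix f assume f: "f \<in> ker c"
    then obtain k where k: "k \<in> ?S" "\<forall>i<m. fourier (f - k) (int i) = 0"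
      using elim[of f m] kH by blast
    then have "f - k \<in> ker c"
      using f S ker_subspace[OF c] by (blast intro: circ_fun.subspace_diff)
    then have "f - k = 0" using zero k by blast
    then show "f \<in> ?S" using k by simp
  qed
  moreover have "inj_on F {..<m}" "circ_fun.independent (F ` {..<m})"
    by (rule independent_has_order; use F D kL in auto)+
  ultimately have dim: "circ_fun.dim (ker c) = m"
    using F D by (intro circ_fun.dim_unique[of "F ` {..<m}"]) (auto simp: card_image)
  show "f = 0" if "f \<in> ker c" "\<And>i. i < circ_fun.dim (ker c) \<Longrightarrow> fourier f (int i) = 0" for f
    using zero that unfolding dim by blast
  show "\<exists>k\<in>ker c. \<forall>i<circ_fun.dim (ker c). fourier (f - k) (int i) = 0" if "f \<in> H" for f
    using elim[OF that, of m] S unfolding dim by blast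
qed

end

section \<open>The prescribed right inverse\<close>

context hardy
begin

text \<open>With an infinite-dimensional kernel the claims are part of the choice of R. Otherwise R
  f is the preimage of t^m f under A = T(c t^m); the work is to show that A is bijective on H, and
  linearity of R then follows by injectivity.\<close>

lemma toeplitz_right_inverse_props:
  assumes c: "c \<in> Linf" and inv: "right_invertible p (T c)" and R: "toeplitz_right_inverse p c R"
  shows "f \<in> H \<Longrightarrow> R f \<in> H"
    and "f \<in> H \<Longrightarrow> g \<in> H \<Longrightarrow> R (f + g) = R f + R g"
    and "f \<in> H \<Longrightarrow> R (cscale z f) = cscale z (R f)"
    and "f \<in> H \<Longrightarrow> T c (R f) = f"
proof -
  have "(\<forall>f\<in>H. R f \<in> H) \<and> (\<forall>f\<in>H. \<forall>g\<in>H. R (f + g) = R f + R g) \<and>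
      (\<forall>f\<in>H. \<forall>z. R (cscale z f) = cscale z (R f)) \<and> (\<forall>f\<in>H. T c (R f) = f)"
  proof (cases "finite_dim (ker c)")
    case False
    then have "right_inverse p (T c) R"
      using R by (simp add: toeplitz_right_inverse_def)
    then show ?thesis
      by (simp add: right_inverse_def bounded_operator_def)
  next
    case True
    obtain S where "right_inverse p (T c) S"
      using inv by (auto simp: right_invertible_def)
    then have S: "S f \<in> H" "T c (S f) = f" if "f \<in> H" for f
      using that by (auto simp: right_inverse_def bounded_operator_def)
    have onto: "f \<in> T c ` H" if "f \<in> H" for f
      using S[OF that] by (metis imageI)
    \<comment> \<open>T(c) is onto, so the empty set spans the cokernel, the index is the dimension
      of the kernel, and the range is closed because it is all of H.\<close>
    have span0: "spans_coker p (T c) {}"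
      unfolding spans_coker_def using onto by (auto intro: circ_fun.span_base)
    have "coker_dim p (T c) = 0"
      unfolding coker_dim_def by (rule Least_eq_0) (use span0 in auto)
    then have index: "fredholm_index p (T c) = int (circ_fun.dim (ker c))"
      by (simp add: fredholm_index_def)
    have "fredholm p (T c)"
      unfolding fredholm_def closed_range_def using True onto span0 by blast
    define m where "m = circ_fun.dim (ker c)"
    define A where "A = T (c * tpow (int m))"
    have R_eq: "R f = inv_into H A (T (tpow (int m)) f)" if "f \<in> H" for f
      using R that \<open>fredholm p (T c)\<close> inv
      by (simp add: toeplitz_right_inverse_def index A_def m_def Let_def)
    note F = ker_complement[OF c True, folded m_def]
    have cm: "c * tpow (int m) \<in> Linf" by (intro Linf_mult c Linf_tpow)
    have A_eq: "A f = T c (tpow (int m) * f)" for f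
      by (simp add: A_def toeplitz_def mult.assoc)
    have A_zero: "f = 0" if "f \<in> H" "A f = 0" for f
    proof -
      have "tpow (int m) * f \<in> ker c"
        using that by (simp add: op_kernel_def H_shift_up A_eq)
      moreover have "fourier (tpow (int m) * f) (int i) = 0" if "i < m" for i
        using \<open>f \<in> H\<close> that by (simp add: fourier_tpow_mult Hp_def)
      ultimately have "tpow (int m) * f = 0" using F(1) by blast
      then show ?thesis using tpow_cancel(2)[of "int m" f] by simp
    qed
    have inj: "inj_on A H"
    proof (rule inj_onI)
      fix f g assume "f \<in> H" "g \<in> H" "A f = A g"
      then have "A (f - g) = 0" unfolding A_def by (simp add: T_diff[OF cm])
      then show "f = g" using A_zero[of "f - g"] \<open>f \<in> H\<close> \<open>g \<in> H\<close> by (simp add: H_diff)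
    qed
    \<comment> \<open>Any solution S g of T(c) u = g can be corrected by a kernel element until t^m
      divides it; the quotient is a preimage under A.\<close>
    have surj: "g \<in> A ` H" if gH: "g \<in> H" for g
    proof -
      obtain k where k: "k \<in> ker c" "\<And>i. i < m \<Longrightarrow> fourier (S g - k) (int i) = 0"
        using F(2)[OF S(1)[OF gH]] by blast
      have kH: "k \<in> H" "T c k = 0" using k(1) by (auto simp: op_kernel_def)
      define h where "h = tpow (- int m) * (S g - k)"
      have "h \<in> H"
        unfolding h_def using k(2) kH S(1)[OF gH] by (intro H_shift_down H_diff) auto
      moreover have "A h = g"
        unfolding A_eq h_def tpow_cancel using S[OF gH] kH by (simp add: T_diff[OF c])
      ultimately show ?thesis by blast
    qed
    have TH: "T (tpow (int m)) f = tpow (int m) * f" if "f \<in> H" for f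
      by (simp add: toeplitz_def P_ident H_shift_up that)
    have RH: "R f \<in> H" and AR: "A (R f) = tpow (int m) * f" if "f \<in> H" for f
      using surj[OF H_shift_up[OF that]] by (simp_all add: R_eq TH that inv_into_into f_inv_into_f)
    have "R (f + g) = R f + R g" if "f \<in> H" "g \<in> H" for f g
    proof (rule inj_onD[OF inj])
      have "A (R f + R g) = A (R f) + A (R g)"
        unfolding A_def using that RH by (simp add: T_add[OF cm])
      then show "A (R (f + g)) = A (R f + R g)"
        using that by (simp add: AR H_add distrib_left)
    qed (use that RH H_add in auto)
    moreover have "R (cscale z f) = cscale z (R f)" if "f \<in> H" for f z
    proof (rule inj_onD[OF inj])
      have "A (cscale z (R f)) = cscale z (A (R f))"
        unfolding A_def using that RH by (simp add: T_cscale[OF cm])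
      then show "A (R (cscale z f)) = A (cscale z (R f))"
        using that by (simp add: AR H_cscale mult_cscale)
    qed (use that RH H_cscale in auto)
    \<comment> \<open>A (R f) = t^m f says that t^m (c R f - f) lies in \<open>Hm\<close>. Division
      by t^m stays in \<open>Hm\<close>, so P annihilates c R f - f.\<close>
    moreover have "T c (R f) = f" if "f \<in> H" for f
    proof -
      have L: "c * tpow (int m) * R f \<in> L" "c * R f \<in> L"
        using L_mult[OF cm H_L[OF RH[OF that]]] L_mult[OF c H_L[OF RH[OF that]]] by auto
      have "P (c * tpow (int m) * R f) = P (tpow (int m) * f)"
        using AR[OF that] by (simp add: A_def toeplitz_def P_ident H_shift_up that)
      then have "c * tpow (int m) * R f - tpow (int m) * f \<in> Hm"
        using L H_L[OF H_shift_up[OF that, of m]] by (subst P_eq_zero_iff[symmetric]) (auto simp: L_diff P_diff)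
      from Hm_shift_down[OF this, of m] have "c * R f - f \<in> Hm"
        using tpow_cancel(2)[of "int m" "c * R f"] tpow_cancel(2)[of "int m" f]
        by (simp add: right_diff_distrib mult_ac)
      then have "P (c * R f) - P f = 0"
        using L H_L[OF that] by (subst P_diff[symmetric]) (auto simp: P_eq_zero_iff L_diff)
      then show ?thesis by (simp add: toeplitz_def P_ident that)
    qed
    ultimately show ?thesis using RH by blast
  qed
  then show "f \<in> H \<Longrightarrow> R f \<in> H"
    and "f \<in> H \<Longrightarrow> g \<in> H \<Longrightarrow> R (f + g) = R f + R g"
    and "f \<in> H \<Longrightarrow> R (cscale z f) = cscale z (R f)"
    and "f \<in> H \<Longrightarrow> T c (R f) = f"
    by blast+
qed

end

theorem proposition3p7:
  fixes p :: real
    and a b c d :: circ_fun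
    and R :: "circ_fun \<Rightarrow> circ_fun"
  assumes "1 < p"
    and "matching_pair a b"
    and "subordinated_pair a b c d"
    and "right_invertible p (toeplitz p c)"
    and "toeplitz_right_inverse p c R"
  shows "is_direct_sum (op_kernel p (\<lambda>f. toeplitz p a f + hankel p b f))
           (phi_plus p a c R ` im_PP_plus p d) (im_PP_minus p c) \<and>
         is_direct_sum (op_kernel p (\<lambda>f. toeplitz p a f - hankel p b f))
           (phi_minus p a c R ` im_PP_minus p d) (im_PP_plus p c)"
proof -
  interpret hardy p by unfold_locales fact
  from \<open>matching_pair a b\<close> obtain ai where a: "a \<in> Linf" "ai \<in> Linf" "a * ai = 1"
    and b: "b \<in> Linf" and match: "a * tilde a = b * tilde b"
    by (auto simp: matching_pair_def GLinf_def)
  \<comment> \<open>Matching gives b * tilde b = a * tilde a, whose inverse is ai * tilde ai;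
    multiplied by tilde b it becomes a bounded inverse of b.\<close>
  define bi where "bi = tilde b * (ai * tilde ai)"
  have ta: "tilde a * tilde ai = 1" using a(3) by (simp flip: tilde_mult)
  have "b * bi = (b * tilde b) * (ai * tilde ai)"
    by (simp add: bi_def mult.assoc)
  also have "\<dots> = (a * ai) * (tilde a * tilde ai)"
    unfolding match[symmetric] by (simp add: mult_ac)
  finally have bi: "bi \<in> Linf" "b * bi = 1"
    using a b ta by (auto simp: bi_def Linf_mult Linf_tilde)
  have c: "c = a * bi" and d: "d = b * tilde ai"
    using \<open>subordinated_pair a b c d\<close> inverse_eqI[OF bi(2)] inverse_eqI[OF ta]
    by (simp_all add: subordinated_pair_def)
  have tb: "tilde b * tilde bi = 1" using bi(2) by (simp flip: tilde_mult)
  have "c * tilde c = (a * tilde a) * (bi * tilde bi)"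
    by (simp add: c tilde_mult mult_ac)
  also have "\<dots> = (b * bi) * (tilde b * tilde bi)"
    unfolding match by (simp add: mult_ac)
  finally have cc: "c * tilde c = 1" by (simp add: bi tb)
  have "d * tilde d = (b * tilde b) * (ai * tilde ai)"
    by (simp add: d tilde_mult mult_ac)
  also have "\<dots> = (a * ai) * (tilde a * tilde ai)"
    unfolding match[symmetric] by (simp add: mult_ac)
  finally have dd: "d * tilde d = 1" by (simp add: a ta)
  have cL: "c \<in> Linf" and dL: "d \<in> Linf"
    using a b bi by (simp_all add: c d Linf_mult Linf_tilde)
  note R = toeplitz_right_inverse_props[OF cL assms(4,5)]
  note main = kernel_direct_sum[OF a(1) b a(2) bi(1) a(3) bi(2) match c d R]
  \<comment> \<open>For f in H the function J f already lies in \<open>Hm\<close>, so the Q inside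
    the Hankel operator acts as the identity.\<close>
  have T_H: "toeplitz p a f + e * hankel p b f = P (a * f + e * (b * flipJ f))"
    if "f \<in> H" "e = 1 \<or> e = -1" for f e
  proof -
    have "a * f \<in> L" "b * flipJ f \<in> L"
      using that a b by (auto intro!: L_mult Lp_flipJ simp: H_L)
    then show ?thesis
      using that P_add[of "a * f" "b * flipJ f"] P_diff[of "a * f" "b * flipJ f"]
      by (auto simp: toeplitz_def hankel_def Q_ident flipJ_H)
  qed
  have K: "op_kernel p (\<lambda>f. toeplitz p a f + e * hankel p b f) =
      {f \<in> H. P (a * f + e * (b * flipJ f)) = 0}" if "e = 1 \<or> e = -1" for e
    unfolding op_kernel_def by (intro Collect_cong conj_cong refl) (simp only: T_H[OF _ that])
  show ?thesis
    using main[of 1] main[of "-1"] K[of 1] K[of "-1"] inverse_eqI[OF ta]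
    by (simp add: im_PP_plus_eq[OF cL cc] im_PP_minus_eq[OF cL cc]
        im_PP_plus_eq[OF dL dd] im_PP_minus_eq[OF dL dd] phi_plus_def[abs_def] phi_minus_def[abs_def])
qed

end
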